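(* There exists a smooth real Fano threefold $X$ belonging to family № 2.12 whose real locus $X(\mathbb{R})$ is disconnected.
   Context: A real variety is a geometrically integral projective scheme over $\mathbb{R}$; $X_{\mathbb{C}}$ is its base change to $\mathbb{C}$, and $X(\mathbb{R})$ carries the Euclidean topology. A smooth real Fano threefold $X$ belongs to family № 2.12 (Mori–Mukai numbering) if $X_{\mathbb{C}}$ is isomorphic to a smooth complete intersection of three divisors of bidegree $(1,1)$ in $\mathbb{P}^3_{\mathbb{C}}\times\mathbb{P}^3_{\mathbb{C}}$ (so $\rho(X_{\mathbb{C}})=2$, $(-K_X)^3=20$, $h^{1,2}=3$). *)

theory Defs
  imports "HOL-Analysis.Analysis"
begin

text \<open>
  Varieties are treated in the classical language. A geometrically integral projective scheme
  over \<open>\<real>\<close>, embedded in \<open>P\<^sup>n\<close>, is determined by its set of complex points, which is an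
  irreducible closed subset of \<open>P\<^sup>n(\<complex>)\<close> cut out by homogeneous polynomials with real
  coefficients; conversely every such subset comes from a unique such scheme (in characteristic 0
  reduced implies geometrically reduced). The same subset, with the real structure forgotten, is
  the base change to \<open>\<complex>\<close>.

  A point of \<open>P\<^sup>n\<close> is the set of its homogeneous coordinate vectors; vectors with coordinates
  \<open>0, \<dots>, n\<close> are functions on \<open>nat\<close> vanishing beyond \<open>n\<close>.
\<close>

type_synonym 'a point = "(nat \<Rightarrow> 'a) set"

definition coord_vecs :: "nat \<Rightarrow> (nat \<Rightarrow> 'a::field) set" where
  "coord_vecs n = {v. (\<forall>i>n. v i = 0) \<and> v \<noteq> (\<lambda>_. 0)}"

definition pt :: "(nat \<Rightarrow> 'a::field) \<Rightarrow> 'a point" where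
  "pt v = {(\<lambda>i. c * v i) | c. c \<noteq> 0}"

definition proj_space :: "nat \<Rightarrow> 'a::field point set" where
  "proj_space n = pt ` coord_vecs n"


section \<open>Zariski topology\<close>

text \<open>Homogeneous polynomials of degree \<open>d\<close> in \<open>x\<^sub>0, \<dots>, x\<^sub>n\<close> with coefficients in the subring \<open>K\<close>
  (here always \<open>\<real>\<close> or \<open>UNIV\<close>), identified with the functions they induce.\<close>

inductive form :: "complex set \<Rightarrow> nat \<Rightarrow> nat \<Rightarrow> ((nat \<Rightarrow> complex) \<Rightarrow> complex) \<Rightarrow> bool"
  for K :: "complex set" and n :: nat where
  const: "c \<in> K \<Longrightarrow> form K n 0 (\<lambda>_. c)"
| coord: "i \<le> n \<Longrightarrow> form K n 1 (\<lambda>v. v i)"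
| add: "form K n d F \<Longrightarrow> form K n d G \<Longrightarrow> form K n d (\<lambda>v. F v + G v)"
| mult: "form K n d F \<Longrightarrow> form K n e G \<Longrightarrow> form K n (d + e) (\<lambda>v. F v * G v)"

definition zariski_closed :: "complex set \<Rightarrow> nat \<Rightarrow> complex point set \<Rightarrow> bool" where
  "zariski_closed K n Z \<longleftrightarrow>
     (\<exists>S. (\<forall>F\<in>S. \<exists>d. form K n d F) \<and> Z = {p \<in> proj_space n. \<forall>F\<in>S. \<forall>v\<in>p. F v = 0})"

definition zariski_open_in :: "nat \<Rightarrow> complex point set \<Rightarrow> complex point set \<Rightarrow> bool" where
  "zariski_open_in n X U \<longleftrightarrow> (\<exists>Z. zariski_closed UNIV n Z \<and> U = X - Z)"

definition zariski_irreducible :: "nat \<Rightarrow> complex point set \<Rightarrow> bool" where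
  "zariski_irreducible n X \<longleftrightarrow> X \<noteq> {} \<and>
     (\<forall>A B. zariski_closed UNIV n A \<and> zariski_closed UNIV n B \<and> X \<subseteq> A \<union> B
        \<longrightarrow> X \<subseteq> A \<or> X \<subseteq> B)"

definition real_variety :: "nat \<Rightarrow> complex point set \<Rightarrow> bool" where
  "real_variety n X \<longleftrightarrow> zariski_closed \<real> n X \<and> zariski_irreducible n X"


section \<open>Regular functions and isomorphisms\<close>

text \<open>Only the values of \<open>f\<close> on the open subset \<open>U\<close> of the variety matter.\<close>

definition regular_on :: "nat \<Rightarrow> complex point set \<Rightarrow> (complex point \<Rightarrow> complex) \<Rightarrow> bool" where
  "regular_on n U f \<longleftrightarrow>
     (\<forall>p\<in>U. \<exists>d F G. form UNIV n d F \<and> form UNIV n d G \<and> (\<forall>v\<in>p. G v \<noteq> 0) \<and>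
        (\<forall>q\<in>U. \<forall>v\<in>q. G v \<noteq> 0 \<longrightarrow> f q = F v / G v))"

text \<open>Isomorphism of the ringed spaces \<open>X \<subseteq> P\<^sup>n\<close> and \<open>Y \<subseteq> P\<^sup>m\<close>: a homeomorphism identifying the
  sheaves of regular functions.\<close>

definition variety_iso ::
  "nat \<Rightarrow> complex point set \<Rightarrow> nat \<Rightarrow> complex point set \<Rightarrow> (complex point \<Rightarrow> complex point) \<Rightarrow> bool"
  where
  "variety_iso n X m Y \<phi> \<longleftrightarrow> bij_betw \<phi> X Y \<and>
     (\<forall>V\<subseteq>Y. zariski_open_in m Y V \<longleftrightarrow> zariski_open_in n X (X \<inter> \<phi> -` V)) \<and>
     (\<forall>V. zariski_open_in m Y V \<longrightarrow>
        (\<forall>f. regular_on m V f \<longleftrightarrow> regular_on n (X \<inter> \<phi> -` V) (f \<circ> \<phi>)))"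


section \<open>Smoothness\<close>

definition partial :: "nat \<Rightarrow> ((nat \<Rightarrow> complex) \<Rightarrow> complex) \<Rightarrow> (nat \<Rightarrow> complex) \<Rightarrow> complex" where
  "partial j F v = deriv (\<lambda>t. F (v(j := t))) (v j)"

text \<open>Smoothness of relative dimension \<open>d\<close> by the Jacobian criterion: near each point, \<open>X\<close> is cut
  out in \<open>P\<^sup>n\<close> by \<open>n - d\<close> equations whose differentials are linearly independent at that point.
  The scheme defined by such equations is smooth, hence reduced, near the point, so it is enough to
  compare zero sets. By Euler's relation the rank on the affine cone equals the rank in an
  affine chart. The condition includes that \<open>X\<close> has pure dimension \<open>d\<close>.\<close>

definition smooth_of_dim :: "nat \<Rightarrow> nat \<Rightarrow> complex point set \<Rightarrow> bool" where
  "smooth_of_dim d n X \<longleftrightarrow> d \<le> n \<and>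
     (\<forall>p\<in>X. \<exists>G e F. (\<exists>k. form UNIV n k G) \<and> (\<forall>v\<in>p. G v \<noteq> 0) \<and>
        (\<forall>i<n - d. form UNIV n (e i) (F i)) \<and>
        (\<forall>q\<in>proj_space n. (\<forall>v\<in>q. G v \<noteq> 0) \<longrightarrow> (q \<in> X \<longleftrightarrow> (\<forall>i<n - d. \<forall>v\<in>q. F i v = 0))) \<and>
        (\<forall>v\<in>p. \<forall>c. (\<forall>j\<le>n. (\<Sum>i<n - d. c i * partial j (F i) v) = 0) \<longrightarrow> (\<forall>i<n - d. c i = 0)))"


section \<open>Fano varieties\<close>

text \<open>
  Let \<open>X\<close> be smooth of dimension \<open>d\<close>, with canonical bundle \<open>\<omega> = \<Lambda>\<^sup>d \<Omega>\<close>. By the universal properties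
  of differentials, tensor and exterior powers, a global section of \<open>\<omega>\<^sup>-\<^sup>m = Hom(\<omega>\<^sup>m, O)\<close> is the same
  as a family of maps sending \<open>d * m\<close> regular functions \<open>f 0, f 1, \<dots>\<close> on an open set \<open>U\<close>, grouped in
  \<open>m\<close> consecutive blocks of length \<open>d\<close>, to the regular function given by the value on
  \<open>(df 0 \<and> \<dots> \<and> df (d-1)) \<otimes> \<dots> \<otimes> (df (dm-d) \<and> \<dots> \<and> df (dm-1))\<close>: it is compatible with
  restriction, a \<open>\<complex>\<close>-derivation in every argument, and alternating in each block.
\<close>

definition anticanonical_section ::
  "nat \<Rightarrow> nat \<Rightarrow> nat \<Rightarrow> complex point set \<Rightarrow>
   (complex point set \<Rightarrow> (nat \<Rightarrow> complex point \<Rightarrow> complex) \<Rightarrow> complex point \<Rightarrow> complex) \<Rightarrow> bool"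
  where
  "anticanonical_section d m n X D \<longleftrightarrow>
     (\<forall>U f. zariski_open_in n X U \<and> (\<forall>i<d*m. regular_on n U (f i)) \<longrightarrow> regular_on n U (D U f)) \<and>
     (\<forall>U V f g. zariski_open_in n X U \<and> zariski_open_in n X V \<and> V \<subseteq> U \<and>
        (\<forall>i<d*m. regular_on n U (f i) \<and> regular_on n V (g i) \<and> (\<forall>p\<in>V. f i p = g i p)) \<longrightarrow>
        (\<forall>p\<in>V. D U f p = D V g p)) \<and>
     (\<forall>U f i a b c. zariski_open_in n X U \<and> (\<forall>j<d*m. regular_on n U (f j)) \<and> i < d*m \<and>
        regular_on n U a \<and> regular_on n U b \<longrightarrow>
        (\<forall>p\<in>U. D U (f(i := (\<lambda>q. a q + b q))) p = D U (f(i := a)) p + D U (f(i := b)) p \<and>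
                D U (f(i := (\<lambda>q. a q * b q))) p = a p * D U (f(i := b)) p + b p * D U (f(i := a)) p \<and>
                D U (f(i := (\<lambda>_. c))) p = 0)) \<and>
     (\<forall>U f i j. zariski_open_in n X U \<and> (\<forall>k<d*m. regular_on n U (f k)) \<and>
        i < d*m \<and> j < d*m \<and> i \<noteq> j \<and> i div d = j div d \<and> (\<forall>p\<in>U. f i p = f j p) \<longrightarrow>
        (\<forall>p\<in>U. D U f p = 0))"

text \<open>The map \<open>\<phi>\<close> is \<open>[s 0 : \<dots> : s M]\<close>. As \<open>\<omega>\<^sup>-\<^sup>m\<close> is a line bundle, the homogeneous coordinates
  of \<open>\<phi> p\<close> may be computed by evaluating all \<open>s j\<close> at \<open>p\<close> on the same arguments \<open>f\<close>, as long as some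
  value is nonzero; the latter is ensured by \<open>\<phi> ` X \<subseteq> P\<^sup>M\<close>.\<close>

definition anticanonical_power_very_ample :: "nat \<Rightarrow> nat \<Rightarrow> nat \<Rightarrow> complex point set \<Rightarrow> bool" where
  "anticanonical_power_very_ample d m n X \<longleftrightarrow>
     (\<exists>M s \<phi>. (\<forall>j\<le>M. anticanonical_section d m n X (s j)) \<and>
        zariski_closed UNIV M (\<phi> ` X) \<and> variety_iso n X M (\<phi> ` X) \<phi> \<and>
        (\<forall>p\<in>X. \<exists>U f. zariski_open_in n X U \<and> p \<in> U \<and> (\<forall>i<d*m. regular_on n U (f i)) \<and>
           \<phi> p = pt (\<lambda>j. if j \<le> M then s j U f p else 0)))"

definition smooth_fano :: "nat \<Rightarrow> nat \<Rightarrow> complex point set \<Rightarrow> bool" where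
  "smooth_fano d n X \<longleftrightarrow> smooth_of_dim d n X \<and> (\<exists>m>0. anticanonical_power_very_ample d m n X)"


section \<open>Family 2.12\<close>

definition bilin :: "(nat \<Rightarrow> nat \<Rightarrow> complex) \<Rightarrow> (nat \<Rightarrow> complex) \<Rightarrow> (nat \<Rightarrow> complex) \<Rightarrow> complex" where
  "bilin a x y = (\<Sum>j\<le>3. \<Sum>k\<le>3. a j k * x j * y k)"

text \<open>Coordinates of the Segre embedding \<open>P\<^sup>3 \<times> P\<^sup>3 \<rightarrow> P\<^sup>1\<^sup>5\<close>, which gives the product its structure
  of a variety.\<close>

definition segre :: "(nat \<Rightarrow> complex) \<Rightarrow> (nat \<Rightarrow> complex) \<Rightarrow> nat \<Rightarrow> complex" where
  "segre x y i = (if i < 16 then x (i div 4) * y (i mod 4) else 0)"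

definition bilin_intersection :: "(nat \<Rightarrow> nat \<Rightarrow> nat \<Rightarrow> complex) \<Rightarrow> complex point set" where
  "bilin_intersection A =
     {pt (segre x y) | x y. x \<in> coord_vecs 3 \<and> y \<in> coord_vecs 3 \<and> (\<forall>i<3. bilin (A i) x y = 0)}"

text \<open>The intersection of the divisors \<open>bilin (A i) = 0\<close>, \<open>i < 3\<close>, is a smooth scheme of codimension
  3: at each of its points the differentials of the three equations, with components
  \<open>\<partial>/\<partial>x\<^sub>j\<close> and \<open>\<partial>/\<partial>y\<^sub>k\<close>, are linearly independent.\<close>

definition smooth_complete_intersection :: "(nat \<Rightarrow> nat \<Rightarrow> nat \<Rightarrow> complex) \<Rightarrow> bool" where
  "smooth_complete_intersection A \<longleftrightarrow>
     (\<forall>x\<in>coord_vecs 3. \<forall>y\<in>coord_vecs 3. (\<forall>i<3. bilin (A i) x y = 0) \<longrightarrow>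
        (\<forall>c. (\<forall>j\<le>3. (\<Sum>i<3. c i * (\<Sum>k\<le>3. A i j k * y k)) = 0) \<and>
             (\<forall>k\<le>3. (\<Sum>i<3. c i * (\<Sum>j\<le>3. A i j k * x j)) = 0) \<longrightarrow> (\<forall>i<3. c i = 0)))"

definition family_2_12 :: "nat \<Rightarrow> complex point set \<Rightarrow> bool" where
  "family_2_12 n X \<longleftrightarrow>
     (\<exists>A \<phi>. smooth_complete_intersection A \<and> variety_iso n X 15 (bilin_intersection A) \<phi>)"


section \<open>The real locus\<close>

text \<open>The Euclidean topology on \<open>P\<^sup>n(\<real>)\<close>, as quotient of \<open>\<real>\<^sup>n\<^sup>+\<^sup>1\<close> minus the origin.\<close>

definition real_proj_topology :: "nat \<Rightarrow> real point topology" where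
  "real_proj_topology n = topology (\<lambda>U. U \<subseteq> proj_space n \<and>
     openin (Euclidean_space (Suc n)) {v \<in> coord_vecs n. pt v \<in> U})"

lemma openin_real_proj_topology:
  "openin (real_proj_topology n) U \<longleftrightarrow>
     U \<subseteq> proj_space n \<and> openin (Euclidean_space (Suc n)) {v \<in> coord_vecs n. pt v \<in> U}"
proof -
  let ?L = "\<lambda>U. U \<subseteq> proj_space n \<and> openin (Euclidean_space (Suc n)) {v \<in> coord_vecs n. pt v \<in> U}"
  have "istopology ?L"
    unfolding istopology_def
  proof (intro conjI allI impI)
    fix S T assume S: "?L S" and T: "?L T"
    show "S \<inter> T \<subseteq> proj_space n" using S by blast
    have "{v \<in> coord_vecs n. pt v \<in> S \<inter> T} = {v \<in> coord_vecs n. pt v \<in> S} \<inter> {v \<in> coord_vecs n. pt v \<in> T}"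
      by blast
    then show "openin (Euclidean_space (Suc n)) {v \<in> coord_vecs n. pt v \<in> S \<inter> T}"
      using S T by auto
  next
    fix \<K> assume K: "\<forall>K\<in>\<K>. ?L K"
    then show "\<Union>\<K> \<subseteq> proj_space n" by blast
    have "{v \<in> coord_vecs n. pt v \<in> \<Union>\<K>} = (\<Union>K\<in>\<K>. {v \<in> coord_vecs n. pt v \<in> K})" by blast
    then show "openin (Euclidean_space (Suc n)) {v \<in> coord_vecs n. pt v \<in> \<Union>\<K>}"
      using K by auto
  qed
  then show ?thesis by (simp add: real_proj_topology_def topology_inverse')
qed

lemma topspace_real_proj_topology: "topspace (real_proj_topology n) = proj_space n"
proof
  show "topspace (real_proj_topology n) \<subseteq> proj_space n"
    using openin_real_proj_topology openin_topspace by blast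
  have E: "topspace (Euclidean_space (Suc n)) = {v. \<forall>i>n. v i = 0}"
    by (auto simp: topspace_Euclidean_space Suc_le_eq)
  have "{v \<in> coord_vecs n. pt v \<in> proj_space n}
      = topspace (Euclidean_space (Suc n)) - {\<lambda>_. 0 :: real}"
    unfolding E by (auto simp: coord_vecs_def proj_space_def)
  moreover have "closedin (Euclidean_space (Suc n)) {\<lambda>_. 0}"
    by (rule closedin_Hausdorff_singleton) (auto simp: E Hausdorff_Euclidean_space)
  ultimately have "openin (real_proj_topology n) (proj_space n)"
    unfolding openin_real_proj_topology by (simp add: openin_diff)
  then show "proj_space n \<subseteq> topspace (real_proj_topology n)"
    by (rule openin_subset)
qed

definition real_locus :: "nat \<Rightarrow> complex point set \<Rightarrow> real point set" where
  "real_locus n X = {pt v | v. v \<in> coord_vecs n \<and> pt (\<lambda>i. complex_of_real (v i)) \<in> X}"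

end

theory Submission
  imports Defs "Jordan_Normal_Form.Determinant"
begin

text \<open>
  Twist the real structure of \<open>P\<^sup>3 \<times> P\<^sup>3\<close> by exchanging the factors, so that a real complete
  intersection of three divisors of bidegree \<open>(1, 1)\<close> is given by three Hermitian forms and its
  real points are the \<open>x \<in> P\<^sup>3(\<complex>)\<close> on which these forms vanish. For
  \<open>4 |x\<^sub>0|\<^sup>2 + 4 |x\<^sub>1|\<^sup>2 = |x\<^sub>2|\<^sup>2 + |x\<^sub>3|\<^sup>2\<close> and
  \<open>2 x\<^sub>0 y\<^sub>1 + x\<^sub>1 y\<^sub>2 + 2 x\<^sub>2 y\<^sub>3 + x\<^sub>3 y\<^sub>0 = 0\<close> with \<open>y = cnj x\<close> (two real equations) no real point has \<open>|x\<^sub>2| = |x\<^sub>3|\<close>,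
  while \<open>(1, 0, 2, 0)\<close> and \<open>(0, 1, 0, 2)\<close> lie on different sides. The reason: without the terms
  of coefficient 1, which are a deformation, the points \<open>(x\<^sub>0, x\<^sub>1)\<close>
  and \<open>(x\<^sub>2, x\<^sub>3)\<close> define vectors of \<open>\<real>\<^sup>3\<close> with opposite horizontal components, the second one longer
  than the first, so that its vertical component does not vanish.

  Irreducibility follows from the birational projection to the first factor: the points where the
  \<open>3 \<times> 4\<close> matrix of the equations for \<open>y\<close> has rank 3 are dense, by an explicit arc through every
  other point. By adjunction \<open>\<omega>\<^sup>-\<^sup>1 = O(1, 1)\<close>, so the Segre embedding is anticanonical; its
  coordinates are written as Jacobian determinants on the cone over \<open>P\<^sup>3 \<times> P\<^sup>3\<close>.
\<close>

section \<open>Forms\<close>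

text \<open>The vectors of R^3 are images under the Hopf map (u, v) -> (2 u cnj v, |u|^2 - |v|^2),
  whose length is |u|^2 + |v|^2. The undeformed net is block diagonal, so the quartic det(t M0 + p
  M1 + q M2) of its three matrices M0, M1, M2 is a product of two conics, and a common point of the
  conics gives a singular point of the threefold. The deformation removes these points; its size is
  limited by the estimate that separates the two pieces.

  The obstacle in the Fano part is that a regular function has many local quotients
  \<open>F / G\<close>. After clearing denominators two of them differ by a form vanishing on the
  threefold, and the Jacobian determinant ignores the choice only if the differential of every such
  form depends on those of the three equations. The homogeneous ideal is not computed. Where the
  matrix has rank 3 the threefold is a graph, and differentiation along it gives the claim;
  elsewhere it follows as a limit along the same arcs that prove irreducibility, because the
  vanishing of a determinant is a closed condition.\<close>

lemma form_zero: "form UNIV n d (\<lambda>_. 0)"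
proof -
  \<comment> \<open>The rule \<open>const\<close> gives zero only in degree 0; multiplication by
    \<open>v 0 ^ d\<close> moves it to degree \<open>d\<close>.\<close>
  have 1: "form UNIV n d (\<lambda>v. v 0 ^ d)"
  proof (induction d)
    case 0
    show ?case using form.const[of 1 UNIV n] by simp
  next
    case (Suc d)
    then show ?case using form.mult[OF form.coord[of 0 n UNIV] Suc] by simp
  qed
  show ?thesis using form.mult[OF form.const[of 0 UNIV n] 1] by simp
qed

lemma form_cmult: "c \<in> K \<Longrightarrow> form K n d F \<Longrightarrow> form K n d (\<lambda>v. c * F v)"
  using form.mult[OF form.const] by fastforce

lemma form_uminus: "form UNIV n d F \<Longrightarrow> form UNIV n d (\<lambda>v. - F v)"
  using form_cmult[of "-1" UNIV n d F] by simp

lemma form_diff: "form UNIV n d F \<Longrightarrow> form UNIV n d G \<Longrightarrow> form UNIV n d (\<lambda>v. F v - G v)"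
  using form.add[OF _ form_uminus] by fastforce

lemma form_sum:
  "(\<And>i. i \<in> I \<Longrightarrow> form UNIV n d (F i)) \<Longrightarrow> form UNIV n d (\<lambda>v. \<Sum>i\<in>I. F i v)"
proof (induction I rule: infinite_finite_induct)
  case (insert x I)
  then show ?case using form.add[of UNIV n d "F x" "\<lambda>v. \<Sum>i\<in>I. F i v"] by simp
qed (simp_all add: form_zero)

lemma form_prod:
  assumes "finite I" "\<And>i. i \<in> I \<Longrightarrow> form UNIV n (e i) (F i)"
  shows "form UNIV n (\<Sum>i\<in>I. e i) (\<lambda>v. \<Prod>i\<in>I. F i v)"
  using assms
proof (induction I rule: finite_induct)
  case empty
  then show ?case using form.const[of 1 UNIV n] by simp
next
  case (insert x I)
  then show ?case using form.mult[of UNIV n "e x" "F x" _ "\<lambda>v. \<Prod>i\<in>I. F i v"] by simp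
qed

lemma form_compose:
  assumes "form UNIV n d F" "\<And>i. i \<le> n \<Longrightarrow> form UNIV m e (\<lambda>v. g v i)"
  shows "form UNIV m (d * e) (\<lambda>v. F (g v))"
  using assms(1)
proof (induction rule: form.induct)
  case (const c)
  then show ?case using form.const[of c UNIV m] by simp
next
  case (coord i)
  then show ?case using assms(2) by simp
next
  case (add d F G)
  then show ?case by (intro form.add)
next
  case (mult d F e' G)
  then show ?case using form.mult[of UNIV m "d * e" _ "e' * e"] by (simp add: algebra_simps)
qed

lemma form_homogeneous: "form K n d F \<Longrightarrow> F (\<lambda>i. c * v i) = c ^ d * F v"
  by (induction rule: form.induct) (auto simp: algebra_simps power_add)

lemma form_cong: "form K n d F \<Longrightarrow> (\<And>i. i \<le> n \<Longrightarrow> v i = w i) \<Longrightarrow> F v = F w"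
  by (induction rule: form.induct) auto

lemma form_coord: "i \<le> n \<Longrightarrow> form K n (Suc 0) (\<lambda>v. v i)"
  using form.coord[of i n K] by simp

lemma form_tendsto:
  assumes "form K n d F" "\<And>i. i \<le> n \<Longrightarrow> ((\<lambda>t. g t i) \<longlongrightarrow> l i) \<F>"
  shows "((\<lambda>t. F (g t)) \<longlongrightarrow> F l) \<F>"
  using assms(1) by (induction rule: form.induct) (auto intro!: tendsto_intros assms(2))

text \<open>A polynomial in one variable that is nonzero at one parameter is nonzero at all but
  finitely many. Irreducibility uses this for lines joining two points.\<close>

lemma form_poly_path:
  assumes "form K n d F" "\<And>i. i \<le> n \<Longrightarrow> \<exists>Q. \<forall>t. g t i = poly Q t"
  shows "\<exists>P. \<forall>t. F (g t) = poly P t"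
  using assms(1)
proof (induction rule: form.induct)
  case (const c)
  have "\<forall>t. c = poly [:c:] t" by simp
  then show ?case by metis
next
  case (coord i)
  then show ?case using assms(2) by blast
next
  case (add d F G)
  then obtain P Q where "\<forall>t. F (g t) = poly P t" "\<forall>t. G (g t) = poly Q t" by blast
  then have "\<forall>t. F (g t) + G (g t) = poly (P + Q) t" by simp
  then show ?case by blast
next
  case (mult d F e G)
  then obtain P Q where "\<forall>t. F (g t) = poly P t" "\<forall>t. G (g t) = poly Q t" by blast
  then have "\<forall>t. F (g t) * G (g t) = poly (P * Q) t" by simp
  then show ?case by blast
qed

text \<open>The chain rule along all differentiable curves is taken as the defining property: it is
  preserved by sums and products, so it can be proved by induction on forms, and it needs no
  derivative on the space of functions on \<open>nat\<close>.\<close>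

definition gradient :: "nat \<Rightarrow> ((nat \<Rightarrow> complex) \<Rightarrow> complex) \<Rightarrow> (nat \<Rightarrow> (nat \<Rightarrow> complex) \<Rightarrow> complex) \<Rightarrow> bool"
  where
  "gradient n F D \<longleftrightarrow>
    (\<forall>g g' t. (\<forall>i\<le>n. ((\<lambda>s. g s i) has_field_derivative g' i) (at t)) \<longrightarrow>
       ((\<lambda>s. F (g s)) has_field_derivative (\<Sum>i\<le>n. D i (g t) * g' i)) (at t))"

lemma gradientI:
  "(\<And>g g' t. (\<And>i. i \<le> n \<Longrightarrow> ((\<lambda>s. g s i) has_field_derivative g' i) (at t)) \<Longrightarrow>
     ((\<lambda>s. F (g s)) has_field_derivative (\<Sum>i\<le>n. D i (g t) * g' i)) (at t)) \<Longrightarrow> gradient n F D"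
  unfolding gradient_def by blast

lemma gradientD:
  "gradient n F D \<Longrightarrow> (\<And>i. i \<le> n \<Longrightarrow> ((\<lambda>s. g s i) has_field_derivative g' i) (at t)) \<Longrightarrow>
     ((\<lambda>s. F (g s)) has_field_derivative (\<Sum>i\<le>n. D i (g t) * g' i)) (at t)"
  unfolding gradient_def by blast

lemma gradient_const: "gradient n (\<lambda>_. c) (\<lambda>i v. 0)"
  by (rule gradientI) simp

text \<open>Homogeneity with the scalar 0, where \<open>0 ^ 0 = 1\<close>.\<close>

lemma form_0_const:
  assumes "form K n 0 F"
  shows "\<exists>c. F = (\<lambda>_. c)"
proof
  show "F = (\<lambda>_. F (\<lambda>_. 0))"
  proof
    fix v
    show "F v = F (\<lambda>_. 0)" using form_homogeneous[OF assms, of 0 v] by simp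
  qed
qed

lemma form_gradient_exists:
  assumes "form UNIV n d F"
  shows "\<exists>D. (\<forall>i\<le>n. form UNIV n (d - 1) (D i)) \<and> gradient n F D"
  using assms
proof (induction rule: form.induct)
  case (const c)
  show ?case by (rule exI[of _ "\<lambda>i v. 0"]) (simp add: form_zero gradient_const)
next
  case (coord k)
  let ?D = "\<lambda>i (v :: nat \<Rightarrow> complex). if i = k then 1 else 0 :: complex"
  have "gradient n (\<lambda>v. v k) ?D"
  proof (rule gradientI)
    fix g :: "complex \<Rightarrow> nat \<Rightarrow> complex" and g' :: "nat \<Rightarrow> complex" and t
    assume *: "\<And>i. i \<le> n \<Longrightarrow> ((\<lambda>s. g s i) has_field_derivative g' i) (at t)"
    have "(\<Sum>i\<le>n. ?D i (g t) * g' i) = (\<Sum>i\<le>n. if i = k then g' i else 0)"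
      by (rule sum.cong) auto
    also have "\<dots> = g' k" using coord by simp
    finally show "((\<lambda>s. g s k) has_field_derivative (\<Sum>i\<le>n. ?D i (g t) * g' i)) (at t)"
      using *[OF coord] by simp
  qed
  moreover have "form UNIV n (1 - 1) (?D i)" for i
    using form.const[of "if i = k then 1 else 0" UNIV n] by simp
  ultimately show ?case by (intro exI[of _ ?D]) simp
next
  case (add d F G)
  then obtain D E where D: "\<forall>i\<le>n. form UNIV n (d - 1) (D i)" "gradient n F D"
    and E: "\<forall>i\<le>n. form UNIV n (d - 1) (E i)" "gradient n G E" by blast
  have "gradient n (\<lambda>v. F v + G v) (\<lambda>i v. D i v + E i v)"
  proof (rule gradientI)
    fix g :: "complex \<Rightarrow> nat \<Rightarrow> complex" and g' :: "nat \<Rightarrow> complex" and t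
    assume "\<And>i. i \<le> n \<Longrightarrow> ((\<lambda>s. g s i) has_field_derivative g' i) (at t)"
    from DERIV_add[OF gradientD[of n F D g g' t, OF D(2) this] gradientD[of n G E g g' t, OF E(2) this]]
    show "((\<lambda>s. F (g s) + G (g s)) has_field_derivative (\<Sum>i\<le>n. (D i (g t) + E i (g t)) * g' i)) (at t)"
      by (simp add: algebra_simps sum.distrib)
  qed
  moreover have "\<forall>i\<le>n. form UNIV n (d - 1) (\<lambda>v. D i v + E i v)" using D E by (auto intro: form.add)
  ultimately show ?case by (intro exI[of _ "\<lambda>i v. D i v + E i v"]) simp
next
  case (mult d F e G)
  \<comment> \<open>For \<open>d = 0\<close> truncated subtraction would break the degree count
    \<open>(d - 1) + e = d + e - 1\<close>, but then \<open>F\<close> is constant and its gradient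
    is 0. The same applies to \<open>G\<close> below.\<close>
  have "\<exists>D. (\<forall>i\<le>n. form UNIV n (d + e - 1) (\<lambda>v. D i v * G v)) \<and> gradient n F D"
  proof (cases d)
    case 0
    then obtain c where "F = (\<lambda>_. c)" using form_0_const mult.hyps by blast
    then show ?thesis using gradient_const by (intro exI[of _ "\<lambda>i v. 0"]) (simp add: form_zero)
  next
    case (Suc k)
    obtain D where D: "\<forall>i\<le>n. form UNIV n (d - 1) (D i)" "gradient n F D" using mult.IH by blast
    have "form UNIV n (d + e - 1) (\<lambda>v. D i v * G v)" if "i \<le> n" for i
      using form.mult[OF D(1)[rule_format, OF that] mult.hyps(2)] Suc by simp
    then show ?thesis using D(2) by (intro exI[of _ D]) simp
  qed
  moreover have "\<exists>E. (\<forall>i\<le>n. form UNIV n (d + e - 1) (\<lambda>v. F v * E i v)) \<and> gradient n G E"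
  proof (cases e)
    case 0
    then obtain c where "G = (\<lambda>_. c)" using form_0_const mult.hyps by blast
    then show ?thesis using gradient_const by (intro exI[of _ "\<lambda>i v. 0"]) (simp add: form_zero)
  next
    case (Suc k)
    obtain E where E: "\<forall>i\<le>n. form UNIV n (e - 1) (E i)" "gradient n G E" using mult.IH by blast
    have "form UNIV n (d + e - 1) (\<lambda>v. F v * E i v)" if "i \<le> n" for i
      using form.mult[OF mult.hyps(1) E(1)[rule_format, OF that]] Suc by simp
    then show ?thesis using E(2) by (intro exI[of _ E]) simp
  qed
  ultimately obtain D E where D: "\<forall>i\<le>n. form UNIV n (d + e - 1) (\<lambda>v. D i v * G v)" "gradient n F D"
    and E: "\<forall>i\<le>n. form UNIV n (d + e - 1) (\<lambda>v. F v * E i v)" "gradient n G E" by blast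
  have "gradient n (\<lambda>v. F v * G v) (\<lambda>i v. D i v * G v + F v * E i v)"
  proof (rule gradientI)
    fix g :: "complex \<Rightarrow> nat \<Rightarrow> complex" and g' :: "nat \<Rightarrow> complex" and t
    assume "\<And>i. i \<le> n \<Longrightarrow> ((\<lambda>s. g s i) has_field_derivative g' i) (at t)"
    from DERIV_mult[OF gradientD[of n F D g g' t, OF D(2) this] gradientD[of n G E g g' t, OF E(2) this]]
    show "((\<lambda>s. F (g s) * G (g s)) has_field_derivative
        (\<Sum>i\<le>n. (D i (g t) * G (g t) + F (g t) * E i (g t)) * g' i)) (at t)"
      by (simp add: algebra_simps sum.distrib sum_distrib_left)
  qed
  moreover have "\<forall>i\<le>n. form UNIV n (d + e - 1) (\<lambda>v. D i v * G v + F v * E i v)"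
    using D E by (auto intro: form.add)
  ultimately show ?case by (intro exI[of _ "\<lambda>i v. D i v * G v + F v * E i v"]) simp
qed

text \<open>A gradient is unique: its chain rule along the coordinate line \<open>v(i := s)\<close>
  computes \<open>partial i F\<close>.\<close>

lemma form_partial_and_chain_rule:
  assumes "form UNIV n d F"
  shows form_partial: "i \<le> n \<Longrightarrow> form UNIV n (d - 1) (partial i F)"
    and form_chain_rule: "(\<And>i. i \<le> n \<Longrightarrow> ((\<lambda>s. g s i) has_field_derivative g' i) (at t)) \<Longrightarrow>
       ((\<lambda>s. F (g s)) has_field_derivative (\<Sum>i\<le>n. partial i F (g t) * g' i)) (at t)"
proof -
  obtain D where D: "\<forall>i\<le>n. form UNIV n (d - 1) (D i)" "gradient n F D"
    using form_gradient_exists[OF assms] by blast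
  have *: "partial i F = D i" if "i \<le> n" for i
  proof
    fix v
    have "((\<lambda>s. F (v(i := s))) has_field_derivative
        (\<Sum>k\<le>n. D k (v(i := v i)) * (if k = i then 1 else 0))) (at (v i))"
      by (rule gradientD[OF D(2)]) auto
    moreover have "(\<Sum>k\<le>n. D k (v(i := v i)) * (if k = i then 1 else 0)) = D i v"
      using that by (simp add: if_distrib[of "(*) _"] cong: if_cong)
    ultimately show "partial i F v = D i v" unfolding partial_def by (metis DERIV_imp_deriv)
  qed
  show "i \<le> n \<Longrightarrow> form UNIV n (d - 1) (partial i F)" using D * by simp
  show "(\<And>i. i \<le> n \<Longrightarrow> ((\<lambda>s. g s i) has_field_derivative g' i) (at t)) \<Longrightarrow>
       ((\<lambda>s. F (g s)) has_field_derivative (\<Sum>i\<le>n. partial i F (g t) * g' i)) (at t)"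
    using gradientD[OF D(2), of g g' t] * by simp
qed

lemma form_directional_derivative:
  assumes "form UNIV n d F"
  shows "((\<lambda>s. F (\<lambda>i. v i + s * w i)) has_field_derivative (\<Sum>i\<le>n. partial i F v * w i)) (at 0)"
proof -
  have "((\<lambda>s. v i + s * w i) has_field_derivative w i) (at 0)" for i
    by (auto intro!: derivative_eq_intros)
  then show ?thesis using form_chain_rule[OF assms, of "\<lambda>s i. v i + s * w i" w 0] by simp
qed

text \<open>Derivative at \<open>s = 0\<close> of
  \<open>F ((1 + s) v) = (1 + s) ^ d * F v\<close>.\<close>

lemma form_euler:
  assumes "form UNIV n d F"
  shows "(\<Sum>i\<le>n. partial i F v * v i) = of_nat d * F v"
proof -
  have "((\<lambda>s. F (\<lambda>i. v i + s * v i)) has_field_derivative (\<Sum>i\<le>n. partial i F v * v i)) (at 0)"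
    by (rule form_directional_derivative[OF assms])
  moreover have "(\<lambda>s. F (\<lambda>i. v i + s * v i)) = (\<lambda>s. (1 + s) ^ d * F v)"
  proof
    fix s
    show "F (\<lambda>i. v i + s * v i) = (1 + s) ^ d * F v"
      using form_homogeneous[OF assms, of "1 + s" v] by (simp add: ring_distribs)
  qed
  moreover have "((\<lambda>s. (1 + s) ^ d * F v) has_field_derivative of_nat d * F v) (at 0)"
    by (auto intro!: derivative_eq_intros)
  ultimately show ?thesis by (simp add: DERIV_unique)
qed

text \<open>\<open>G\<close> and \<open>H\<close> carry the real and the imaginary parts of the
  coefficients of \<open>F\<close>. A point where \<open>F\<close> and its conjugate form both
  vanish is one where \<open>G\<close> and \<open>H\<close> vanish, which will produce real
  equations.\<close>

lemma form_cnj: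
  assumes "form UNIV n d F"
  shows "\<exists>G H. form \<real> n d G \<and> form \<real> n d H \<and>
    (\<forall>v. F v = G v + \<i> * H v \<and> cnj (F (\<lambda>i. cnj (v i))) = G v - \<i> * H v)"
  using assms
proof (induction rule: form.induct)
  case (const c)
  have "c = of_real (Re c) + \<i> * of_real (Im c)" "cnj c = of_real (Re c) - \<i> * of_real (Im c)"
    by (simp_all add: complex_eq_iff)
  then show ?case
    by (intro exI[of _ "\<lambda>_. of_real (Re c)"] exI[of _ "\<lambda>_. of_real (Im c)"])
       (auto intro: form.const)
next
  case (coord i)
  have "form \<real> n 1 (\<lambda>v. 0 * v i)" by (rule form_cmult) (use coord form.coord in auto)
  then show ?case using form.coord[OF coord, of "\<real>"]
    by (intro exI[of _ "\<lambda>v. v i"] exI[of _ "\<lambda>v. 0 * v i"]) simp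
next
  case (add d F F')
  then obtain G H G' H' where *: "form \<real> n d G" "form \<real> n d H" "form \<real> n d G'" "form \<real> n d H'"
    "\<And>v. F v = G v + \<i> * H v" "\<And>v. cnj (F (\<lambda>i. cnj (v i))) = G v - \<i> * H v"
    "\<And>v. F' v = G' v + \<i> * H' v" "\<And>v. cnj (F' (\<lambda>i. cnj (v i))) = G' v - \<i> * H' v" by blast
  show ?case
    by (rule exI[of _ "\<lambda>v. G v + G' v"], rule exI[of _ "\<lambda>v. H v + H' v"])
       (use * in \<open>auto intro: form.add simp: algebra_simps\<close>)
next
  case (mult d F e F')
  then obtain G H G' H' where *: "form \<real> n d G" "form \<real> n d H" "form \<real> n e G'" "form \<real> n e H'"
    "\<And>v. F v = G v + \<i> * H v" "\<And>v. cnj (F (\<lambda>i. cnj (v i))) = G v - \<i> * H v"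
    "\<And>v. F' v = G' v + \<i> * H' v" "\<And>v. cnj (F' (\<lambda>i. cnj (v i))) = G' v - \<i> * H' v" by blast
  have "form \<real> n (d + e) (\<lambda>v. G v * G' v + (-1) * (H v * H' v))"
    using * by (intro form.add form_cmult form.mult) auto
  moreover have "form \<real> n (d + e) (\<lambda>v. G v * H' v + H v * G' v)"
    using * by (intro form.add form.mult) auto
  moreover have "F v * F' v = (G v * G' v + (-1) * (H v * H' v)) + \<i> * (G v * H' v + H v * G' v)"
    "cnj (F (\<lambda>i. cnj (v i)) * F' (\<lambda>i. cnj (v i))) =
      (G v * G' v + (-1) * (H v * H' v)) - \<i> * (G v * H' v + H v * G' v)" for v
  proof -
    have i: "\<i> * (\<i> * z) = - z" for z by (simp flip: mult.assoc)
    show "F v * F' v = (G v * G' v + (-1) * (H v * H' v)) + \<i> * (G v * H' v + H v * G' v)"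
      unfolding *(5,7) by (simp add: i algebra_simps)
    show "cnj (F (\<lambda>i. cnj (v i)) * F' (\<lambda>i. cnj (v i))) =
      (G v * G' v + (-1) * (H v * H' v)) - \<i> * (G v * H' v + H v * G' v)"
      unfolding complex_cnj_mult *(6,8) by (simp add: i algebra_simps)
  qed
  ultimately show ?case by blast
qed

section \<open>Determinants of families of rows\<close>

text \<open>The rows are functions on \<open>nat\<close>, of which only the first \<open>n\<close> coordinates count.\<close>

definition rowdet :: "nat \<Rightarrow> (nat \<Rightarrow> nat \<Rightarrow> 'a::comm_ring_1) \<Rightarrow> 'a" where
  "rowdet n r = (\<Sum>p | p permutes {0..<n}. signof p * (\<Prod>i=0..<n. r i (p i)))"

lemma rowdet_eq_det: "rowdet n r = Determinant.det (mat n n (\<lambda>(i, j). r i j))"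
proof -
  have "(\<Prod>i=0..<n. r i (p i)) = (\<Prod>i=0..<n. mat n n (\<lambda>(i, j). r i j) $$ (i, p i))"
    if "p permutes {0..<n}" for p
    using permutes_in_image[OF that] by (intro prod.cong) auto
  then show ?thesis unfolding rowdet_def by (subst det_def') (auto intro!: sum.cong)
qed

lemma rowdet_cong:
  "(\<And>i j. i < n \<Longrightarrow> j < n \<Longrightarrow> r i j = r' i j) \<Longrightarrow> rowdet n r = rowdet n r'"
  unfolding rowdet_eq_det by (intro arg_cong[of _ _ Determinant.det] eq_matI) auto

text \<open>In every product the entry from row \<open>i\<close> is split off; the cofactor does not
  see that row, so linearity in it can be read off.\<close>

lemma rowdet_update:
  assumes "i < n"
  shows "rowdet n (r(i := a)) =
    (\<Sum>p | p permutes {0..<n}. signof p * (a (p i) * (\<Prod>k\<in>{0..<n} - {i}. r k (p k))))"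
  unfolding rowdet_def
proof (intro sum.cong refl arg_cong2[of _ _ _ _ "(*)"])
  fix p
  have "(\<Prod>k=0..<n. (r(i := a)) k (p k)) = (r(i := a)) i (p i) * (\<Prod>k\<in>{0..<n} - {i}. (r(i := a)) k (p k))"
    using assms by (intro prod.remove) auto
  also have "(\<Prod>k\<in>{0..<n} - {i}. (r(i := a)) k (p k)) = (\<Prod>k\<in>{0..<n} - {i}. r k (p k))"
    by (intro prod.cong) auto
  finally show "(\<Prod>k=0..<n. (r(i := a)) k (p k)) = a (p i) * (\<Prod>k\<in>{0..<n} - {i}. r k (p k))" by simp
qed

lemma rowdet_add:
  "i < n \<Longrightarrow> rowdet n (r(i := \<lambda>j. a j + b j)) = rowdet n (r(i := a)) + rowdet n (r(i := b))"
  by (simp add: rowdet_update algebra_simps sum.distrib)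

lemma rowdet_scale: "i < n \<Longrightarrow> rowdet n (r(i := \<lambda>j. c * a j)) = c * rowdet n (r(i := a))"
  by (simp add: rowdet_update sum_distrib_left algebra_simps)

lemma rowdet_zero: "i < n \<Longrightarrow> rowdet n (r(i := \<lambda>j. 0)) = 0"
  using rowdet_scale[of i n r 0 "\<lambda>_. 0"] by simp

lemma rowdet_sum:
  "i < n \<Longrightarrow> rowdet n (r(i := \<lambda>j. \<Sum>l\<in>I. c l * a l j)) = (\<Sum>l\<in>I. c l * rowdet n (r(i := a l)))"
proof (induction I rule: infinite_finite_induct)
  case (insert x I)
  then show ?case
    using rowdet_add[of i n r "\<lambda>j. c x * a x j" "\<lambda>j. \<Sum>l\<in>I. c l * a l j"]
    by (simp add: rowdet_scale del: fun_upd_apply)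
qed (auto simp: rowdet_zero)

lemma rowdet_identical:
  assumes "i < n" "k < n" "i \<noteq> k" "\<And>j. j < n \<Longrightarrow> r i j = r k j"
  shows "rowdet n r = 0"
proof -
  have "Matrix.row (mat n n (\<lambda>(i, j). r i j)) i = Matrix.row (mat n n (\<lambda>(i, j). r i j)) k"
    using assms by (intro eq_vecI) auto
  then show ?thesis unfolding rowdet_eq_det
    using det_identical_rows[of "mat n n (\<lambda>(i, j). r i j)" n i k] assms by auto
qed

lemma rowdet_expand:
  assumes "i < n"
  shows "rowdet n (r(i := a)) = (\<Sum>j<n. a j * rowdet n (r(i := \<lambda>k. if k = j then 1 else 0)))"
proof -
  have "rowdet n (r(i := a)) = rowdet n (r(i := \<lambda>k. \<Sum>j<n. a j * (if k = j then 1 else 0)))"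
    by (rule rowdet_cong) (simp add: if_distrib[of "(*) _"] cong: if_cong)
  then show ?thesis using rowdet_sum[OF assms, where I = "{..<n}"] by simp
qed

lemma rowdet_eq_0_iff_kernel:
  fixes r :: "nat \<Rightarrow> nat \<Rightarrow> 'a::field"
  shows "rowdet n r = 0 \<longleftrightarrow> (\<exists>v. (\<exists>j<n. v j \<noteq> 0) \<and> (\<forall>i<n. (\<Sum>j<n. r i j * v j) = 0))"
proof -
  let ?M = "mat n n (\<lambda>(i, j). r i j)"
  have "rowdet n r = 0 \<longleftrightarrow> (\<exists>v. v \<in> carrier_vec n \<and> v \<noteq> 0\<^sub>v n \<and> ?M *\<^sub>v v = 0\<^sub>v n)"
    unfolding rowdet_eq_det by (rule det_0_iff_vec_prod_zero_field) simp
  also have "\<dots> \<longleftrightarrow> (\<exists>v. (\<exists>j<n. v j \<noteq> 0) \<and> (\<forall>i<n. (\<Sum>j<n. r i j * v j) = 0))"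
  proof
    assume "\<exists>v. v \<in> carrier_vec n \<and> v \<noteq> 0\<^sub>v n \<and> ?M *\<^sub>v v = 0\<^sub>v n"
    then obtain v where v: "v \<in> carrier_vec n" "v \<noteq> 0\<^sub>v n" "?M *\<^sub>v v = 0\<^sub>v n" by blast
    have "\<exists>j<n. vec_index v j \<noteq> 0" using v(1,2) by (metis carrier_vecD eq_vecI index_zero_vec)
    moreover have "(\<Sum>j<n. r i j * vec_index v j) = 0" if "i < n" for i
    proof -
      have "vec_index (?M *\<^sub>v v) i = 0" using v(3) that by simp
      then show ?thesis using that v(1)
        by (simp add: scalar_prod_def lessThan_atLeast0)
    qed
    ultimately show "\<exists>v. (\<exists>j<n. v j \<noteq> 0) \<and> (\<forall>i<n. (\<Sum>j<n. r i j * v j) = 0)" by blast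
  next
    assume "\<exists>v. (\<exists>j<n. v j \<noteq> 0) \<and> (\<forall>i<n. (\<Sum>j<n. r i j * v j) = 0)"
    then obtain v where v: "\<exists>j<n. v j \<noteq> 0" "\<forall>i<n. (\<Sum>j<n. r i j * v j) = 0" by blast
    have "Matrix.vec n v \<noteq> 0\<^sub>v n" using v(1) by (metis index_vec index_zero_vec(1))
    moreover have "?M *\<^sub>v Matrix.vec n v = 0\<^sub>v n"
      using v(2) by (intro eq_vecI) (auto simp: scalar_prod_def lessThan_atLeast0)
    ultimately show "\<exists>v. v \<in> carrier_vec n \<and> v \<noteq> 0\<^sub>v n \<and> ?M *\<^sub>v v = 0\<^sub>v n"
      by (intro exI[of _ "Matrix.vec n v"]) auto
  qed
  finally show ?thesis .
qed

lemma rowdet_transpose: "rowdet n (\<lambda>i j. r j i) = rowdet n r"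
proof -
  have "transpose_mat (mat n n (\<lambda>(i, j). r i j)) = mat n n (\<lambda>(i, j). r j i)"
    by (rule eq_matI) auto
  then show ?thesis unfolding rowdet_eq_det
    using Determinant.det_transpose[of "mat n n (\<lambda>(i, j). r i j)" n] by simp
qed

lemma rowdet_eq_0_iff_dependent:
  fixes r :: "nat \<Rightarrow> nat \<Rightarrow> 'a::field"
  shows "rowdet n r = 0 \<longleftrightarrow> (\<exists>c. (\<exists>i<n. c i \<noteq> 0) \<and> (\<forall>j<n. (\<Sum>i<n. c i * r i j) = 0))"
  by (subst rowdet_transpose[symmetric], subst rowdet_eq_0_iff_kernel) (simp add: mult.commute)

lemma rowdet_scale_rows_columns:
  "rowdet n (\<lambda>i j. a i * b j * r i j) = (\<Prod>i<n. a i) * (\<Prod>j<n. b j) * rowdet n r"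
proof -
  have "(\<Prod>i=0..<n. a i * b (p i) * r i (p i)) = (\<Prod>i<n. a i) * (\<Prod>j<n. b j) * (\<Prod>i=0..<n. r i (p i))"
    if "p permutes {0..<n}" for p
  proof -
    have "(\<Prod>i=0..<n. b (p i)) = (\<Prod>i=0..<n. b i)"
      using prod.permute[OF that, of b] by (simp add: o_def)
    then show ?thesis by (simp add: prod.distrib lessThan_atLeast0)
  qed
  then show ?thesis unfolding rowdet_def sum_distrib_left
    by (intro sum.cong) (auto simp: algebra_simps)
qed

lemma form_rowdet:
  assumes "\<And>i j. i < n \<Longrightarrow> j < n \<Longrightarrow> form UNIV m (e i) (r i j)"
  shows "form UNIV m (\<Sum>i<n. e i) (\<lambda>v. rowdet n (\<lambda>i j. r i j v))"
proof -
  have "form UNIV m (\<Sum>i=0..<n. e i) (\<lambda>v. rowdet n (\<lambda>i j. r i j v))"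
    unfolding rowdet_def
    by (intro form_sum form_cmult form_prod) (auto intro!: assms simp: permutes_in_image[of _ "{0..<n}"])
  then show ?thesis by (simp add: lessThan_atLeast0)
qed

lemma tendsto_rowdet:
  fixes r :: "'b \<Rightarrow> nat \<Rightarrow> nat \<Rightarrow> complex"
  assumes "\<And>i j. i < n \<Longrightarrow> j < n \<Longrightarrow> ((\<lambda>t. r t i j) \<longlongrightarrow> l i j) \<F>"
  shows "((\<lambda>t. rowdet n (r t)) \<longlongrightarrow> rowdet n l) \<F>"
  unfolding rowdet_def by (intro tendsto_intros) (auto intro!: assms simp: permutes_in_image[of _ "{0..<n}"])

text \<open>Steinitz exchange from the bottom: the rows from \<open>k\<close> on are independent,
  those above are free. If no unit row fitted into the last free place, each unit row would be a
  combination of the independent rows, so a vector killed by these rows would vanish in all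
  coordinates; but fewer than \<open>n\<close> rows kill some nonzero vector.\<close>

lemma extend_rows_by_coordinates:
  fixes r :: "nat \<Rightarrow> nat \<Rightarrow> 'a::field"
  assumes "k \<le> n" "\<And>c. (\<And>j. j < n \<Longrightarrow> (\<Sum>i=k..<n. c i * r i j) = 0) \<Longrightarrow> \<forall>i\<in>{k..<n}. c i = 0"
  shows "\<exists>l. (\<forall>i<k. l i < n) \<and>
    rowdet n (\<lambda>i. if i < k then (\<lambda>j. if j = l i then 1 else 0) else r i) \<noteq> 0"
  using assms
proof (induction k arbitrary: r)
  case 0
  have "rowdet n r \<noteq> 0"
    unfolding rowdet_eq_0_iff_dependent using 0(2) by (auto simp: lessThan_atLeast0)
  then show ?case by simp
next
  case (Suc k)
  let ?e = "\<lambda>l. (\<lambda>j. if j = l then 1 else 0) :: nat \<Rightarrow> 'a"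
  have "\<exists>l<n. \<forall>c. (\<forall>j<n. (\<Sum>i=k..<n. c i * (r(k := ?e l)) i j) = 0) \<longrightarrow> (\<forall>i\<in>{k..<n}. c i = 0)"
  proof (rule ccontr)
    assume "\<not> ?thesis"
    then have *: "\<exists>c. (\<forall>j<n. (\<Sum>i=k..<n. c i * (r(k := ?e l)) i j) = 0) \<and> \<not> (\<forall>i\<in>{k..<n}. c i = 0)"
      if "l < n" for l using that by blast
    \<comment> \<open>The zero rows make the matrix singular; this yields a nonzero \<open>v\<close>
      killed by the rows after \<open>k\<close>.\<close>
    have "rowdet n (\<lambda>i. if i \<le> k then (\<lambda>_. 0) else r i) = 0"
      using Suc.prems(1) rowdet_zero[of k n "\<lambda>i. if i \<le> k then (\<lambda>_. 0) else r i"]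
      by (simp add: fun_upd_idem)
    then obtain v where v: "\<exists>j<n. v j \<noteq> 0"
      "\<And>i. i < n \<Longrightarrow> (\<Sum>j<n. (if i \<le> k then (\<lambda>_. 0) else r i) j * v j) = 0"
      unfolding rowdet_eq_0_iff_kernel by blast
    have "v l = 0" if l: "l < n" for l
    proof -
      obtain c where c: "\<forall>j<n. (\<Sum>i=k..<n. c i * (r(k := ?e l)) i j) = 0" "\<not> (\<forall>i\<in>{k..<n}. c i = 0)"
        using *[OF l] by blast
      have split: "(\<Sum>i=k..<n. c i * (r(k := ?e l)) i j) = c k * ?e l j + (\<Sum>i=Suc k..<n. c i * r i j)" for j
        using Suc.prems(1) by (simp add: sum.atLeast_Suc_lessThan)
      have ck: "c k \<noteq> 0"
      proof
        assume "c k = 0"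
        then have "\<And>j. j < n \<Longrightarrow> (\<Sum>i=Suc k..<n. c i * r i j) = 0" using c(1) split by fastforce
        then have "\<forall>i\<in>{Suc k..<n}. c i = 0" by (rule Suc.prems(2))
        then have "\<forall>i\<in>{k..<n}. c i = 0" using \<open>c k = 0\<close>
          by (metis atLeastLessThan_iff not_less_eq_eq order_antisym)
        then show False using c(2) by blast
      qed
      have "0 = (\<Sum>j<n. (c k * ?e l j + (\<Sum>i=Suc k..<n. c i * r i j)) * v j)"
        using c(1) unfolding split by (intro sum.neutral[symmetric]) simp
      also have "\<dots> = (\<Sum>j<n. c k * ?e l j * v j) + (\<Sum>j<n. \<Sum>i=Suc k..<n. c i * (r i j * v j))"
        by (simp add: algebra_simps sum.distrib sum_distrib_left)
      also have "(\<Sum>j<n. \<Sum>i=Suc k..<n. c i * (r i j * v j)) = (\<Sum>i=Suc k..<n. c i * (\<Sum>j<n. r i j * v j))"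
        by (subst sum.swap) (simp add: sum_distrib_left)
      also have "\<dots> = 0" using v(2) by (intro sum.neutral) fastforce
      also have "(\<Sum>j<n. c k * ?e l j * v j) = (\<Sum>j<n. if j = l then c k * v j else 0)"
        by (rule sum.cong) auto
      also have "\<dots> = c k * v l" using l by simp
      finally show "v l = 0" using ck by simp
    qed
    then show False using v(1) by blast
  qed
  then obtain l where l: "l < n"
    "\<And>c. (\<And>j. j < n \<Longrightarrow> (\<Sum>i=k..<n. c i * (r(k := ?e l)) i j) = 0) \<Longrightarrow> \<forall>i\<in>{k..<n}. c i = 0"
    by blast
  have "\<exists>m. (\<forall>i<k. m i < n) \<and>
      rowdet n (\<lambda>i. if i < k then (\<lambda>j. if j = m i then 1 else 0) else (r(k := ?e l)) i) \<noteq> 0"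
  proof (rule Suc.IH)
    show "k \<le> n" using Suc.prems(1) by simp
  qed (rule l(2))
  then obtain m where m: "\<forall>i<k. m i < n"
    "rowdet n (\<lambda>i. if i < k then ?e (m i) else (r(k := ?e l)) i) \<noteq> 0"
    by blast
  have "(\<lambda>i. if i < k then ?e (m i) else (r(k := ?e l)) i) =
    (\<lambda>i. if i < Suc k then ?e ((m(k := l)) i) else r i)"
    by (rule ext) (auto simp: less_Suc_eq)
  then show ?case using m l(1) by (intro exI[of _ "m(k := l)"]) (auto simp: less_Suc_eq)
qed

lemma rowdet_0_if_kernel:
  fixes r :: "nat \<Rightarrow> nat \<Rightarrow> 'a::field"
  assumes "j < n" "v j \<noteq> 0" "\<forall>i<n. (\<Sum>j<n. r i j * v j) = 0"
  shows "rowdet n r = 0"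
  unfolding rowdet_eq_0_iff_kernel by (rule exI[of _ v]) (use assms in blast)

lemma rowdet_0_if_dependent:
  fixes r :: "nat \<Rightarrow> nat \<Rightarrow> 'a::field"
  assumes "i < n" "c i \<noteq> 0" "\<forall>j<n. (\<Sum>i<n. c i * r i j) = 0"
  shows "rowdet n r = 0"
  unfolding rowdet_eq_0_iff_dependent by (rule exI[of _ c]) (use assms in blast)

section \<open>Linear algebra of three covectors in four-space\<close>

abbreviation unit_row :: "nat \<Rightarrow> nat \<Rightarrow> complex" where
  "unit_row k \<equiv> \<lambda>l. if l = k then 1 else 0"

definition prepend_row :: "(nat \<Rightarrow> complex) \<Rightarrow> (nat \<Rightarrow> nat \<Rightarrow> complex) \<Rightarrow> nat \<Rightarrow> nat \<Rightarrow> complex" where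
  "prepend_row a c i = (if i = 0 then a else c (i - 1))"

text \<open>The vector product of three covectors in four-space: its components are the signed 3 x 3
  minors.\<close>

definition cross :: "(nat \<Rightarrow> nat \<Rightarrow> complex) \<Rightarrow> nat \<Rightarrow> complex" where
  "cross c k = rowdet 4 (prepend_row (unit_row k) c)"

lemma prepend_row_update_0: "(prepend_row a c)(0 := b) = prepend_row b c"
  by (rule ext) (simp add: prepend_row_def)

lemma prepend_row_update_Suc: "prepend_row a (c(i := b)) = (prepend_row a c)(Suc i := b)"
  by (rule ext) (auto simp: prepend_row_def)

lemma all_less_4_prepend: "(\<forall>i<4. P (prepend_row a c i)) \<longleftrightarrow> P a \<and> (\<forall>i<3. P (c i))"
proof -
  have "(\<forall>i<4. P (prepend_row a c i)) \<longleftrightarrow> P (prepend_row a c 0) \<and> (\<forall>i<3. P (prepend_row a c (Suc i)))"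
    using All_less_Suc2[of 3 "\<lambda>i. P (prepend_row a c i)"] by simp
  then show ?thesis by (simp add: prepend_row_def)
qed

lemma sum_prepend: "(\<Sum>i<4. s i * prepend_row a c i l) = s 0 * a l + (\<Sum>i<3. s (Suc i) * c i l)"
  by (simp add: prepend_row_def eval_nat_numeral)

lemma dot_cross: "(\<Sum>k<4. a k * cross c k) = rowdet 4 (prepend_row a c)"
  using rowdet_expand[of 0 4 "prepend_row a c" a] by (simp add: prepend_row_update_0 cross_def)

lemma cross_orthogonal: "i < 3 \<Longrightarrow> (\<Sum>k<4. c i k * cross c k) = 0"
  unfolding dot_cross by (rule rowdet_identical[of 0 _ "Suc i"]) (auto simp: prepend_row_def)

text \<open>Independent covectors could be completed by a unit row to a nonsingular matrix, and its
  determinant is a component of \<open>cross c\<close>.\<close>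

lemma cross_eq_0_imp_dependent:
  assumes "\<And>k. k < 4 \<Longrightarrow> cross c k = 0"
  shows "\<exists>s. (\<exists>i<3. s i \<noteq> 0) \<and> (\<forall>k<4. (\<Sum>i<3. s i * c i k) = 0)"
proof (rule ccontr)
  assume neg: "\<not> ?thesis"
  let ?r = "prepend_row (\<lambda>_. 0) c"
  have "\<exists>l. (\<forall>i<1. l i < 4) \<and>
    rowdet 4 (\<lambda>i. if i < 1 then (\<lambda>j. if j = l i then 1 else 0) else ?r i) \<noteq> 0"
  proof (rule extend_rows_by_coordinates)
    fix s assume s: "\<And>j. j < 4 \<Longrightarrow> (\<Sum>i=1..<4. s i * ?r i j) = 0"
    have "(\<Sum>i<3. s (Suc i) * c i j) = 0" if "j < 4" for j
      using s[OF that] by (simp add: prepend_row_def eval_nat_numeral)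
    moreover have "\<not> ((\<exists>i<3. s (Suc i) \<noteq> 0) \<and> (\<forall>k<4. (\<Sum>i<3. s (Suc i) * c i k) = 0))"
      using neg by (rule contrapos_nn) (rule exI[of _ "\<lambda>i. s (Suc i)"])
    ultimately have *: "\<forall>i<3. s (Suc i) = 0" by blast
    show "\<forall>i\<in>{1..<4}. s i = 0"
    proof
      fix i :: nat assume "i \<in> {1..<4}"
      then have "i = Suc (i - 1)" "i - 1 < 3" by auto
      then show "s i = 0" using * by metis
    qed
  qed simp
  then obtain l where l: "l (0::nat) < (4::nat)"
    "rowdet 4 (\<lambda>i. if i < 1 then (\<lambda>j. if j = l i then 1 else 0) else ?r i) \<noteq> 0" by auto
  have "(\<lambda>i. if i < 1 then (\<lambda>j. if j = l i then 1 else 0) else ?r i) = prepend_row (unit_row (l 0)) c"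
    by (rule ext) (simp add: prepend_row_def)
  then show False using assms[OF l(1)] l(2) by (simp add: cross_def)
qed

text \<open>The vector \<open>cross c k * y - y k * cross c\<close> is killed by the three covectors
  and has component 0 at \<open>k\<close>. The matrix of these four conditions has determinant
  \<open>cross c k\<close>, so the vector is 0.\<close>

lemma kernel_proportional_cross:
  assumes "k < 4" "cross c k \<noteq> 0" "\<And>i. i < 3 \<Longrightarrow> (\<Sum>l<4. c i l * y l) = 0"
  shows "\<exists>s. \<forall>l<4. y l = s * cross c l"
proof -
  let ?w = "\<lambda>l. cross c k * y l - y k * cross c l"
  have dot: "(\<Sum>l<4. a l * ?w l) = cross c k * (\<Sum>l<4. a l * y l) - y k * (\<Sum>l<4. a l * cross c l)" for a
    by (simp add: sum_subtractf sum_distrib_left algebra_simps)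
  have unit: "(\<Sum>l<4. unit_row k l * z l) = z k" for z :: "nat \<Rightarrow> complex"
  proof -
    have "(\<Sum>l<4. unit_row k l * z l) = (\<Sum>l<4. if l = k then z l else 0)"
      by (rule sum.cong) auto
    then show ?thesis using assms(1) by simp
  qed
  have "\<forall>i<4. (\<Sum>l<4. prepend_row (unit_row k) c i l * ?w l) = 0"
  proof -
    have "(\<Sum>l<4. unit_row k l * ?w l) = 0" unfolding unit by simp
    moreover have "\<forall>i<3. (\<Sum>l<4. c i l * ?w l) = 0"
      unfolding dot by (simp add: assms(3) cross_orthogonal)
    ultimately show ?thesis
      using all_less_4_prepend[of "\<lambda>a. (\<Sum>l<4. a l * ?w l) = 0"] by blast
  qed
  moreover have "rowdet 4 (prepend_row (unit_row k) c) \<noteq> 0" using assms(2) by (simp add: cross_def)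
  ultimately have "\<forall>l<4. ?w l = 0" using rowdet_0_if_kernel[where v = ?w and n = 4] by blast
  then have "\<forall>l<4. y l = y k / cross c k * cross c l" using assms(2) by (simp add: field_simps)
  then show ?thesis by blast
qed

text \<open>The hypothesis is the vanishing of the determinant with rows
  \<open>a, c 0, c 1, c 2\<close>. In the resulting relation \<open>a\<close> has a nonzero
  coefficient, since otherwise \<open>c\<close> would be dependent and its minors would
  vanish.\<close>

lemma orthogonal_cross_imp_span:
  assumes "k < 4" "cross c k \<noteq> 0" "(\<Sum>l<4. a l * cross c l) = 0"
  shows "\<exists>s. \<forall>l<4. a l = (\<Sum>i<3. s i * c i l)"
proof -
  have "rowdet 4 (prepend_row a c) = 0" using assms(3) by (simp add: dot_cross)
  then obtain s where s: "\<exists>i<4. s i \<noteq> 0" "\<forall>l<4. (\<Sum>i<4. s i * prepend_row a c i l) = 0"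
    unfolding rowdet_eq_0_iff_dependent by blast
  have "s 0 \<noteq> 0"
  proof
    assume "s 0 = 0"
    then have "\<forall>l<4. (\<Sum>i<4. s i * prepend_row (unit_row k) c i l) = 0"
      using s(2) unfolding sum_prepend by simp
    then have "rowdet 4 (prepend_row (unit_row k) c) = 0"
      using rowdet_0_if_dependent[where c = s and n = 4] s(1) by blast
    then show False using assms(2) by (simp add: cross_def)
  qed
  have "a l = (\<Sum>i<3. (- s (Suc i) / s 0) * c i l)" if "l < 4" for l
  proof -
    have "s 0 * a l = - (\<Sum>i<3. s (Suc i) * c i l)"
      using s(2) that unfolding sum_prepend by (simp add: add_eq_0_iff2)
    then have "a l = - (\<Sum>i<3. s (Suc i) * c i l) / s 0" using \<open>s 0 \<noteq> 0\<close> by (simp add: field_simps)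
    then show ?thesis by (simp add: sum_negf sum_divide_distrib)
  qed
  then show ?thesis by (intro exI[of _ "\<lambda>i. - s (Suc i) / s 0"]) blast
qed

lemma cross_scale_row: "i < 3 \<Longrightarrow> cross (c(i := \<lambda>l. t * a l)) k = t * cross (c(i := a)) k"
  unfolding cross_def prepend_row_update_Suc by (rule rowdet_scale) simp

text \<open>Only the summand \<open>j = i\<close> survives, the others repeat a row. Applied to a
  relation that holds at one point, it exhibits the order of vanishing of the minors there.\<close>

lemma cross_row_combination:
  assumes "i < 3"
  shows "cross (c(i := \<lambda>l. \<Sum>j<3. s j * c j l)) k = s i * cross c k"
proof -
  have "cross (c(i := c j)) k = (if j = i then cross c k else 0)" if "j < 3" for j
  proof (cases "j = i")
    case False
    then show ?thesis unfolding cross_def using assms that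
      by (auto intro!: rowdet_identical[of "Suc i" _ "Suc j"] simp: prepend_row_def)
  qed simp
  then have "(\<Sum>j<3. s j * cross (c(i := c j)) k) = (\<Sum>j<3. if j = i then s j * cross c k else 0)"
    by (intro sum.cong) auto
  also have "\<dots> = s i * cross c k" using assms by simp
  finally show ?thesis unfolding cross_def prepend_row_update_Suc
    using assms by (subst rowdet_sum) auto
qed

section \<open>The incidence cone of a net of bilinear forms\<close>

lemma atMost_3: "{..3::nat} = {..<4}"
  by auto

lemma sum_16: "(\<Sum>i\<le>15. f i) = (\<Sum>j<4. \<Sum>k<4. f (4 * j + k))" for f :: "nat \<Rightarrow> 'a::comm_monoid_add"
  by (simp add: eval_nat_numeral atMost_Suc lessThan_Suc ac_simps)

text \<open>Row \<open>i\<close> of the 3 x 4 matrix of the equations that a fixed \<open>x\<close>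
  imposes on \<open>y\<close>; \<open>rrow\<close> below exchanges the roles of the factors.\<close>

definition lrow :: "(nat \<Rightarrow> nat \<Rightarrow> nat \<Rightarrow> complex) \<Rightarrow> (nat \<Rightarrow> complex) \<Rightarrow> nat \<Rightarrow> nat \<Rightarrow> complex" where
  "lrow A x i k = (\<Sum>j<4. A i j k * x j)"

definition rrow :: "(nat \<Rightarrow> nat \<Rightarrow> nat \<Rightarrow> complex) \<Rightarrow> (nat \<Rightarrow> complex) \<Rightarrow> nat \<Rightarrow> nat \<Rightarrow> complex" where
  "rrow A y i j = (\<Sum>k<4. A i j k * y k)"

lemma bilin_lrow: "bilin (A i) x y = (\<Sum>k<4. lrow A x i k * y k)"
  unfolding bilin_def lrow_def atMost_3 by (subst sum.swap) (simp only: sum_distrib_right)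

lemma bilin_rrow: "bilin (A i) x y = (\<Sum>j<4. rrow A y i j * x j)"
  unfolding bilin_def rrow_def atMost_3 by (simp only: sum_distrib_right) (simp only: ac_simps)

text \<open>Only the first four coordinates are inspected, so representatives may be arbitrary
  beyond index 3; \<open>truncate4\<close> restores membership in
  \<open>coord_vecs 3\<close>.\<close>

definition in_cone :: "(nat \<Rightarrow> nat \<Rightarrow> nat \<Rightarrow> complex) \<Rightarrow> (nat \<Rightarrow> complex) \<Rightarrow> (nat \<Rightarrow> complex) \<Rightarrow> bool" where
  "in_cone A x y \<longleftrightarrow> (\<exists>j<4. x j \<noteq> 0) \<and> (\<exists>k<4. y k \<noteq> 0) \<and> (\<forall>i<3. bilin (A i) x y = 0)"

definition truncate4 :: "(nat \<Rightarrow> complex) \<Rightarrow> nat \<Rightarrow> complex" where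
  "truncate4 x i = (if i < 4 then x i else 0)"

lemma segre_truncate4: "segre (truncate4 x) (truncate4 y) = segre x y"
  by (auto simp: fun_eq_iff segre_def truncate4_def)

lemma bilin_truncate4: "bilin a (truncate4 x) (truncate4 y) = bilin a x y"
  by (simp add: bilin_def truncate4_def)

lemma truncate4_coord_vecs: "truncate4 x \<in> coord_vecs 3 \<longleftrightarrow> (\<exists>j<4. x j \<noteq> 0)"
  by (auto simp: coord_vecs_def truncate4_def fun_eq_iff)

lemma coord_vecs_3_nonzero:
  assumes "x \<in> coord_vecs 3"
  shows "\<exists>j<4. x j \<noteq> 0"
proof -
  obtain j where "x j \<noteq> 0" using assms by (auto simp: coord_vecs_def fun_eq_iff)
  moreover from this have "\<not> 3 < j" using assms by (auto simp: coord_vecs_def)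
  ultimately show ?thesis by (intro exI[of _ j]) simp
qed

lemma bilin_intersection_eq: "bilin_intersection A = {pt (segre x y) | x y. in_cone A x y}"
proof (rule subset_antisym; rule subsetI)
  fix p assume "p \<in> bilin_intersection A"
  then show "p \<in> {pt (segre x y) | x y. in_cone A x y}"
    unfolding bilin_intersection_def in_cone_def using coord_vecs_3_nonzero by blast
next
  fix p assume "p \<in> {pt (segre x y) | x y. in_cone A x y}"
  then obtain x y where "p = pt (segre x y)" "in_cone A x y" by blast
  then have "p = pt (segre (truncate4 x) (truncate4 y))" "truncate4 x \<in> coord_vecs 3"
    "truncate4 y \<in> coord_vecs 3" "\<forall>i<3. bilin (A i) (truncate4 x) (truncate4 y) = 0"
    by (simp_all add: segre_truncate4 in_cone_def truncate4_coord_vecs bilin_truncate4)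
  then show "p \<in> bilin_intersection A" unfolding bilin_intersection_def by blast
qed

lemma segre_index: "j < 4 \<Longrightarrow> k < 4 \<Longrightarrow> segre x y (4 * j + k) = x j * y k"
  by (simp add: segre_def)

lemma segre_coord_vecs: "in_cone A x y \<Longrightarrow> segre x y \<in> coord_vecs 15"
proof -
  assume "in_cone A x y"
  then obtain j k where "j < 4" "k < 4" "x j \<noteq> 0" "y k \<noteq> 0" unfolding in_cone_def by blast
  then have "segre x y (4 * j + k) \<noteq> 0" by (simp add: segre_index)
  then have "segre x y \<noteq> (\<lambda>_. 0)" by metis
  then show ?thesis by (simp add: coord_vecs_def segre_def)
qed

lemma segre_scale: "segre (\<lambda>i. a * x i) (\<lambda>i. b * y i) = (\<lambda>i. (a * b) * segre x y i)"
  by (auto simp: fun_eq_iff segre_def)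

lemma in_cone_scale: "in_cone A x y \<Longrightarrow> a \<noteq> 0 \<Longrightarrow> b \<noteq> 0 \<Longrightarrow> in_cone A (\<lambda>i. a * x i) (\<lambda>i. b * y i)"
proof -
  have "bilin f (\<lambda>i. a * x i) (\<lambda>i. b * y i) = a * b * bilin f x y" for f
    by (simp add: bilin_def sum_distrib_left ac_simps)
  then show "in_cone A x y \<Longrightarrow> a \<noteq> 0 \<Longrightarrow> b \<noteq> 0 \<Longrightarrow> ?thesis" by (simp add: in_cone_def)
qed

lemma lrow_line: "lrow A (\<lambda>i. x i + t * u i) i k = lrow A x i k + t * lrow A u i k"
  by (simp add: lrow_def sum.distrib sum_distrib_left algebra_simps)

lemma form_lrow: "k < 4 \<Longrightarrow> form UNIV 3 1 (\<lambda>x. lrow A x i k)"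
  unfolding lrow_def by (intro form_sum form_cmult form.coord) auto

text \<open>The cubic rational map inverse to the first projection: where \<open>lrow A x\<close>
  has rank 3, its maximal minors span the solutions \<open>y\<close>.\<close>

definition minors :: "(nat \<Rightarrow> nat \<Rightarrow> nat \<Rightarrow> complex) \<Rightarrow> (nat \<Rightarrow> complex) \<Rightarrow> nat \<Rightarrow> complex" where
  "minors A x = cross (lrow A x)"

lemma form_minors: "k < 4 \<Longrightarrow> form UNIV 3 3 (\<lambda>x. minors A x k)"
proof -
  assume k: "k < 4"
  have "form UNIV 3 (\<Sum>i<4::nat. if i = 0 then 0 else 1)
      (\<lambda>x. rowdet 4 (\<lambda>i j. prepend_row (unit_row k) (lrow A x) i j))"
  proof (rule form_rowdet[where r = "\<lambda>i j x. prepend_row (unit_row k) (lrow A x) i j"])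
    fix i j :: nat assume "i < 4" "j < 4"
    then show "form UNIV 3 (if i = 0 then 0 else 1) (\<lambda>x. prepend_row (unit_row k) (lrow A x) i j)"
      using form.const[of "unit_row k j" UNIV 3] form_lrow[of j A "i - 1"]
      by (simp add: prepend_row_def)
  qed
  moreover have "(\<Sum>i<4::nat. if i = 0 then 0 else 1) = (3::nat)" by (simp add: eval_nat_numeral)
  ultimately show ?thesis by (simp add: minors_def cross_def)
qed

lemma bilin_minors: "i < 3 \<Longrightarrow> bilin (A i) x (\<lambda>k. s * minors A x k) = 0"
  using cross_orthogonal[of i "lrow A x"]
  by (simp add: bilin_lrow minors_def algebra_simps flip: sum_distrib_left)

lemma minors_nonzero_imp: 
  assumes "k < 4" "minors A x k \<noteq> 0"
  shows "\<exists>j<4. x j \<noteq> 0"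
proof (rule ccontr)
  assume "\<not> ?thesis"
  then have "minors A x k = minors A (\<lambda>i. 0 * x i) k"
    by (intro form_cong[OF form_minors[OF assms(1)]]) auto
  also have "\<dots> = 0" using form_homogeneous[OF form_minors[OF assms(1), of A], of 0 x] by simp
  finally show False using assms by simp
qed

lemma in_cone_minors:
  assumes "k < 4" "minors A x k \<noteq> 0" "s \<noteq> 0"
  shows "in_cone A x (\<lambda>k. s * minors A x k)"
  using assms minors_nonzero_imp[OF assms(1,2)] bilin_minors unfolding in_cone_def by auto

lemma form_segre_minors: "i \<le> 15 \<Longrightarrow> form UNIV 3 4 (\<lambda>x. segre x (\<lambda>k. s * minors A x k) i)"
  using form.mult[OF form.coord[of "i div 4" 3 UNIV] form_cmult[OF UNIV_I form_minors[of "i mod 4" A], of s]]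
  by (simp add: segre_def)

lemma segre_cong: "(\<And>k. k < 4 \<Longrightarrow> x k = x' k) \<Longrightarrow> (\<And>k. k < 4 \<Longrightarrow> y k = y' k) \<Longrightarrow> segre x y = segre x' y'"
  by (auto simp: segre_def fun_eq_iff)

lemma tendsto_segre:
  assumes "\<And>j. j < 4 \<Longrightarrow> ((\<lambda>t. X t j) \<longlongrightarrow> x j) F" "\<And>k. k < 4 \<Longrightarrow> ((\<lambda>t. Y t k) \<longlongrightarrow> y k) F"
  shows "((\<lambda>t. segre (X t) (Y t) i) \<longlongrightarrow> segre x y i) F"
proof (cases "i < 16")
  case True
  then show ?thesis by (auto simp: segre_def intro!: tendsto_intros assms)
qed (simp add: segre_def)

text \<open>By \<open>corank\<close> any two relations between the rows of \<open>lrow A x\<close>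
  are proportional, so its rank is at least 2 and the fibres of the first projection are points or
  lines. At a degenerate point there is thus a single relation to follow along an arc.\<close>

locale smooth_net =
  fixes A :: "nat \<Rightarrow> nat \<Rightarrow> nat \<Rightarrow> complex"
  assumes smooth: "smooth_complete_intersection A"
    and corank: "\<And>x c c' i j. \<lbrakk>\<exists>j<4. x j \<noteq> 0; \<And>k. k < 4 \<Longrightarrow> (\<Sum>i<3. c i * lrow A x i k) = 0;
        \<And>k. k < 4 \<Longrightarrow> (\<Sum>i<3. c' i * lrow A x i k) = 0; i < 3; j < 3\<rbrakk> \<Longrightarrow> c i * c' j = c j * c' i"
begin

lemma smooth_cone:
  assumes "in_cone A x y" "\<And>j. j < 4 \<Longrightarrow> (\<Sum>i<3. c i * rrow A y i j) = 0"
    "\<And>k. k < 4 \<Longrightarrow> (\<Sum>i<3. c i * lrow A x i k) = 0" "i < 3"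
  shows "c i = 0"
proof -
  have "\<forall>i<3. bilin (A i) (truncate4 x) (truncate4 y) = 0"
    using assms(1) by (simp add: bilin_truncate4 in_cone_def)
  moreover have "(\<forall>j\<le>3. (\<Sum>i<3. c i * (\<Sum>k\<le>3. A i j k * truncate4 y k)) = 0) \<and>
      (\<forall>k\<le>3. (\<Sum>i<3. c i * (\<Sum>j\<le>3. A i j k * truncate4 x j)) = 0)"
    using assms(2,3) by (simp add: atMost_3 rrow_def lrow_def truncate4_def)
  moreover have "truncate4 x \<in> coord_vecs 3" "truncate4 y \<in> coord_vecs 3"
    using assms(1) by (simp_all add: in_cone_def truncate4_coord_vecs)
  ultimately have "\<forall>i<3. c i = 0" using smooth unfolding smooth_complete_intersection_def by blast
  then show ?thesis using assms(4) by blast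
qed

text \<open>At a point whose fibre over the first factor is a line, move \<open>x\<close> in a direction \<open>u\<close> such that
  the kernel of the pencil of matrices \<open>lrow A (x + t u)\<close> tends to the given \<open>y\<close>.\<close>

lemma generic_points_dense:
  assumes xy: "in_cone A x y"
  obtains X Y :: "complex \<Rightarrow> nat \<Rightarrow> complex" where
    "\<And>j. ((\<lambda>t. X t j) \<longlongrightarrow> x j) (at 0)" "\<And>k. k < 4 \<Longrightarrow> ((\<lambda>t. Y t k) \<longlongrightarrow> y k) (at 0)"
    "\<forall>\<^sub>F t in at 0. in_cone A (X t) (Y t) \<and> (\<exists>k<4. minors A (X t) k \<noteq> 0)"
proof (cases "\<exists>k<4. minors A x k \<noteq> 0")
  case True
  then show ?thesis using that[of "\<lambda>_. x" "\<lambda>_. y"] xy by simp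
next
  case False
  then have m0: "cross (lrow A x) k = 0" if "k < 4" for k using that by (auto simp: minors_def)
  obtain c where "\<exists>i<3. c i \<noteq> 0" and c: "\<And>k. k < 4 \<Longrightarrow> (\<Sum>i<3. c i * lrow A x i k) = 0"
    using cross_eq_0_imp_dependent[of "lrow A x"] m0 by blast
  then obtain i0 where i0: "i0 < 3" "c i0 \<noteq> 0" by blast
  \<comment> \<open>\<open>c\<close> is a relation between the rows at \<open>x\<close>. Along
    \<open>x + t u\<close> the same combination of rows equals \<open>t * \<rho> u\<close>, so
    exchanging row \<open>i0\<close> for \<open>\<rho> u\<close> divides the minors by
    \<open>t\<close>, up to the factor \<open>c i0\<close>. The quotient \<open>\<psi> u t\<close>
    has a limit as \<open>t\<close> tends to 0.\<close>
  define \<rho> where "\<rho> u l = (\<Sum>i<3. c i * lrow A u i l)" for u l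
  define \<psi> where "\<psi> u t = cross ((lrow A (\<lambda>j. x j + t * u j))(i0 := \<rho> u))" for u t
  have \<rho>_smooth: "\<exists>j<4. (\<Sum>i<3. c i * rrow A z i j) \<noteq> 0"
    if "\<exists>k<4. z k \<noteq> 0" "\<forall>i<3. bilin (A i) x z = 0" for z
  proof (rule ccontr)
    assume "\<not> ?thesis"
    moreover have "in_cone A x z" using that xy by (auto simp: in_cone_def)
    ultimately have "c i0 = 0" using smooth_cone[of x z c i0] c i0 by blast
    then show False using i0 by blast
  qed
  have \<rho>_dot: "(\<Sum>l<4. \<rho> u l * z l) = (\<Sum>j<4. (\<Sum>i<3. c i * rrow A z i j) * u j)" for u z
  proof -
    have "(\<Sum>l<4. \<rho> u l * z l) = (\<Sum>i<3. c i * bilin (A i) u z)"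
      unfolding \<rho>_def bilin_lrow sum_distrib_left sum_distrib_right
      by (subst sum.swap) (simp add: ac_simps)
    also have "\<dots> = (\<Sum>j<4. (\<Sum>i<3. c i * rrow A z i j) * u j)"
      unfolding bilin_rrow sum_distrib_left sum_distrib_right
      by (subst sum.swap) (simp add: ac_simps)
    finally show ?thesis .
  qed
  obtain k0 where k0: "k0 < 4" "y k0 \<noteq> 0" using xy by (auto simp: in_cone_def)
  \<comment> \<open>All minors vanish, so the extra equation \<open>z k0 = 0\<close> still leaves a
    nonzero solution. It lies in the fibre of \<open>y\<close> and is independent of
    \<open>y\<close>, because \<open>y k0\<close> is not 0.\<close>
  have "rowdet 4 (prepend_row (unit_row k0) (lrow A x)) = 0" using m0[OF k0(1)] by (simp add: cross_def)
  then obtain z where z: "\<exists>l<4. z l \<noteq> 0"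
    "\<forall>i<4. (\<Sum>l<4. prepend_row (unit_row k0) (lrow A x) i l * z l) = 0"
    unfolding rowdet_eq_0_iff_kernel by blast
  then have z0: "(\<Sum>l<4. unit_row k0 l * z l) = 0" and zb: "\<forall>i<3. bilin (A i) x z = 0"
    unfolding all_less_4_prepend[of "\<lambda>a. (\<Sum>l<4. a l * z l) = 0"] by (simp_all add: bilin_lrow)
  have "(\<Sum>l<4. unit_row k0 l * z l) = (\<Sum>l<4. if l = k0 then z l else 0)" by (rule sum.cong) auto
  then have zk0: "z k0 = 0" using z0 k0 by simp
  have yb: "\<forall>i<3. bilin (A i) x y = 0" and ynz: "\<exists>k<4. y k \<noteq> 0" using xy by (auto simp: in_cone_def)
  \<comment> \<open>As functions of \<open>u\<close> the two pairings have coefficient vectors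
    \<open>?\<alpha>\<close> and \<open>?\<beta>\<close>. Smoothness at every point of the line
    through \<open>y\<close> and \<open>z\<close> says that no nontrivial combination of these
    vectors vanishes, so some \<open>u\<close> kills the first pairing and not the second.\<close>
  obtain u where u: "(\<Sum>l<4. \<rho> u l * y l) = 0" "(\<Sum>l<4. \<rho> u l * z l) \<noteq> 0"
  proof -
    obtain j1 where j1: "j1 < 4" "(\<Sum>i<3. c i * rrow A y i j1) \<noteq> 0" using \<rho>_smooth[OF ynz yb] by blast
    let ?\<alpha> = "\<lambda>j. \<Sum>i<3. c i * rrow A y i j" and ?\<beta> = "\<lambda>j. \<Sum>i<3. c i * rrow A z i j"
    \<comment> \<open>The coefficient vector of this point has component 0 at \<open>j1\<close> by
      construction; a nonzero component at \<open>j2\<close> is a nonzero 2 x 2 minor of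
      \<open>?\<alpha>\<close> and \<open>?\<beta>\<close>.\<close>
    let ?w = "\<lambda>k. ?\<alpha> j1 * z k - ?\<beta> j1 * y k"
    have "\<exists>k<4. ?w k \<noteq> 0"
    proof (rule ccontr)
      assume neg: "\<not> ?thesis"
      have "?\<alpha> j1 * z k0 - ?\<beta> j1 * y k0 = 0" using neg k0(1) by blast
      then have "?\<beta> j1 = 0" using zk0 k0(2) by simp
      then have "\<forall>k<4. z k = 0" using neg j1(2) by simp
      then show False using z(1) by blast
    qed
    moreover have "bilin (A i) x ?w = ?\<alpha> j1 * bilin (A i) x z - ?\<beta> j1 * bilin (A i) x y" for i
      by (simp add: bilin_lrow sum_subtractf sum_distrib_left algebra_simps)
    then have "\<forall>i<3. bilin (A i) x ?w = 0" using yb zb by simp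
    ultimately obtain j2 where j2: "j2 < 4" "(\<Sum>i<3. c i * rrow A ?w i j2) \<noteq> 0" using \<rho>_smooth[of ?w] by blast
    have "(\<Sum>i<3. c i * rrow A ?w i j2) = ?\<alpha> j1 * ?\<beta> j2 - ?\<beta> j1 * ?\<alpha> j2"
    proof -
      have "(\<Sum>i<3. c i * rrow A (\<lambda>k. a * z k - b * y k) i j2) = a * ?\<beta> j2 - b * ?\<alpha> j2" for a b
        by (simp add: rrow_def sum_subtractf sum_distrib_left algebra_simps)
      then show ?thesis .
    qed
    then have ne: "?\<alpha> j1 * ?\<beta> j2 - ?\<beta> j1 * ?\<alpha> j2 \<noteq> 0" using j2(2) by simp
    let ?u = "\<lambda>j. ?\<alpha> j1 * unit_row j2 j - ?\<alpha> j2 * unit_row j1 j"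
    have unit: "(\<Sum>j<4. g j * unit_row k j) = g k" if "k < 4" for g :: "nat \<Rightarrow> complex" and k
    proof -
      have "(\<Sum>j<4. g j * unit_row k j) = (\<Sum>j<4. if j = k then g j else 0)" by (rule sum.cong) auto
      then show ?thesis using that by simp
    qed
    have "(\<Sum>j<4. g j * ?u j) = ?\<alpha> j1 * (\<Sum>j<4. g j * unit_row j2 j) - ?\<alpha> j2 * (\<Sum>j<4. g j * unit_row j1 j)"
      for g :: "nat \<Rightarrow> complex"
      unfolding sum_distrib_left sum_subtractf[symmetric] by (rule sum.cong) (auto simp: algebra_simps)
    then have "(\<Sum>j<4. g j * ?u j) = ?\<alpha> j1 * g j2 - ?\<alpha> j2 * g j1" for g :: "nat \<Rightarrow> complex"
      unfolding unit[OF j1(1)] unit[OF j2(1)] .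
    then show ?thesis using that[of ?u] ne unfolding \<rho>_dot by (simp add: mult.commute)
  qed
  \<comment> \<open>A relation \<open>s\<close> between the new rows has \<open>s i0 = 0\<close>:
    pair it with \<open>z\<close>, which every row except \<open>\<rho> u\<close> kills. It is then
    a relation at \<open>x\<close> itself, proportional to \<open>c\<close> by
    \<open>corank\<close>, while \<open>c i0\<close> is not 0.\<close>
  have \<psi>0: "\<exists>k<4. \<psi> u 0 k \<noteq> 0"
  proof (rule ccontr)
    let ?R = "(lrow A x)(i0 := \<rho> u)"
    assume "\<not> ?thesis"
    then have "\<And>k. k < 4 \<Longrightarrow> cross ?R k = 0" by (auto simp: \<psi>_def)
    then obtain s where s: "\<exists>i<3. s i \<noteq> 0" "\<And>k. k < 4 \<Longrightarrow> (\<Sum>i<3. s i * ?R i k) = 0"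
      using cross_eq_0_imp_dependent by blast
    have "0 = (\<Sum>k<4. (\<Sum>i<3. s i * ?R i k) * z k)" using s(2) by simp
    also have "\<dots> = (\<Sum>i<3. s i * (\<Sum>k<4. ?R i k * z k))"
      unfolding sum_distrib_left sum_distrib_right by (subst sum.swap) (simp add: ac_simps)
    also have "\<dots> = (\<Sum>i<3. if i = i0 then s i * (\<Sum>k<4. \<rho> u k * z k) else 0)"
      using zb by (intro sum.cong) (auto simp: bilin_lrow)
    also have "\<dots> = s i0 * (\<Sum>k<4. \<rho> u k * z k)" using i0 by simp
    finally have si0: "s i0 = 0" using u(2) by simp
    have "(\<Sum>i<3. s i * lrow A x i k) = (\<Sum>i<3. s i * ?R i k)" for k
      using si0 by (intro sum.cong) auto
    then have "\<And>k. k < 4 \<Longrightarrow> (\<Sum>i<3. s i * lrow A x i k) = 0" using s(2) by simp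
    then have "c i0 * s i = c i * s i0" if "i < 3" for i
      using corank[of x c s i0 i] xy c i0(1) that by (simp add: in_cone_def)
    then show False using s(1) si0 i0(2) by auto
  qed
  \<comment> \<open>\<open>y\<close> is killed by \<open>\<rho> u\<close> and by the other rows, and
    their matrix has rank 3; hence \<open>y\<close> is a multiple of its minors, the limit of the
    kernels along the arc.\<close>
  have "\<exists>s. \<forall>k<4. y k = s * cross ((lrow A x)(i0 := \<rho> u)) k"
  proof -
    obtain k where "k < 4" "cross ((lrow A x)(i0 := \<rho> u)) k \<noteq> 0" using \<psi>0 by (auto simp: \<psi>_def)
    then show ?thesis
      by (rule kernel_proportional_cross) (use u(1) yb in \<open>auto simp: bilin_lrow\<close>)
  qed
  then obtain s where s: "\<And>k. k < 4 \<Longrightarrow> y k = s * \<psi> u 0 k" unfolding \<psi>_def by auto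
  have "s \<noteq> 0" using s k0 by auto
  have minors_\<psi>: "c i0 * minors A (\<lambda>j. x j + t * u j) k = t * \<psi> u t k" for t k
  proof -
    let ?L = "lrow A (\<lambda>j. x j + t * u j)"
    have "(\<Sum>i<3. c i * ?L i l) = (\<Sum>i<3. c i * lrow A x i l) + t * \<rho> u l" for l
      by (simp add: lrow_line \<rho>_def sum.distrib sum_distrib_left algebra_simps)
    then have *: "(\<Sum>i<3. c i * ?L i l) = t * \<rho> u l" if "l < 4" for l using c[OF that] by simp
    have "c i0 * minors A (\<lambda>j. x j + t * u j) k = cross (?L(i0 := \<lambda>l. \<Sum>i<3. c i * ?L i l)) k"
      unfolding minors_def by (rule cross_row_combination[OF i0(1), symmetric])
    also have "\<dots> = cross (?L(i0 := \<lambda>l. t * \<rho> u l)) k"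
      unfolding cross_def by (rule rowdet_cong) (auto simp: prepend_row_def *)
    finally show ?thesis unfolding \<psi>_def by (simp only: cross_scale_row[OF i0(1)])
  qed
  have \<psi>_lim: "((\<lambda>t. \<psi> u t k) \<longlongrightarrow> \<psi> u 0 k) (at 0)" for k
    unfolding \<psi>_def cross_def
  proof (rule tendsto_rowdet)
    fix i j :: nat
    have "((\<lambda>t. lrow A (\<lambda>j. x j + t * u j) (i - 1) j) \<longlongrightarrow> lrow A (\<lambda>j. x j + 0 * u j) (i - 1) j) (at 0)"
      unfolding lrow_line by (intro tendsto_intros)
    then show "((\<lambda>t. prepend_row (unit_row k) ((lrow A (\<lambda>j. x j + t * u j))(i0 := \<rho> u)) i j) \<longlongrightarrow>
        prepend_row (unit_row k) ((lrow A (\<lambda>j. x j + 0 * u j))(i0 := \<rho> u)) i j) (at 0)"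
      by (auto simp: prepend_row_def)
  qed
  obtain k1 where k1: "k1 < 4" "\<psi> u 0 k1 \<noteq> 0" using \<psi>0 by blast
  have "\<forall>\<^sub>F t in at 0. \<psi> u t k1 \<noteq> 0"
    using tendsto_imp_eventually_ne[OF \<psi>_lim[of k1] k1(2)] .
  moreover have "\<forall>\<^sub>F t in at 0. t \<noteq> (0::complex)" by (simp add: eventually_at_filter)
  ultimately have ev: "\<forall>\<^sub>F t in at 0. in_cone A (\<lambda>j. x j + t * u j) (\<lambda>k. s * \<psi> u t k) \<and>
      (\<exists>k<4. minors A (\<lambda>j. x j + t * u j) k \<noteq> 0)"
  proof eventually_elim
    case (elim t)
    then have mk: "minors A (\<lambda>j. x j + t * u j) k1 \<noteq> 0" using minors_\<psi>[of t k1] i0(2) by auto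
    have "\<psi> u t k = c i0 / t * minors A (\<lambda>j. x j + t * u j) k" for k
      using minors_\<psi>[of t k] elim by (simp add: field_simps)
    then have "(\<lambda>k. s * \<psi> u t k) = (\<lambda>k. (s * (c i0 / t)) * minors A (\<lambda>j. x j + t * u j) k)" by auto
    moreover have "s * (c i0 / t) \<noteq> 0" using \<open>s \<noteq> 0\<close> i0 elim by simp
    ultimately have "in_cone A (\<lambda>j. x j + t * u j) (\<lambda>k. s * \<psi> u t k)"
      using in_cone_minors[OF k1(1) mk, of "s * (c i0 / t)"] by (simp only: simp_thms)
    then show ?case using mk k1(1) by blast
  qed
  show ?thesis
  proof (rule that[OF _ _ ev])
    show "((\<lambda>t. x j + t * u j) \<longlongrightarrow> x j) (at 0)" for j by (auto intro!: tendsto_eq_intros)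
    show "((\<lambda>t. s * \<psi> u t k) \<longlongrightarrow> y k) (at 0)" if "k < 4" for k
      unfolding s[OF that] by (intro tendsto_intros \<psi>_lim)
  qed
qed

lemma generic_point_minors:
  assumes "in_cone A x y" "\<exists>k<4. minors A x k \<noteq> 0"
  shows "\<exists>s. s \<noteq> 0 \<and> (\<forall>k<4. y k = s * minors A x k)"
proof -
  obtain k where "k < 4" "cross (lrow A x) k \<noteq> 0" using assms(2) by (auto simp: minors_def)
  then have "\<exists>s. \<forall>k<4. y k = s * minors A x k" unfolding minors_def
    by (rule kernel_proportional_cross) (use assms(1) in \<open>auto simp: in_cone_def bilin_lrow\<close>)
  then obtain s where s: "\<forall>k<4. y k = s * minors A x k" by blast
  moreover have "s \<noteq> 0" using s assms(1) by (auto simp: in_cone_def)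
  ultimately show ?thesis by blast
qed

text \<open>Nonvanishing is an open condition, so it survives a small move along the arc to a point
  where the matrix has rank 3; there \<open>y\<close> is a multiple of \<open>minors\<close>, and
  homogeneity absorbs the factor.\<close>

lemma nonzero_at_generic_point:
  assumes "form UNIV 15 d F" "in_cone A x y" "F (segre x y) \<noteq> 0"
  obtains x' k where "k < 4" "minors A x' k \<noteq> 0" "F (segre x' (minors A x')) \<noteq> 0"
proof -
  obtain X Y :: "complex \<Rightarrow> nat \<Rightarrow> complex" where
    lim: "\<And>j. ((\<lambda>t. X t j) \<longlongrightarrow> x j) (at 0)" "\<And>k. k < 4 \<Longrightarrow> ((\<lambda>t. Y t k) \<longlongrightarrow> y k) (at 0)" and
    ev: "\<forall>\<^sub>F t in at 0. in_cone A (X t) (Y t) \<and> (\<exists>k<4. minors A (X t) k \<noteq> 0)"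
    using generic_points_dense[OF assms(2)] by blast
  have "((\<lambda>t. F (segre (X t) (Y t))) \<longlongrightarrow> F (segre x y)) (at 0)"
    by (intro form_tendsto[OF assms(1)] tendsto_segre lim)
  then have "\<forall>\<^sub>F t in at 0. F (segre (X t) (Y t)) \<noteq> 0" using assms(3) by (rule tendsto_imp_eventually_ne)
  then have "\<forall>\<^sub>F t in at 0. F (segre (X t) (Y t)) \<noteq> 0 \<and> in_cone A (X t) (Y t) \<and>
      (\<exists>k<4. minors A (X t) k \<noteq> 0)" using ev by eventually_elim blast
  then have "\<exists>t. F (segre (X t) (Y t)) \<noteq> 0 \<and> in_cone A (X t) (Y t) \<and> (\<exists>k<4. minors A (X t) k \<noteq> 0)"
    by (rule eventually_happens'[rotated]) simp
  then obtain t where t: "F (segre (X t) (Y t)) \<noteq> 0" "in_cone A (X t) (Y t)" "\<exists>k<4. minors A (X t) k \<noteq> 0"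
    by blast
  obtain s where s: "s \<noteq> 0" "\<forall>k<4. Y t k = s * minors A (X t) k" using generic_point_minors t by blast
  have "segre (X t) (Y t) = segre (\<lambda>i. 1 * X t i) (\<lambda>k. s * minors A (X t) k)"
    by (rule segre_cong) (use s in auto)
  also have "\<dots> = (\<lambda>i. s * segre (X t) (minors A (X t)) i)" using segre_scale[of 1 "X t" s "minors A (X t)"] by simp
  finally have "F (segre (X t) (minors A (X t))) \<noteq> 0"
    using t(1) form_homogeneous[OF assms(1), of s] by auto
  then show ?thesis using that t(3) by blast
qed

section \<open>Irreducibility by lines in the first factor\<close>

lemma in_cone_nonempty: "\<exists>x y. in_cone A x y"
proof -
  let ?x = "unit_row 0"
  \<comment> \<open>The zero row turns three equations in four unknowns into a singular square
    system.\<close>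
  have "rowdet 4 (prepend_row (\<lambda>_. 0) (lrow A ?x)) = 0"
    using rowdet_zero[of 0 4 "prepend_row (\<lambda>_. 0) (lrow A ?x)"] by (simp add: prepend_row_update_0)
  then obtain y where "\<exists>k<4. y k \<noteq> 0" "\<forall>i<4. (\<Sum>l<4. prepend_row (\<lambda>_. 0) (lrow A ?x) i l * y l) = 0"
    unfolding rowdet_eq_0_iff_kernel by blast
  then have "in_cone A ?x y"
    unfolding all_less_4_prepend[of "\<lambda>a. (\<Sum>l<4. a l * y l) = 0"] in_cone_def bilin_lrow
    by (auto intro!: exI[of _ "0::nat"])
  then show ?thesis by blast
qed

lemma form_at_minors: "form UNIV 15 d F \<Longrightarrow> form UNIV 3 (d * 4) (\<lambda>x. F (segre x (minors A x)))"
  using form_compose[of 15 d F 3 4 "\<lambda>x. segre x (minors A x)"] form_segre_minors[of _ 1 A] by simp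

lemma irreducible: "zariski_irreducible 15 (bilin_intersection A)"
  unfolding zariski_irreducible_def
proof (intro conjI allI impI)
  show "bilin_intersection A \<noteq> {}" unfolding bilin_intersection_eq using in_cone_nonempty by blast
next
  fix P Q
  assume "zariski_closed UNIV 15 P \<and> zariski_closed UNIV 15 Q \<and> bilin_intersection A \<subseteq> P \<union> Q"
  then obtain S T where S: "\<And>F. F \<in> S \<Longrightarrow> \<exists>d. form UNIV 15 d F"
    "P = {p \<in> proj_space 15. \<forall>F\<in>S. \<forall>v\<in>p. F v = 0}"
    and T: "\<And>F. F \<in> T \<Longrightarrow> \<exists>d. form UNIV 15 d F"
    "Q = {p \<in> proj_space 15. \<forall>F\<in>T. \<forall>v\<in>p. F v = 0}" and sub: "bilin_intersection A \<subseteq> P \<union> Q"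
    unfolding zariski_closed_def by blast
  have sep: "\<exists>d F. F \<in> R \<and> form UNIV 15 d F \<and> (\<exists>x y. in_cone A x y \<and> F (segre x y) \<noteq> 0)"
    if R: "\<And>F. F \<in> R \<Longrightarrow> \<exists>d. form UNIV 15 d F"
    and p: "p \<in> bilin_intersection A" "p \<notin> {p \<in> proj_space 15. \<forall>F\<in>R. \<forall>v\<in>p. F v = 0}" for R p
  proof -
    obtain x y where xy: "in_cone A x y" "p = pt (segre x y)" using p(1) unfolding bilin_intersection_eq by blast
    then have "p \<in> proj_space 15" using segre_coord_vecs unfolding proj_space_def by blast
    then obtain F v where F: "F \<in> R" "v \<in> p" "F v \<noteq> 0" using p(2) by blast
    obtain d where d: "form UNIV 15 d F" using R F by blast
    obtain c where "v = (\<lambda>i. c * segre x y i)" using F(2) xy(2) unfolding pt_def by blast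
    then have "F (segre x y) \<noteq> 0" using F(3) form_homogeneous[OF d, of c] by auto
    then show ?thesis using F d xy by blast
  qed
  show "bilin_intersection A \<subseteq> P \<or> bilin_intersection A \<subseteq> Q"
  proof (rule ccontr)
    assume "\<not> ?thesis"
    then obtain p q where p: "p \<in> bilin_intersection A" "p \<notin> P" and q: "q \<in> bilin_intersection A" "q \<notin> Q"
      by blast
    obtain d F x y where F: "F \<in> S" "form UNIV 15 d F" "in_cone A x y" "F (segre x y) \<noteq> 0"
      using sep[OF S(1), of S p] p S(2) by blast
    obtain e G x' y' where G: "G \<in> T" "form UNIV 15 e G" "in_cone A x' y'" "G (segre x' y') \<noteq> 0"
      using sep[OF T(1), of T q] q T(2) by blast
    obtain a k where a: "k < 4" "minors A a k \<noteq> 0" "F (segre a (minors A a)) \<noteq> 0"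
      using nonzero_at_generic_point[OF F(2-4)] by blast
    obtain b l where b: "l < 4" "minors A b l \<noteq> 0" "G (segre b (minors A b)) \<noteq> 0"
      using nonzero_at_generic_point[OF G(2-4)] by blast
    \<comment> \<open>The line from \<open>a\<close> to \<open>b\<close> in the first factor is
      lifted by \<open>minors\<close>. \<open>F\<close> is nonzero over its start and
      \<open>G\<close> over its end, so some parameter avoids the zeros of both; \<open>PM\<close>
      keeps the minors nonzero there, so that the lift is a point of the variety.\<close>
    define g where "g t i = a i + t * (b i - a i)" for t i
    have g01: "g 0 = a" "g 1 = b" by (auto simp: g_def)
    have "\<exists>R. \<forall>t. g t i = poly R t" for i
      by (rule exI[of _ "[:a i, b i - a i:]"]) (simp add: g_def)
    note path = form_poly_path[where g = g, OF _ this]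
    obtain PF where PF: "\<forall>t. F (segre (g t) (minors A (g t))) = poly PF t"
      using path[OF form_at_minors[OF F(2)]] by blast
    obtain PG where PG: "\<forall>t. G (segre (g t) (minors A (g t))) = poly PG t"
      using path[OF form_at_minors[OF G(2)]] by blast
    obtain PM where PM: "\<forall>t. minors A (g t) k = poly PM t"
      using path[OF form_minors[OF a(1)]] by blast
    have "poly PF 0 \<noteq> 0" "poly PG 1 \<noteq> 0" "poly PM 0 \<noteq> 0"
      using PF[rule_format, of 0] PG[rule_format, of 1] PM[rule_format, of 0] a b g01 by auto
    then have "PF * PG * PM \<noteq> 0" by auto
    then have "finite {t. poly (PF * PG * PM) t = 0}" by (rule poly_roots_finite)
    then obtain t where t: "poly (PF * PG * PM) t \<noteq> 0"
      using ex_new_if_finite[OF infinite_UNIV_char_0] by blast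
    then have mt: "minors A (g t) k \<noteq> 0" using PM by simp
    have "pt (segre (g t) (minors A (g t))) \<in> bilin_intersection A"
      using in_cone_minors[OF a(1) mt, of 1] unfolding bilin_intersection_eq by auto
    then have "pt (segre (g t) (minors A (g t))) \<in> P \<union> Q" using sub by blast
    moreover have "segre (g t) (minors A (g t)) \<in> pt (segre (g t) (minors A (g t)))"
      unfolding pt_def by (auto intro!: exI[of _ 1])
    ultimately have "F (segre (g t) (minors A (g t))) = 0 \<or> G (segre (g t) (minors A (g t))) = 0"
      using S(2) T(2) F(1) G(1) by blast
    then show False using t PF PG by auto
  qed
qed

end

section \<open>Tangent spaces\<close>

text \<open>The differential of \<open>H (segre x y)\<close> in the eight coordinates \<open>x 0, \<dots>, x 3, y 0, \<dots>, y 3\<close>,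
  and those of the three bilinear forms.\<close>

definition drow :: "((nat \<Rightarrow> complex) \<Rightarrow> complex) \<Rightarrow> (nat \<Rightarrow> complex) \<Rightarrow> (nat \<Rightarrow> complex) \<Rightarrow> nat \<Rightarrow> complex" where
  "drow H x y j = (if j < 4 then \<Sum>k<4. partial (4 * j + k) H (segre x y) * y k
     else \<Sum>i<4. partial (4 * i + (j - 4)) H (segre x y) * x i)"

definition brow :: "(nat \<Rightarrow> nat \<Rightarrow> nat \<Rightarrow> complex) \<Rightarrow> (nat \<Rightarrow> complex) \<Rightarrow> (nat \<Rightarrow> complex) \<Rightarrow> nat \<Rightarrow> nat \<Rightarrow> complex" where
  "brow A x y i j = (if j < 4 then rrow A y i j else lrow A x i (j - 4))"

definition linear_form :: "(nat \<Rightarrow> nat \<Rightarrow> complex) \<Rightarrow> (nat \<Rightarrow> complex) \<Rightarrow> complex" where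
  "linear_form a v = (\<Sum>l\<le>15. a (l div 4) (l mod 4) * v l)"

lemma form_linear_form: "form UNIV 15 1 (linear_form a)"
  unfolding linear_form_def by (intro form_sum form_cmult form.coord) auto

lemma linear_form_segre: "linear_form a (segre x y) = bilin a x y"
  unfolding linear_form_def sum_16 bilin_def atMost_3
  by (intro sum.cong refl) (simp add: segre_index)

lemma partial_linear_form:
  assumes "l \<le> 15"
  shows "partial l (linear_form a) v = a (l div 4) (l mod 4)"
proof -
  have "((\<lambda>t. linear_form a (v(l := t))) has_field_derivative
      (\<Sum>l'\<le>15. a (l' div 4) (l' mod 4) * (if l' = l then 1 else 0))) (at (v l))"
    unfolding linear_form_def by (intro DERIV_sum DERIV_cmult) (auto intro!: derivative_eq_intros)
  moreover have "(\<Sum>l'\<le>15. a (l' div 4) (l' mod 4) * (if l' = l then 1 else 0)) = a (l div 4) (l mod 4)"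
    using assms by (simp add: if_distrib[of "(*) _"] cong: if_cong)
  ultimately show ?thesis unfolding partial_def by (simp add: DERIV_imp_deriv)
qed

lemma drow_linear_form: "j < 8 \<Longrightarrow> drow (linear_form (A i)) x y j = brow A x y i j"
proof (cases "j < 4")
  case False
  moreover assume "j < 8"
  ultimately have "j = 4 + (j - 4)" "j - 4 < 4" by auto
  then obtain k where "j = 4 + k" "k < 4" by blast
  then show ?thesis by (simp add: drow_def brow_def partial_linear_form lrow_def)
qed (simp add: drow_def brow_def partial_linear_form rrow_def)

lemma drow_chain_rule:
  assumes "form UNIV 15 d H"
    and X: "\<And>j. j < 4 \<Longrightarrow> ((\<lambda>s. X s j) has_field_derivative X' j) (at t)"
    and Y: "\<And>j. j < 4 \<Longrightarrow> ((\<lambda>s. Y s j) has_field_derivative Y' j) (at t)"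
  shows "((\<lambda>s. H (segre (X s) (Y s))) has_field_derivative
    (\<Sum>j<4. drow H (X t) (Y t) j * X' j) + (\<Sum>k<4. drow H (X t) (Y t) (4 + k) * Y' k)) (at t)"
proof -
  let ?g' = "\<lambda>i. X' (i div 4) * Y t (i mod 4) + Y' (i mod 4) * X t (i div 4)"
  let ?P = "\<lambda>i. partial i H (segre (X t) (Y t))"
  have "((\<lambda>s. H (segre (X s) (Y s))) has_field_derivative (\<Sum>i\<le>15. ?P i * ?g' i)) (at t)"
  proof (rule form_chain_rule[OF assms(1)])
    fix i :: nat assume "i \<le> 15"
    then have "i < 16" "i div 4 < 4" by auto
    then show "((\<lambda>s. segre (X s) (Y s) i) has_field_derivative ?g' i) (at t)"
      using DERIV_mult[OF X[of "i div 4"] Y[of "i mod 4"]] by (simp add: segre_def)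
  qed
  also have "(\<Sum>i\<le>15. ?P i * ?g' i) =
      (\<Sum>j<4. \<Sum>k<4. ?P (4 * j + k) * Y t k * X' j) + (\<Sum>j<4. \<Sum>k<4. ?P (4 * j + k) * X t j * Y' k)"
    unfolding sum_16 by (simp add: algebra_simps sum.distrib)
  also have "\<dots> = (\<Sum>j<4. drow H (X t) (Y t) j * X' j) + (\<Sum>k<4. drow H (X t) (Y t) (4 + k) * Y' k)"
    by (subst (2) sum.swap) (simp add: drow_def sum_distrib_right)
  finally show ?thesis .
qed

text \<open>\<open>H (segre x y)\<close> is homogeneous of degree \<open>d\<close> in
  \<open>x\<close> and in \<open>y\<close> separately, so each block of four coordinates has its own
  Euler relation.\<close>

lemma drow_euler_y:
  assumes "form UNIV 15 d H"
  shows "(\<Sum>k<4. drow H x y (4 + k) * y k) = of_nat d * H (segre x y)"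
proof -
  let ?P = "\<lambda>i. partial i H (segre x y)"
  have "(\<Sum>k<4. drow H x y (4 + k) * y k) = (\<Sum>k<4. \<Sum>j<4. ?P (4 * j + k) * (x j * y k))"
    by (simp add: drow_def sum_distrib_right mult.assoc)
  also have "\<dots> = (\<Sum>j<4. \<Sum>k<4. ?P (4 * j + k) * (x j * y k))" by (rule sum.swap)
  also have "\<dots> = (\<Sum>i\<le>15. ?P i * segre x y i)" unfolding sum_16 by (simp add: segre_index)
  finally show ?thesis using form_euler[OF assms] by simp
qed

lemma drow_euler_x:
  assumes "form UNIV 15 d H"
  shows "(\<Sum>j<4. drow H x y j * x j) = of_nat d * H (segre x y)"
proof -
  let ?P = "\<lambda>i. partial i H (segre x y)"
  have "(\<Sum>j<4. drow H x y j * x j) = (\<Sum>j<4. \<Sum>k<4. ?P (4 * j + k) * (x j * y k))"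
    by (intro sum.cong refl) (simp add: drow_def sum_distrib_right sum_distrib_left mult.assoc mult.commute[of "y _"])
  also have "\<dots> = (\<Sum>i\<le>15. ?P i * segre x y i)" unfolding sum_16 by (simp add: segre_index)
  finally show ?thesis using form_euler[OF assms] by simp
qed

lemma tendsto_drow:
  assumes "form UNIV 15 d H" "\<And>j. j < 4 \<Longrightarrow> ((\<lambda>t. X t j) \<longlongrightarrow> x j) F"
    "\<And>k. k < 4 \<Longrightarrow> ((\<lambda>t. Y t k) \<longlongrightarrow> y k) F" "j < 8"
  shows "((\<lambda>t. drow H (X t) (Y t) j) \<longlongrightarrow> drow H x y j) F"
proof -
  have "((\<lambda>t. partial i H (segre (X t) (Y t))) \<longlongrightarrow> partial i H (segre x y)) F" if "i \<le> 15" for i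
    by (rule form_tendsto[OF form_partial[OF assms(1) that]]) (intro tendsto_segre assms)
  then show ?thesis unfolding drow_def using assms(4)
    by (auto intro!: tendsto_intros assms(2,3))
qed

context smooth_net
begin

text \<open>Over a point of rank 3 the variety is locally the graph
  \<open>y = s * minors A x\<close>. Differentiating \<open>H = 0\<close> along the graph expresses
  the first four components of \<open>drow\<close> through the last four, and the same rule holds
  for the bilinear forms. The last four are orthogonal to \<open>minors A x\<close> by Euler's
  relation in \<open>y\<close>, hence a combination of the rows of \<open>lrow A x\<close>; the same
  coefficients serve for the first four.\<close>

lemma drow_in_span_at_generic_point:
  assumes H: "form UNIV 15 d H" "\<And>x y. in_cone A x y \<Longrightarrow> H (segre x y) = 0"
    and xy: "in_cone A x y" "\<exists>k<4. minors A x k \<noteq> 0"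
  shows "\<exists>c. \<forall>j<8. drow H x y j = (\<Sum>i<3. c i * brow A x y i j)"
proof -
  obtain s where s: "s \<noteq> 0" "\<forall>k<4. y k = s * minors A x k" using generic_point_minors[OF xy] by blast
  define Y where "Y z k = s * minors A z k" for z k
  define Y' where "Y' j k = s * partial j (\<lambda>z. minors A z k) x" for j k
  have y: "y k = Y x k" if "k < 4" for k using s that by (simp add: Y_def)
  have drow_xy: "drow G x (Y x) = drow G x y" for G
  proof -
    have e: "segre x (Y x) = segre x y" by (rule segre_cong) (use y in auto)
    show ?thesis
    proof
      show "drow G x (Y x) j = drow G x y j" for j
        unfolding drow_def e by (auto simp: y intro!: sum.cong)
    qed
  qed
  have key: "drow G x y j + (\<Sum>k<4. drow G x y (4 + k) * Y' j k) = 0"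
    if G: "form UNIV 15 e G" "\<And>z. G (segre z (Y z)) = 0" and j: "j < 4" for G e j
  proof -
    let ?X = "\<lambda>t. x(j := t)"
    have "((\<lambda>t. G (segre (?X t) (Y (?X t)))) has_field_derivative
      (\<Sum>l<4. drow G (?X (x j)) (Y (?X (x j))) l * (if l = j then 1 else 0)) +
      (\<Sum>k<4. drow G (?X (x j)) (Y (?X (x j))) (4 + k) * Y' j k)) (at (x j))"
    proof (rule drow_chain_rule[OF G(1)])
      show "((\<lambda>t. ?X t l) has_field_derivative (if l = j then 1 else 0)) (at (x j))" for l
        by (auto intro!: derivative_eq_intros)
      fix k :: nat assume k: "k < 4"
      have "((\<lambda>t. minors A (?X t) k) has_field_derivative
          (\<Sum>i\<le>3. partial i (\<lambda>z. minors A z k) (?X (x j)) * (if i = j then 1 else 0))) (at (x j))"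
        by (rule form_chain_rule[OF form_minors[OF k]]) (auto intro!: derivative_eq_intros)
      also have "(\<Sum>i\<le>3. partial i (\<lambda>z. minors A z k) (?X (x j)) * (if i = j then 1 else 0))
          = partial j (\<lambda>z. minors A z k) x"
        using j by (simp add: if_distrib[of "(*) _"] cong: if_cong)
      finally show "((\<lambda>t. Y (?X t) k) has_field_derivative Y' j k) (at (x j))"
        unfolding Y_def Y'_def by (rule DERIV_cmult)
    qed
    moreover have "(\<Sum>l<4. drow G x y l * (if l = j then 1 else 0)) = drow G x y j"
      using j by (simp add: if_distrib[of "(*) _"] cong: if_cong)
    ultimately have "((\<lambda>t. 0) has_field_derivative
        drow G x y j + (\<Sum>k<4. drow G x y (4 + k) * Y' j k)) (at (x j))"
      by (simp add: G(2) drow_xy)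
    then show ?thesis using DERIV_unique DERIV_const by blast
  qed
  have "H (segre z (Y z)) = 0" for z
  proof (cases "\<exists>k<4. minors A z k \<noteq> 0")
    case True
    then show ?thesis using H(2) in_cone_minors[of _ A z s] s(1) unfolding Y_def by blast
  next
    case False
    \<comment> \<open>The Segre vector is 0 here. Writing it as 0 times a point of the cone gives
      \<open>H = 0\<close> in every degree, including degree 0.\<close>
    then have z: "segre z (Y z) = (\<lambda>i. 0 * segre x y i)" by (auto simp: segre_def Y_def fun_eq_iff)
    then show ?thesis using form_homogeneous[OF H(1), of 0 "segre x y"] H(2)[OF xy(1)] by simp
  qed
  note key_H = key[OF H(1) this]
  have "linear_form (A i) (segre z (Y z)) = 0" if "i < 3" for i z
    unfolding linear_form_segre Y_def using bilin_minors[OF that] .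
  note key_b = key[OF form_linear_form this]
  have "(\<Sum>k<4. drow H x y (4 + k) * cross (lrow A x) k) = 0"
  proof -
    have "s * (\<Sum>k<4. drow H x y (4 + k) * cross (lrow A x) k) = (\<Sum>k<4. drow H x y (4 + k) * y k)"
      unfolding sum_distrib_left by (rule sum.cong) (auto simp: y Y_def minors_def)
    also have "\<dots> = 0" using drow_euler_y[OF H(1)] H(2)[OF xy(1)] by simp
    finally show ?thesis using s(1) by simp
  qed
  moreover obtain k where "k < 4" "cross (lrow A x) k \<noteq> 0" using xy(2) by (auto simp: minors_def)
  ultimately obtain c where c: "\<forall>l<4. drow H x y (4 + l) = (\<Sum>i<3. c i * lrow A x i l)"
    using orthogonal_cross_imp_span[of k "lrow A x" "\<lambda>l. drow H x y (4 + l)"] by blast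
  have "drow H x y j = (\<Sum>i<3. c i * brow A x y i j)" if "j < 8" for j
  proof (cases "j < 4")
    case True
    have b: "rrow A y i j = - (\<Sum>k<4. lrow A x i k * Y' j k)" if "i < 3" for i
    proof -
      have "drow (linear_form (A i)) x y j + (\<Sum>k<4. drow (linear_form (A i)) x y (4 + k) * Y' j k) = 0"
        using key_b[OF that True] .
      moreover have "(\<Sum>k<4. drow (linear_form (A i)) x y (4 + k) * Y' j k) = (\<Sum>k<4. lrow A x i k * Y' j k)"
        by (rule sum.cong) (auto simp: drow_linear_form brow_def)
      ultimately show ?thesis using True by (simp add: drow_linear_form brow_def add_eq_0_iff2)
    qed
    have "drow H x y j = - (\<Sum>k<4. drow H x y (4 + k) * Y' j k)"
      using key_H[OF True] by (simp add: add_eq_0_iff2)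
    also have "\<dots> = - (\<Sum>k<4. \<Sum>i<3. c i * (lrow A x i k * Y' j k))"
    proof -
      have "drow H x y (4 + k) * Y' j k = (\<Sum>i<3. c i * (lrow A x i k * Y' j k))" if "k < 4" for k
        using c[rule_format, OF that] by (simp only: sum_distrib_right mult.assoc)
      then show ?thesis by simp
    qed
    also have "\<dots> = (\<Sum>i<3. c i * (- (\<Sum>k<4. lrow A x i k * Y' j k)))"
      by (subst sum.swap) (simp add: sum_negf sum_distrib_left)
    also have "\<dots> = (\<Sum>i<3. c i * brow A x y i j)"
      using True b by (intro sum.cong) (auto simp: brow_def)
    finally show ?thesis .
  next
    case False
    then show ?thesis using c[rule_format, of "j - 4"] that by (simp add: brow_def)
  qed
  then show ?thesis by blast
qed

text \<open>Along an arc of points of rank 3, row \<open>i0\<close> is a combination of rows 3, 4,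
  5, whatever the other rows are, and the determinant is continuous. The statement is about a
  determinant because the coefficients of the combinations need not be controlled in the
  limit.\<close>

lemma drow_dependent:
  assumes H: "form UNIV 15 d H" "\<And>x y. in_cone A x y \<Longrightarrow> H (segre x y) = 0"
    and xy: "in_cone A x y" and i0: "i0 < 3"
    and r: "\<And>j. j < 8 \<Longrightarrow> r i0 j = drow H x y j" "\<And>i j. i < 3 \<Longrightarrow> j < 8 \<Longrightarrow> r (3 + i) j = brow A x y i j"
  shows "rowdet 8 r = 0"
proof -
  obtain X Y :: "complex \<Rightarrow> nat \<Rightarrow> complex" where
    lim: "\<And>j. ((\<lambda>t. X t j) \<longlongrightarrow> x j) (at 0)" "\<And>k. k < 4 \<Longrightarrow> ((\<lambda>t. Y t k) \<longlongrightarrow> y k) (at 0)" and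
    ev: "\<forall>\<^sub>F t in at 0. in_cone A (X t) (Y t) \<and> (\<exists>k<4. minors A (X t) k \<noteq> 0)"
    using generic_points_dense[OF xy] by blast
  define R where "R t i = (if i = i0 then drow H (X t) (Y t)
      else if 3 \<le> i \<and> i < 6 then brow A (X t) (Y t) (i - 3) else r i)" for t i
  have zero: "\<forall>\<^sub>F t in at 0. rowdet 8 (R t) = 0"
    using ev
  proof eventually_elim
    case (elim t)
    then obtain c where c: "\<forall>j<8. drow H (X t) (Y t) j = (\<Sum>i<3. c i * brow A (X t) (Y t) i j)"
      using drow_in_span_at_generic_point[OF H] by blast
    let ?c = "\<lambda>i. if i = i0 then 1 else if 3 \<le> i \<and> i < 6 then - c (i - 3) else 0"
    show ?case
    proof (rule rowdet_0_if_dependent[where c = ?c and i = i0])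
      show "\<forall>j<8. (\<Sum>i<8. ?c i * R t i j) = 0"
      proof (intro allI impI)
        fix j :: nat assume "j < 8"
        have "i0 = 0 \<or> i0 = 1 \<or> i0 = 2" using i0 by auto
        then have "(\<Sum>i<8. ?c i * R t i j) = R t i0 j - (\<Sum>i<3. c i * R t (3 + i) j)"
          by (elim disjE) (simp_all add: eval_nat_numeral)
        also have "\<dots> = 0" using c \<open>j < 8\<close> i0 by (simp add: R_def)
        finally show "(\<Sum>i<8. ?c i * R t i j) = 0" .
      qed
    qed (use i0 in auto)
  qed
  have "((\<lambda>t. rowdet 8 (R t)) \<longlongrightarrow> rowdet 8 r) (at 0)"
  proof (rule tendsto_rowdet)
    fix i j :: nat assume "i < 8" and j: "j < 8"
    consider "i = i0" | "3 \<le> i \<and> i < 6" "i \<noteq> i0" | "i \<noteq> i0" "\<not> (3 \<le> i \<and> i < 6)" by blast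
    then show "((\<lambda>t. R t i j) \<longlongrightarrow> r i j) (at 0)"
    proof cases
      case 1
      then show ?thesis using tendsto_drow[OF H(1), of X x "at 0" Y y j] lim j r(1) by (simp add: R_def)
    next
      case 2
      have "((\<lambda>t. brow A (X t) (Y t) (i - 3) j) \<longlongrightarrow> brow A x y (i - 3) j) (at 0)"
        using j by (auto simp: brow_def rrow_def lrow_def intro!: tendsto_intros lim)
      moreover have "r i j = brow A x y (i - 3) j" using r(2)[of "i - 3" j] 2 j by (simp add: less_diff_conv2)
      ultimately show ?thesis using 2 by (simp add: R_def)
    next
      case 3
      then have "R t i = r i" for t unfolding R_def by (simp only: if_False)
      then show ?thesis by simp
    qed
  qed
  from Lim_transform_eventually[OF this zero]
  have "((\<lambda>t. 0) \<longlongrightarrow> rowdet 8 r) (at (0::complex))" .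
  then show ?thesis by (simp add: tendsto_const_iff)
qed

end

section \<open>Anticanonical sections\<close>

lemma form_has_partial:
  assumes "form UNIV n d F" "i \<le> n"
  shows "((\<lambda>t. F (v(i := t))) has_field_derivative partial i F v) (at (v i))"
proof -
  have "((\<lambda>t. F (v(i := t))) has_field_derivative
      (\<Sum>k\<le>n. partial k F (v(i := v i)) * (if k = i then 1 else 0))) (at (v i))"
    by (rule form_chain_rule[OF assms(1)]) (auto intro!: derivative_eq_intros)
  moreover have "(\<Sum>k\<le>n. partial k F (v(i := v i)) * (if k = i then 1 else 0)) = partial i F v"
    using assms(2) by (simp add: if_distrib[of "(*) _"] cong: if_cong)
  ultimately show ?thesis by simp
qed

lemma partial_eqI:
  "((\<lambda>t. F (v(i := t))) has_field_derivative D) (at (v i)) \<Longrightarrow> partial i F v = D"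
  unfolding partial_def by (rule DERIV_imp_deriv)

lemma partial_mult:
  assumes "form UNIV n d F" "form UNIV n e G" "i \<le> n"
  shows "partial i (\<lambda>v. F v * G v) v = partial i F v * G v + F v * partial i G v"
  using DERIV_mult[OF form_has_partial[OF assms(1,3), of v] form_has_partial[OF assms(2,3), of v]]
  by (intro partial_eqI) (simp add: algebra_simps)

lemma partial_add:
  assumes "form UNIV n d F" "form UNIV n e G" "i \<le> n"
  shows "partial i (\<lambda>v. F v + G v) v = partial i F v + partial i G v"
  using DERIV_add[OF form_has_partial[OF assms(1,3), of v] form_has_partial[OF assms(2,3), of v]]
  by (intro partial_eqI) simp

lemma partial_diff:
  assumes "form UNIV n d F" "form UNIV n e G" "i \<le> n"
  shows "partial i (\<lambda>v. F v - G v) v = partial i F v - partial i G v"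
  using DERIV_diff[OF form_has_partial[OF assms(1,3), of v] form_has_partial[OF assms(2,3), of v]]
  by (intro partial_eqI) simp

lemma partial_const: "partial i (\<lambda>_. c) v = 0"
  by (rule partial_eqI) simp

lemma partial_coord: "partial i (\<lambda>v. v m) v = (if i = m then 1 else 0)"
  by (rule partial_eqI) (auto intro!: derivative_eq_intros)

lemma drow_mult:
  assumes "form UNIV 15 d F" "form UNIV 15 e G" "j < 8"
  shows "drow (\<lambda>v. F v * G v) x y j = drow F x y j * G (segre x y) + F (segre x y) * drow G x y j"
  unfolding drow_def using assms(3)
  by (simp add: partial_mult[OF assms(1,2)] sum.distrib algebra_simps sum_distrib_left)

lemma drow_add:
  assumes "form UNIV 15 d F" "form UNIV 15 e G" "j < 8"
  shows "drow (\<lambda>v. F v + G v) x y j = drow F x y j + drow G x y j"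
  unfolding drow_def using assms(3)
  by (simp add: partial_add[OF assms(1,2)] sum.distrib algebra_simps)

lemma drow_diff:
  assumes "form UNIV 15 d F" "form UNIV 15 e G" "j < 8"
  shows "drow (\<lambda>v. F v - G v) x y j = drow F x y j - drow G x y j"
  unfolding drow_def using assms(3)
  by (simp add: partial_diff[OF assms(1,2)] sum_subtractf algebra_simps)

lemma drow_const: "drow (\<lambda>_. c) x y j = 0"
  by (simp add: drow_def partial_const)

lemma drow_cong:
  assumes "\<And>k. k < 4 \<Longrightarrow> x k = x' k" "\<And>k. k < 4 \<Longrightarrow> y k = y' k"
  shows "drow F x y = drow F x' y'"
proof
  fix j
  have e: "segre x y = segre x' y'" by (rule segre_cong) (use assms in auto)
  show "drow F x y j = drow F x' y' j" unfolding drow_def e by (auto simp: assms intro!: sum.cong)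
qed

lemma brow_cong:
  assumes "\<And>k. k < 4 \<Longrightarrow> x k = x' k" "\<And>k. k < 4 \<Longrightarrow> y k = y' k"
  shows "brow A x y = brow A x' y'"
  by (auto simp: fun_eq_iff brow_def rrow_def lrow_def assms intro!: sum.cong)

text \<open>The differential of the quotient \<open>F / G\<close> of two forms of equal degree.\<close>

definition frow :: "((nat \<Rightarrow> complex) \<Rightarrow> complex) \<Rightarrow> ((nat \<Rightarrow> complex) \<Rightarrow> complex) \<Rightarrow>
    (nat \<Rightarrow> complex) \<Rightarrow> (nat \<Rightarrow> complex) \<Rightarrow> nat \<Rightarrow> complex" where
  "frow F G x y j = (drow F x y j * G (segre x y) - F (segre x y) * drow G x y j) / (G (segre x y))\<^sup>2"

lemma frow_add:
  assumes "form UNIV 15 d F" "form UNIV 15 d G" "form UNIV 15 e F'" "form UNIV 15 e G'" "j < 8"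
    "G (segre x y) \<noteq> 0" "G' (segre x y) \<noteq> 0"
  shows "frow (\<lambda>v. F v * G' v + F' v * G v) (\<lambda>v. G v * G' v) x y j = frow F G x y j + frow F' G' x y j"
  unfolding frow_def
    drow_add[OF form.mult[OF assms(1,4)] form.mult[OF assms(3,2)] assms(5)]
    drow_mult[OF assms(1,4,5)] drow_mult[OF assms(3,2,5)] drow_mult[OF assms(2,4,5)]
  using assms(6,7) by (simp add: field_simps power2_eq_square)

lemma frow_mult:
  assumes "form UNIV 15 d F" "form UNIV 15 d G" "form UNIV 15 e F'" "form UNIV 15 e G'" "j < 8"
    "G (segre x y) \<noteq> 0" "G' (segre x y) \<noteq> 0"
  shows "frow (\<lambda>v. F v * F' v) (\<lambda>v. G v * G' v) x y j =
    F (segre x y) / G (segre x y) * frow F' G' x y j + F' (segre x y) / G' (segre x y) * frow F G x y j"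
  unfolding frow_def drow_mult[OF assms(1,3,5)] drow_mult[OF assms(2,4,5)]
  using assms(6,7) by (simp add: field_simps power2_eq_square)

text \<open>The difference of the quotients is \<open>(F G' - F' G) / (G G')\<close>; its numerator
  vanishes at the point, so only the differential of the numerator contributes.\<close>

lemma frow_diff:
  assumes "form UNIV 15 d F" "form UNIV 15 d G" "form UNIV 15 e F'" "form UNIV 15 e G'" "j < 8"
    "G (segre x y) \<noteq> 0" "G' (segre x y) \<noteq> 0" "F (segre x y) * G' (segre x y) = F' (segre x y) * G (segre x y)"
  shows "frow F G x y j = frow F' G' x y j +
    drow (\<lambda>v. F v * G' v - F' v * G v) x y j / (G (segre x y) * G' (segre x y))"
proof -
  have F: "F (segre x y) = F' (segre x y) * G (segre x y) / G' (segre x y)"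
    using assms(7,8) by (simp add: field_simps)
  show ?thesis
    unfolding frow_def drow_diff[OF form.mult[OF assms(1,4)] form.mult[OF assms(3,2)] assms(5)]
      drow_mult[OF assms(1,4,5)] drow_mult[OF assms(3,2,5)] F
    using assms(6,7) by (simp add: field_simps power2_eq_square)
qed

text \<open>A quotient of forms of equal degree does not change when \<open>x\<close> is scaled, so
  its differential kills the Euler field in \<open>x\<close>.\<close>

lemma frow_euler_x:
  assumes "form UNIV 15 d F" "form UNIV 15 d G"
  shows "(\<Sum>j<4. frow F G x y j * x j) = 0"
proof -
  have "(\<Sum>j<4. frow F G x y j * x j) =
    ((\<Sum>j<4. drow F x y j * x j) * G (segre x y) - F (segre x y) * (\<Sum>j<4. drow G x y j * x j)) / (G (segre x y))\<^sup>2"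
    by (simp add: frow_def sum_divide_distrib sum_distrib_left sum_distrib_right sum_subtractf diff_divide_distrib
        algebra_simps)
  then show ?thesis by (simp add: drow_euler_x[OF assms(1)] drow_euler_x[OF assms(2)])
qed

lemma frow_euler_y:
  assumes "form UNIV 15 d F" "form UNIV 15 d G"
  shows "(\<Sum>k<4. frow F G x y (4 + k) * y k) = 0"
proof -
  have "(\<Sum>k<4. frow F G x y (4 + k) * y k) =
    ((\<Sum>k<4. drow F x y (4 + k) * y k) * G (segre x y) - F (segre x y) * (\<Sum>k<4. drow G x y (4 + k) * y k)) / (G (segre x y))\<^sup>2"
    by (simp add: frow_def sum_divide_distrib sum_distrib_left sum_distrib_right sum_subtractf diff_divide_distrib
        algebra_simps)
  then show ?thesis by (simp add: drow_euler_y[OF assms(1)] drow_euler_y[OF assms(2)])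
qed

lemma drow_scale:
  assumes F: "form UNIV 15 d F" and "j < 8"
  shows "(a * b) * drow F (\<lambda>i. a * x i) (\<lambda>i. b * y i) j = (a * b) ^ d * (if j < 4 then b else a) * drow F x y j"
proof (cases d)
  case 0
  then obtain c where "F = (\<lambda>_. c)" using form_0_const F by blast
  then show ?thesis by (simp add: drow_const)
next
  case (Suc k)
  have "partial i F (segre (\<lambda>i. a * x i) (\<lambda>i. b * y i)) = (a * b) ^ k * partial i F (segre x y)"
    if "i \<le> 15" for i
    unfolding segre_scale using form_homogeneous[OF form_partial[OF F that]] Suc by simp
  then show ?thesis unfolding drow_def using assms(2) Suc
    by (simp add: sum_distrib_left algebra_simps)
qed

lemma frow_scale:
  assumes F: "form UNIV 15 d F" "form UNIV 15 d G" and j: "j < 8" and ab: "a \<noteq> 0" "b \<noteq> 0"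
  shows "frow F G (\<lambda>i. a * x i) (\<lambda>i. b * y i) j = (if j < 4 then 1 / a else 1 / b) * frow F G x y j"
proof -
  let ?s = "if j < 4 then 1 / a else 1 / b"
  have d: "drow H (\<lambda>i. a * x i) (\<lambda>i. b * y i) j = (a * b) ^ d * ?s * drow H x y j" if "form UNIV 15 d H" for H
    using drow_scale[OF that j, of a b x y] ab by (auto simp: field_simps split: if_splits)
  have h: "H (segre (\<lambda>i. a * x i) (\<lambda>i. b * y i)) = (a * b) ^ d * H (segre x y)" if "form UNIV 15 d H" for H
    unfolding segre_scale by (rule form_homogeneous[OF that])
  have ne: "(a * b) ^ d \<noteq> 0" using ab by simp
  have "(c * s * p * (c * g) - c * f * (c * s * q)) / (c * g)\<^sup>2 = s * ((p * g - f * q) / g\<^sup>2)"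
    if "c \<noteq> 0" for c s p g f q :: complex
    using that by (cases "g = 0") (simp_all add: field_simps power2_eq_square)
  from this[OF ne] show ?thesis unfolding frow_def d[OF F(1)] d[OF F(2)] h[OF F(1)] h[OF F(2)] .
qed

section \<open>Determinants of local quotients and their independence of choices\<close>

definition local_rep :: "nat \<Rightarrow> complex point set \<Rightarrow> complex point \<Rightarrow> (complex point \<Rightarrow> complex) \<Rightarrow>
    ((nat \<Rightarrow> complex) \<Rightarrow> complex) \<Rightarrow> ((nat \<Rightarrow> complex) \<Rightarrow> complex) \<Rightarrow> bool" where
  "local_rep n U p f F G \<longleftrightarrow> (\<exists>d. form UNIV n d F \<and> form UNIV n d G) \<and> (\<forall>v\<in>p. G v \<noteq> 0) \<and>
     (\<forall>q\<in>U. \<forall>v\<in>q. G v \<noteq> 0 \<longrightarrow> f q = F v / G v)"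

lemma regular_on_local_rep: "regular_on n U f \<longleftrightarrow> (\<forall>p\<in>U. \<exists>F G. local_rep n U p f F G)"
  unfolding regular_on_def local_rep_def by blast

text \<open>The differentials of three functions and of the three equations, completed by
  \<open>dx_j\<close> and \<open>dy_k\<close> to a square matrix.\<close>

definition sec_rows :: "(nat \<Rightarrow> nat \<Rightarrow> nat \<Rightarrow> complex) \<Rightarrow> (nat \<Rightarrow> (nat \<Rightarrow> complex) \<Rightarrow> complex) \<Rightarrow>
    (nat \<Rightarrow> (nat \<Rightarrow> complex) \<Rightarrow> complex) \<Rightarrow> nat \<Rightarrow> nat \<Rightarrow> (nat \<Rightarrow> complex) \<Rightarrow> (nat \<Rightarrow> complex) \<Rightarrow>
    nat \<Rightarrow> nat \<Rightarrow> complex" where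
  "sec_rows A F G j k x y i = (if i < 3 then frow (F i) (G i) x y else if i < 6 then brow A x y (i - 3)
     else if i = 6 then unit_row j else unit_row (4 + k))"

text \<open>On the cone over \<open>P\<^sup>3 \<times> P\<^sup>3\<close> the form \<open>df\<^sub>0 \<and> df\<^sub>1 \<and> df\<^sub>2 \<and> db\<^sub>0 \<and> db\<^sub>1 \<and> db\<^sub>2\<close> is a multiple \<open>\<lambda>\<close> of the
  contraction of \<open>dx\<^sub>0 \<and> \<dots> \<and> dy\<^sub>3\<close> with the two Euler fields. The determinant below is \<open>\<lambda> x\<^sub>j y\<^sub>k\<close>.\<close>

definition sec_val :: "(nat \<Rightarrow> nat \<Rightarrow> nat \<Rightarrow> complex) \<Rightarrow> (nat \<Rightarrow> (nat \<Rightarrow> complex) \<Rightarrow> complex) \<Rightarrow>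
    (nat \<Rightarrow> (nat \<Rightarrow> complex) \<Rightarrow> complex) \<Rightarrow> nat \<Rightarrow> nat \<Rightarrow> (nat \<Rightarrow> complex) \<Rightarrow> (nat \<Rightarrow> complex) \<Rightarrow> complex" where
  "sec_val A F G j k x y = rowdet 8 (sec_rows A F G j k x y)"

text \<open>The choices are homogeneous coordinates \<open>(x, y)\<close> of the point and a local
  quotient for each function; \<open>antican_eq\<close> shows that the value does not depend on
  them.\<close>

definition antican :: "(nat \<Rightarrow> nat \<Rightarrow> nat \<Rightarrow> complex) \<Rightarrow> nat \<Rightarrow> nat \<Rightarrow> complex point set \<Rightarrow>
    (nat \<Rightarrow> complex point \<Rightarrow> complex) \<Rightarrow> complex point \<Rightarrow> complex" where
  "antican A j k U f p = (SOME s. \<exists>x y F G. in_cone A x y \<and> p = pt (segre x y) \<and>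
     (\<forall>i<3. local_rep 15 U p (f i) (F i) (G i)) \<and> s = sec_val A F G j k x y)"

lemma sec_rows_update:
  "i < 3 \<Longrightarrow> sec_rows A (F(i := P)) (G(i := Q)) j k x y = (sec_rows A F G j k x y)(i := frow P Q x y)"
  by (auto simp: sec_rows_def fun_eq_iff)

lemma sec_val_update:
  "i < 3 \<Longrightarrow> sec_val A (F(i := P)) (G(i := Q)) j k x y = rowdet 8 ((sec_rows A F G j k x y)(i := frow P Q x y))"
  by (simp add: sec_val_def sec_rows_update)

lemma sec_val_cong:
  assumes "\<And>k. k < 4 \<Longrightarrow> x k = x' k" "\<And>k. k < 4 \<Longrightarrow> y k = y' k"
  shows "sec_val A F G j k x y = sec_val A F G j k x' y'"
proof -
  have e: "segre x y = segre x' y'" by (rule segre_cong) (use assms in auto)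
  have d: "drow F x y = drow F x' y'" for F by (rule drow_cong) (use assms in auto)
  have "frow F G x y = frow F G x' y'" for F G by (rule ext) (simp only: frow_def e d)
  moreover have "brow A x y = brow A x' y'" by (rule brow_cong) (use assms in auto)
  ultimately have "sec_rows A F G j k x y = sec_rows A F G j k x' y'" by (simp add: sec_rows_def fun_eq_iff)
  then show ?thesis by (simp add: sec_val_def)
qed

text \<open>Rows have weights \<open>1, 1, 1\<close>, three times \<open>a * b\<close>, then
  \<open>a\<close> and \<open>b\<close>; columns have four times \<open>1 / a\<close> and four times
  \<open>1 / b\<close>. The product is 1. This is adjunction in numbers: bidegree (4, 4) minus three
  times (1, 1) leaves (1, 1), carried by the two unit rows.\<close>

lemma sec_val_scale:
  assumes FG: "\<And>i. i < 3 \<Longrightarrow> \<exists>d. form UNIV 15 d (F i) \<and> form UNIV 15 d (G i)"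
    and ab: "a \<noteq> 0" "b \<noteq> 0" and jk: "j < 4" "k < 4"
  shows "sec_val A F G j k (\<lambda>i. a * x i) (\<lambda>i. b * y i) = sec_val A F G j k x y"
proof -
  let ?\<sigma> = "\<lambda>l::nat. if l < 4 then 1 / a else 1 / b"
  let ?\<rho> = "\<lambda>i::nat. if i < 3 then 1 else if i < 6 then a * b else if i = 6 then a else b"
  have "sec_val A F G j k (\<lambda>i. a * x i) (\<lambda>i. b * y i) =
    rowdet 8 (\<lambda>i l. ?\<rho> i * ?\<sigma> l * sec_rows A F G j k x y i l)"
    unfolding sec_val_def
  proof (rule rowdet_cong)
    fix i l :: nat assume "i < 8" and l: "l < 8"
    consider "i < 3" | "3 \<le> i \<and> i < 6" | "6 \<le> i" by linarith
    then show "sec_rows A F G j k (\<lambda>i. a * x i) (\<lambda>i. b * y i) i l = ?\<rho> i * ?\<sigma> l * sec_rows A F G j k x y i l"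
    proof cases
      case 1
      then obtain d where "form UNIV 15 d (F i)" "form UNIV 15 d (G i)" using FG by blast
      then show ?thesis using 1 frow_scale[OF _ _ l ab] by (simp add: sec_rows_def)
    next
      case 2
      have "brow A (\<lambda>i. a * x i) (\<lambda>i. b * y i) (i - 3) l = (a * b) * ?\<sigma> l * brow A x y (i - 3) l"
        using ab by (simp add: brow_def rrow_def lrow_def sum_distrib_left algebra_simps)
      then show ?thesis using 2 by (simp add: sec_rows_def)
    next
      case 3
      then show ?thesis using ab jk by (simp add: sec_rows_def)
    qed
  qed
  also have "\<dots> = (\<Prod>i<8. ?\<rho> i) * (\<Prod>l<8. ?\<sigma> l) * sec_val A F G j k x y"
    unfolding sec_val_def by (rule rowdet_scale_rows_columns)
  also have "(\<Prod>i<8. ?\<rho> i) * (\<Prod>l<8. ?\<sigma> l) = 1" using ab by (simp add: eval_nat_numeral)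
  finally show ?thesis by simp
qed

lemma segre_in_pt: "segre x y \<in> pt (segre x y)"
  unfolding pt_def by (auto intro!: exI[of _ 1])

lemma in_ptE:
  assumes "v \<in> pt w"
  obtains c where "c \<noteq> 0" "v = (\<lambda>i. c * w i)"
  using assms unfolding pt_def by blast

lemma pt_scale: "c \<noteq> 0 \<Longrightarrow> pt (\<lambda>i. c * v i) = pt v"
proof -
  assume c: "c \<noteq> 0"
  have "(\<lambda>i. d * v i) \<in> pt (\<lambda>i. c * v i)" if "d \<noteq> 0" for d
    unfolding pt_def using c that by (intro CollectI exI[of _ "d / c"]) auto
  moreover have "(\<lambda>i. d * (c * v i)) \<in> pt v" if "d \<noteq> 0" for d
    unfolding pt_def using c that by (intro CollectI exI[of _ "d * c"]) auto
  ultimately show ?thesis by (auto elim!: in_ptE)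
qed

lemma segre_point_eq:
  assumes xy: "in_cone A x y" "in_cone A' x' y'" and eq: "pt (segre x y) = pt (segre x' y')"
  obtains a b where "a \<noteq> 0" "b \<noteq> 0" "\<And>j. j < 4 \<Longrightarrow> x' j = a * x j" "\<And>k. k < 4 \<Longrightarrow> y' k = b * y k"
proof -
  obtain c where c: "c \<noteq> 0" "segre x' y' = (\<lambda>i. c * segre x y i)"
    using segre_in_pt[of x' y'] unfolding eq[symmetric] by (rule in_ptE)
  have e: "x' j * y' k = c * (x j * y k)" if "j < 4" "k < 4" for j k
    using fun_cong[OF c(2), of "4 * j + k"] that by (simp add: segre_index)
  obtain j0 k0 where jk: "j0 < 4" "x' j0 \<noteq> 0" "k0 < 4" "y' k0 \<noteq> 0" using xy(2) by (auto simp: in_cone_def)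
  have ne: "x j0 \<noteq> 0" "y k0 \<noteq> 0" using e[OF jk(1,3)] jk by auto
  show ?thesis
  proof (rule that[of "c * y k0 / y' k0" "c * x j0 / x' j0"])
    show "x' j = c * y k0 / y' k0 * x j" if "j < 4" for j using e[OF that jk(3)] jk by (simp add: field_simps)
    show "y' k = c * x j0 / x' j0 * y k" if "k < 4" for k using e[OF jk(1) that] jk by (simp add: field_simps)
  qed (use c jk ne in auto)
qed

text \<open>A principal open neighbourhood inside \<open>U\<close>. Multiplication by
  \<open>Q\<close> turns equations between forms that hold over \<open>U\<close> into equations over
  the whole variety.\<close>

lemma open_separating_form:
  assumes U: "zariski_open_in 15 (bilin_intersection A) U" and xy: "in_cone A x y" "pt (segre x y) \<in> U"
  obtains e Q where "form UNIV 15 e Q" "Q (segre x y) \<noteq> 0"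
    "\<And>x' y'. in_cone A x' y' \<Longrightarrow> pt (segre x' y') \<notin> U \<Longrightarrow> Q (segre x' y') = 0"
proof -
  obtain S where S: "\<And>F. F \<in> S \<Longrightarrow> \<exists>d. form UNIV 15 d F"
    "U = bilin_intersection A - {p \<in> proj_space 15. \<forall>F\<in>S. \<forall>v\<in>p. F v = 0}"
    using U unfolding zariski_open_in_def zariski_closed_def by blast
  have "pt (segre x y) \<in> proj_space 15" using segre_coord_vecs[OF xy(1)] unfolding proj_space_def by blast
  then obtain F v where F: "F \<in> S" "v \<in> pt (segre x y)" "F v \<noteq> 0" using xy(2) S(2) by blast
  obtain d where d: "form UNIV 15 d F" using S F by blast
  obtain c where "v = (\<lambda>i. c * segre x y i)" using F(2) by (rule in_ptE)
  then have "F (segre x y) \<noteq> 0" using F(3) form_homogeneous[OF d, of c] by auto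
  moreover have "F (segre x' y') = 0" if "in_cone A x' y'" "pt (segre x' y') \<notin> U" for x' y'
  proof -
    have "pt (segre x' y') \<in> bilin_intersection A" using that(1) unfolding bilin_intersection_eq by blast
    then have "\<forall>F\<in>S. \<forall>v\<in>pt (segre x' y'). F v = 0" using that(2) S(2) by blast
    then show ?thesis using F(1) segre_in_pt by blast
  qed
  ultimately show ?thesis using that d by blast
qed

context smooth_net
begin

text \<open>\<open>H = F G' - F' G\<close> is known to vanish only over \<open>U\<close> and where
  both quotients are defined; multiplied by \<open>P = G G' Q\<close> it vanishes on the whole cone.
  At the given point \<open>H = 0\<close>, so the differential of \<open>H P\<close> is
  \<open>P\<close> times that of \<open>H\<close>, and the two rows differ by a multiple of it, to
  which \<open>drow_dependent\<close> applies.\<close>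

lemma rowdet_frow_unique:
  assumes U: "zariski_open_in 15 (bilin_intersection A) U" and xy: "in_cone A x y" "pt (segre x y) \<in> U"
    and F: "local_rep 15 U (pt (segre x y)) f F G" and F': "local_rep 15 U (pt (segre x y)) f F' G'"
    and r: "\<And>i j. i < 3 \<Longrightarrow> j < 8 \<Longrightarrow> r (3 + i) j = brow A x y i j" and i0: "i0 < 3"
  shows "rowdet 8 (r(i0 := frow F G x y)) = rowdet 8 (r(i0 := frow F' G' x y))"
proof -
  let ?z = "segre x y"
  obtain d d' where d: "form UNIV 15 d F" "form UNIV 15 d G" and d': "form UNIV 15 d' F'" "form UNIV 15 d' G'"
    using F F' unfolding local_rep_def by blast
  have ne: "G ?z \<noteq> 0" "G' ?z \<noteq> 0" using F F' segre_in_pt unfolding local_rep_def by blast+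
  have fq: "F w * G' w = F' w * G w" if "w \<in> q" "q \<in> U" "G w \<noteq> 0" "G' w \<noteq> 0" for w q
  proof -
    have "f q = F w / G w" "f q = F' w / G' w" using F F' that unfolding local_rep_def by blast+
    then show ?thesis using that by (simp add: field_simps)
  qed
  obtain e Q where Q: "form UNIV 15 e Q" "Q ?z \<noteq> 0"
    "\<And>x' y'. in_cone A x' y' \<Longrightarrow> pt (segre x' y') \<notin> U \<Longrightarrow> Q (segre x' y') = 0"
    using open_separating_form[OF U xy] by blast
  define H where "H v = F v * G' v - F' v * G v" for v
  define P where "P v = G v * G' v * Q v" for v
  have H: "form UNIV 15 (d + d') H"
    using form_diff[OF form.mult[OF d(1) d'(2)]] form.mult[OF d'(1) d(2)] unfolding H_def by (simp add: add.commute)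
  have P: "form UNIV 15 (d + d' + e) P" unfolding P_def by (intro form.mult d d' Q)
  have H0: "H ?z = 0" unfolding H_def using fq[OF segre_in_pt xy(2) ne] by simp
  have HP: "H (segre x' y') * P (segre x' y') = 0" if "in_cone A x' y'" for x' y'
    using Q(3)[OF that] fq[OF segre_in_pt, of x' y'] by (auto simp: H_def P_def)
  define c where "c = 1 / (G ?z * G' ?z * P ?z)"
  have "P ?z \<noteq> 0" using ne Q(2) by (simp add: P_def)
  have row: "frow F G x y j = frow F' G' x y j + c * drow (\<lambda>v. H v * P v) x y j" if "j < 8" for j
    using frow_diff[OF d d' that ne] fq[OF segre_in_pt xy(2) ne] \<open>P ?z \<noteq> 0\<close>
    unfolding drow_mult[OF H P that] H0 by (simp add: c_def flip: H_def)
  have "rowdet 8 (r(i0 := frow F G x y)) =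
      rowdet 8 (r(i0 := \<lambda>j. frow F' G' x y j + c * drow (\<lambda>v. H v * P v) x y j))"
    by (rule rowdet_cong) (simp add: row)
  also have "\<dots> = rowdet 8 (r(i0 := frow F' G' x y)) + c * rowdet 8 (r(i0 := drow (\<lambda>v. H v * P v) x y))"
    using i0 by (simp only: rowdet_add rowdet_scale)
  also have "rowdet 8 (r(i0 := drow (\<lambda>v. H v * P v) x y)) = 0"
    by (rule drow_dependent[OF form.mult[OF H P] HP xy(1) i0]) (use r i0 in auto)
  finally show ?thesis by (simp only: mult_zero_right add_0_right)
qed

lemma sec_val_unique:
  assumes U: "zariski_open_in 15 (bilin_intersection A) U" and xy: "in_cone A x y" "pt (segre x y) \<in> U"
    and F: "\<And>i. i < 3 \<Longrightarrow> local_rep 15 U (pt (segre x y)) (f i) (F i) (G i)"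
    and F': "\<And>i. i < 3 \<Longrightarrow> local_rep 15 U (pt (segre x y)) (f i) (F' i) (G' i)"
  shows "sec_val A F G j k x y = sec_val A F' G' j k x y"
proof -
  \<comment> \<open>The quotients are exchanged one at a time: at stage \<open>m\<close> the first
    \<open>m\<close> functions use the new ones.\<close>
  define M where "M m i = (if i < m then F' i else F i)" for m i :: nat
  define N where "N m i = (if i < m then G' i else G i)" for m i :: nat
  have step: "sec_val A (M (Suc m)) (N (Suc m)) j k x y = sec_val A (M m) (N m) j k x y" if m: "m < 3" for m
  proof -
    have "M (Suc m) = (M m)(m := F' m)" "N (Suc m) = (N m)(m := G' m)"
      by (auto simp: M_def N_def fun_eq_iff)
    moreover have "M m = (M m)(m := F m)" "N m = (N m)(m := G m)" by (auto simp: M_def N_def fun_eq_iff)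
    moreover have "rowdet 8 ((sec_rows A (M m) (N m) j k x y)(m := frow (F' m) (G' m) x y)) =
        rowdet 8 ((sec_rows A (M m) (N m) j k x y)(m := frow (F m) (G m) x y))"
      by (rule rowdet_frow_unique[OF U xy F'[OF m] F[OF m] _ m]) (simp add: sec_rows_def)
    ultimately show ?thesis using sec_val_update[OF m] by metis
  qed
  have "sec_val A (M 3) (N 3) j k x y = sec_val A (M 0) (N 0) j k x y"
    using step[of 0] step[of 1] step[of 2] by (simp add: numeral_3_eq_3 numeral_2_eq_2)
  moreover have "sec_val A (M 3) (N 3) j k x y = sec_val A F' G' j k x y"
    by (auto simp: sec_val_def sec_rows_def M_def N_def intro!: arg_cong[of _ _ "rowdet 8"])
  moreover have "M 0 = F" "N 0 = G" by (auto simp: M_def N_def fun_eq_iff)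
  ultimately show ?thesis by simp
qed

lemma antican_eq:
  assumes U: "zariski_open_in 15 (bilin_intersection A) U" and xy: "in_cone A x y" "pt (segre x y) \<in> U"
    and F: "\<And>i. i < 3 \<Longrightarrow> local_rep 15 U (pt (segre x y)) (f i) (F i) (G i)" and jk: "j < 4" "k < 4"
  shows "antican A j k U f (pt (segre x y)) = sec_val A F G j k x y"
  unfolding antican_def
proof (rule some_equality)
  show "\<exists>x' y' F' G'. in_cone A x' y' \<and> pt (segre x y) = pt (segre x' y') \<and>
      (\<forall>i<3. local_rep 15 U (pt (segre x y)) (f i) (F' i) (G' i)) \<and>
      sec_val A F G j k x y = sec_val A F' G' j k x' y'"
    using xy F by blast
next
  fix s
  assume "\<exists>x' y' F' G'. in_cone A x' y' \<and> pt (segre x y) = pt (segre x' y') \<and>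
      (\<forall>i<3. local_rep 15 U (pt (segre x y)) (f i) (F' i) (G' i)) \<and> s = sec_val A F' G' j k x' y'"
  then obtain x' y' F' G' where *: "in_cone A x' y'" "pt (segre x y) = pt (segre x' y')"
    "\<And>i. i < 3 \<Longrightarrow> local_rep 15 U (pt (segre x y)) (f i) (F' i) (G' i)" "s = sec_val A F' G' j k x' y'"
    by blast
  obtain a b where ab: "a \<noteq> 0" "b \<noteq> 0" "\<And>j. j < 4 \<Longrightarrow> x' j = a * x j" "\<And>k. k < 4 \<Longrightarrow> y' k = b * y k"
    using segre_point_eq[OF xy(1) *(1,2)] by blast
  have "s = sec_val A F' G' j k (\<lambda>i. a * x i) (\<lambda>i. b * y i)"
    unfolding *(4) by (rule sec_val_cong) (use ab in auto)
  also have "\<dots> = sec_val A F' G' j k x y"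
    by (rule sec_val_scale[OF _ ab(1,2) jk]) (use *(3) in \<open>auto simp: local_rep_def\<close>)
  also have "\<dots> = sec_val A F G j k x y" by (rule sec_val_unique[OF U xy *(3) F])
  finally show "s = sec_val A F G j k x y" .
qed

end

section \<open>The determinants define anticanonical sections\<close>

lemma local_rep_restrict:
  assumes "local_rep n U p f F G" "V \<subseteq> U" "\<And>q. q \<in> V \<Longrightarrow> g q = f q"
  shows "local_rep n V p g F G"
  using assms unfolding local_rep_def by fastforce

lemma local_rep_add:
  assumes "local_rep n U p f F G" "local_rep n U p g F' G'"
  shows "local_rep n U p (\<lambda>q. f q + g q) (\<lambda>v. F v * G' v + F' v * G v) (\<lambda>v. G v * G' v)"
proof -
  obtain d e where d: "form UNIV n d F" "form UNIV n d G" and e: "form UNIV n e F'" "form UNIV n e G'"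
    using assms unfolding local_rep_def by blast
  have "form UNIV n (d + e) (\<lambda>v. F v * G' v + F' v * G v)"
  proof (rule form.add[OF form.mult[OF d(1) e(2)]])
    show "form UNIV n (d + e) (\<lambda>v. F' v * G v)"
      using form.mult[OF e(1) d(2)] by (simp only: add.commute)
  qed
  moreover have "form UNIV n (d + e) (\<lambda>v. G v * G' v)" by (rule form.mult[OF d(2) e(2)])
  moreover have "f q + g q = (F v * G' v + F' v * G v) / (G v * G' v)"
    if "q \<in> U" "v \<in> q" "G v * G' v \<noteq> 0" for q v
  proof -
    have "f q = F v / G v" "g q = F' v / G' v" using assms that unfolding local_rep_def by auto
    then show ?thesis using that by (simp add: field_simps)
  qed
  ultimately show ?thesis using assms unfolding local_rep_def by auto
qed

lemma local_rep_mult: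
  assumes "local_rep n U p f F G" "local_rep n U p g F' G'"
  shows "local_rep n U p (\<lambda>q. f q * g q) (\<lambda>v. F v * F' v) (\<lambda>v. G v * G' v)"
proof -
  obtain d e where d: "form UNIV n d F" "form UNIV n d G" and e: "form UNIV n e F'" "form UNIV n e G'"
    using assms unfolding local_rep_def by blast
  have "form UNIV n (d + e) (\<lambda>v. F v * F' v)" by (rule form.mult[OF d(1) e(1)])
  moreover have "form UNIV n (d + e) (\<lambda>v. G v * G' v)" by (rule form.mult[OF d(2) e(2)])
  moreover have "f q * g q = (F v * F' v) / (G v * G' v)"
    if "q \<in> U" "v \<in> q" "G v * G' v \<noteq> 0" for q v
  proof -
    have "f q = F v / G v" "g q = F' v / G' v" using assms that unfolding local_rep_def by auto
    then show ?thesis by simp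
  qed
  ultimately show ?thesis using assms unfolding local_rep_def by auto
qed

lemma local_rep_const: "local_rep n U p (\<lambda>_. c) (\<lambda>_. c) (\<lambda>_. 1)"
proof -
  have "\<exists>d. form UNIV n d (\<lambda>_. c) \<and> form UNIV n d (\<lambda>_. 1)" using form.const[of _ UNIV n] by blast
  then show ?thesis by (simp add: local_rep_def)
qed

lemma local_rep_value: "local_rep n U p f F G \<Longrightarrow> p \<in> U \<Longrightarrow> v \<in> p \<Longrightarrow> f p = F v / G v"
  unfolding local_rep_def by blast

lemma rowdet_add_multiple:
  assumes "i < n" "k < n" "i \<noteq> k" "\<And>j. j < n \<Longrightarrow> a j = b j + c * r k j"
  shows "rowdet n (r(i := a)) = rowdet n (r(i := b))"
proof -
  have "rowdet n (r(i := a)) = rowdet n (r(i := \<lambda>j. b j + c * r k j))"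
    by (rule rowdet_cong) (simp add: assms(4))
  also have "\<dots> = rowdet n (r(i := b)) + c * rowdet n (r(i := r k))"
    using assms(1) by (simp only: rowdet_add rowdet_scale)
  also have "rowdet n (r(i := r k)) = 0" by (rule rowdet_identical[of i n k]) (use assms in auto)
  finally show ?thesis by (simp only: mult_zero_right add_0_right)
qed

lemma sum_8: "(\<Sum>j<8. f j) = (\<Sum>j<4. f j) + (\<Sum>k<4. f (4 + k))" for f :: "nat \<Rightarrow> 'a::comm_monoid_add"
  by (simp add: eval_nat_numeral ac_simps)

lemma pt_segre_in: "in_cone A x y \<Longrightarrow> pt (segre x y) \<in> bilin_intersection A"
  unfolding bilin_intersection_eq by blast

lemma zariski_open_in_subset: "zariski_open_in n X U \<Longrightarrow> U \<subseteq> X"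
  unfolding zariski_open_in_def by blast

context smooth_net
begin

lemma antican_point:
  fixes f :: "nat \<Rightarrow> complex point \<Rightarrow> complex"
  assumes U: "zariski_open_in 15 (bilin_intersection A) U" and p: "p \<in> U"
    and f: "\<And>i. i < 3 \<Longrightarrow> regular_on 15 U (f i)"
  obtains x y F G where "in_cone A x y" "p = pt (segre x y)"
    "\<forall>i<3. local_rep 15 U (pt (segre x y)) (f i) (F i) (G i)"
proof -
  obtain x y where xy: "in_cone A x y" "p = pt (segre x y)"
    using p zariski_open_in_subset[OF U] unfolding bilin_intersection_eq by blast
  have "\<forall>i. \<exists>F G. i < 3 \<longrightarrow> local_rep 15 U p (f i) F G"
    using f p unfolding regular_on_local_rep by blast
  then obtain F G where "\<And>i. i < 3 \<longrightarrow> local_rep 15 U p (f i) (F i) (G i)" by metis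
  then show ?thesis using that[OF xy, of F G] xy(2) by simp
qed

lemma antican_restrict:
  assumes U: "zariski_open_in 15 (bilin_intersection A) U" and V: "zariski_open_in 15 (bilin_intersection A) V"
    and sub: "V \<subseteq> U" and f: "\<And>i. i < 3 \<Longrightarrow> regular_on 15 U (f i)"
    and fg: "\<And>i q. i < 3 \<Longrightarrow> q \<in> V \<Longrightarrow> f i q = g i q" and p: "p \<in> V" and jk: "j < 4" "k < 4"
  shows "antican A j k U f p = antican A j k V g p"
proof -
  obtain x y F G where xy: "in_cone A x y" "p = pt (segre x y)"
    and F': "\<forall>i<3. local_rep 15 U (pt (segre x y)) (f i) (F i) (G i)"
    by (rule antican_point[OF U subsetD[OF sub p] f])
  note F = F'[rule_format]
  have pU: "pt (segre x y) \<in> U" "pt (segre x y) \<in> V" using xy p sub by auto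
  have G: "local_rep 15 V (pt (segre x y)) (g i) (F i) (G i)" if "i < 3" for i
    by (rule local_rep_restrict[OF F[OF that] sub]) (simp add: fg that)
  show ?thesis unfolding xy(2)
    using antican_eq[OF U xy(1) pU(1) F jk] antican_eq[OF V xy(1) pU(2) G jk] by simp
qed

lemma antican_derivation:
  assumes U: "zariski_open_in 15 (bilin_intersection A) U" and f: "\<And>i. i < 3 \<Longrightarrow> regular_on 15 U (f i)"
    and i: "i < 3" and ab: "regular_on 15 U a" "regular_on 15 U b" and p: "p \<in> U" and jk: "j < 4" "k < 4"
  shows "antican A j k U (f(i := (\<lambda>q. a q + b q))) p =
      antican A j k U (f(i := a)) p + antican A j k U (f(i := b)) p"
    and "antican A j k U (f(i := (\<lambda>q. a q * b q))) p =
      a p * antican A j k U (f(i := b)) p + b p * antican A j k U (f(i := a)) p"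
    and "antican A j k U (f(i := (\<lambda>_. c))) p = 0"
proof -
  obtain x y F G where xy: "in_cone A x y" "p = pt (segre x y)"
    and F': "\<forall>i<3. local_rep 15 U (pt (segre x y)) (f i) (F i) (G i)"
    by (rule antican_point[OF U p f])
  note F = F'[rule_format]
  have pU: "pt (segre x y) \<in> U" using xy p by simp
  obtain Fa Ga Fb Gb where a: "local_rep 15 U (pt (segre x y)) a Fa Ga"
    and b: "local_rep 15 U (pt (segre x y)) b Fb Gb"
    using ab pU unfolding regular_on_local_rep by metis
  have val: "antican A j k U (f(i := h)) p = rowdet 8 ((sec_rows A F G j k x y)(i := frow P Q x y))"
    if "local_rep 15 U (pt (segre x y)) h P Q" for h P Q
  proof -
    have "local_rep 15 U (pt (segre x y)) ((f(i := h)) l) ((F(i := P)) l) ((G(i := Q)) l)" if "l < 3" for l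
      using F[OF that] \<open>local_rep 15 U (pt (segre x y)) h P Q\<close> by simp
    then show ?thesis unfolding xy(2) using antican_eq[OF U xy(1) pU _ jk, of "f(i := h)"] sec_val_update[OF i]
      by metis
  qed
  obtain d e where d: "form UNIV 15 d Fa" "form UNIV 15 d Ga" and e: "form UNIV 15 e Fb" "form UNIV 15 e Gb"
    using a b unfolding local_rep_def by blast
  have ne: "Ga (segre x y) \<noteq> 0" "Gb (segre x y) \<noteq> 0" using a b segre_in_pt unfolding local_rep_def by blast+
  have ap: "a p = Fa (segre x y) / Ga (segre x y)" "b p = Fb (segre x y) / Gb (segre x y)"
    using local_rep_value[OF a pU segre_in_pt] local_rep_value[OF b pU segre_in_pt] xy by auto
  have i8: "i < 8" using i by simp
  let ?r = "sec_rows A F G j k x y"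
  have "rowdet 8 (?r(i := frow (\<lambda>v. Fa v * Gb v + Fb v * Ga v) (\<lambda>v. Ga v * Gb v) x y)) =
      rowdet 8 (?r(i := \<lambda>l. frow Fa Ga x y l + frow Fb Gb x y l))"
    by (rule rowdet_cong) (simp add: frow_add[OF d e _ ne])
  then show "antican A j k U (f(i := (\<lambda>q. a q + b q))) p =
      antican A j k U (f(i := a)) p + antican A j k U (f(i := b)) p"
    by (simp only: val[OF local_rep_add[OF a b]] val[OF a] val[OF b] rowdet_add[OF i8])
  have "rowdet 8 (?r(i := frow (\<lambda>v. Fa v * Fb v) (\<lambda>v. Ga v * Gb v) x y)) =
      rowdet 8 (?r(i := \<lambda>l. a p * frow Fb Gb x y l + b p * frow Fa Ga x y l))"
    by (rule rowdet_cong) (simp add: frow_mult[OF d e _ ne] ap)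
  then show "antican A j k U (f(i := (\<lambda>q. a q * b q))) p =
      a p * antican A j k U (f(i := b)) p + b p * antican A j k U (f(i := a)) p"
    by (simp only: val[OF local_rep_mult[OF a b]] val[OF a] val[OF b] rowdet_add[OF i8] rowdet_scale[OF i8])
  have "frow (\<lambda>_. c) (\<lambda>_. 1) x y = (\<lambda>l. 0)" by (simp add: fun_eq_iff frow_def drow_const)
  then show "antican A j k U (f(i := (\<lambda>_. c))) p = 0"
    by (simp only: val[OF local_rep_const] rowdet_zero[OF i8])
qed

text \<open>Functions that agree on \<open>U\<close> may be given the same local quotient, which
  makes two rows equal.\<close>

lemma antican_alternating:
  assumes U: "zariski_open_in 15 (bilin_intersection A) U" and f: "\<And>i. i < 3 \<Longrightarrow> regular_on 15 U (f i)"
    and il: "i < 3" "l < 3" "i \<noteq> l" and eq: "\<And>q. q \<in> U \<Longrightarrow> f i q = f l q" and p: "p \<in> U" and jk: "j < 4" "k < 4"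
  shows "antican A j k U f p = 0"
proof -
  obtain x y F G where xy: "in_cone A x y" "p = pt (segre x y)"
    and F': "\<forall>i<3. local_rep 15 U (pt (segre x y)) (f i) (F i) (G i)"
    by (rule antican_point[OF U p f])
  note F = F'[rule_format]
  have pU: "pt (segre x y) \<in> U" using xy p by simp
  have "local_rep 15 U (pt (segre x y)) (f l) (F i) (G i)"
    by (rule local_rep_restrict[OF F[OF il(1)] subset_refl]) (simp add: eq)
  then have "local_rep 15 U (pt (segre x y)) (f m) ((F(l := F i)) m) ((G(l := G i)) m)" if "m < 3" for m
    using F[OF that] by simp
  from antican_eq[where f = f and F = "F(l := F i)" and G = "G(l := G i)", OF U xy(1) pU this jk]
  have "antican A j k U f p = rowdet 8 ((sec_rows A F G j k x y)(l := frow (F i) (G i) x y))"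
    unfolding xy(2) sec_val_update[OF il(2)] .
  also have "\<dots> = 0" by (rule rowdet_identical[of i _ l]) (use il in \<open>auto simp: sec_rows_def\<close>)
  finally show ?thesis .
qed

text \<open>The quotient is expanded by a coordinate that is nonzero at the point. Positive degree
  is wanted because differentiation lowers degrees by truncated subtraction.\<close>

lemma local_rep_positive_degree:
  assumes F: "local_rep 15 U (pt (segre x y)) f F G" and m: "m \<le> 15" "segre x y m \<noteq> 0"
  shows "local_rep 15 U (pt (segre x y)) f (\<lambda>v. F v * v m) (\<lambda>v. G v * v m)"
    and "\<exists>d>0. form UNIV 15 d (\<lambda>v. F v * v m) \<and> form UNIV 15 d (\<lambda>v. G v * v m)"
proof -
  obtain d where d: "form UNIV 15 d F" "form UNIV 15 d G" using F unfolding local_rep_def by blast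
  have "form UNIV 15 (d + 1) (\<lambda>v. F v * v m)" "form UNIV 15 (d + 1) (\<lambda>v. G v * v m)"
    by (intro form.mult d form.coord m)+
  then show *: "\<exists>d>0. form UNIV 15 d (\<lambda>v. F v * v m) \<and> form UNIV 15 d (\<lambda>v. G v * v m)"
    by (intro exI[of _ "d + 1"]) simp
  have "v m \<noteq> 0" if "v \<in> pt (segre x y)" for v using that m(2) by (auto elim!: in_ptE)
  then show "local_rep 15 U (pt (segre x y)) f (\<lambda>v. F v * v m) (\<lambda>v. G v * v m)"
    using F * unfolding local_rep_def by auto
qed

text \<open>Near a point with \<open>x\<^sub>a y\<^sub>b \<noteq> 0\<close> the factors of \<open>z = x \<otimes> y\<close> are, up to scalars, the row and the
  column of \<open>z\<close> through the entry \<open>(a, b)\<close>, so that the determinant becomes a form in \<open>z\<close>.\<close>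

lemma antican_regular:
  assumes U: "zariski_open_in 15 (bilin_intersection A) U" and f: "\<And>i. i < 3 \<Longrightarrow> regular_on 15 U (f i)"
    and jk: "j < 4" "k < 4"
  shows "regular_on 15 U (antican A j k U f)"
  unfolding regular_on_local_rep
proof
  fix p assume p: "p \<in> U"
  obtain x y F0 G0 where xy: "in_cone A x y" "p = pt (segre x y)"
    and F0': "\<forall>i<3. local_rep 15 U (pt (segre x y)) (f i) (F0 i) (G0 i)"
    by (rule antican_point[OF U p f])
  note F0 = F0'[rule_format]
  obtain a b where ab: "a < 4" "x a \<noteq> 0" "b < 4" "y b \<noteq> 0" using xy(1) by (auto simp: in_cone_def)
  define m where "m = 4 * a + b"
  have m: "m \<le> 15" "segre x y m \<noteq> 0" using ab by (auto simp: m_def segre_index)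
  define F where "F i v = F0 i v * v m" for i v
  define G where "G i v = G0 i v * v m" for i v
  have F: "local_rep 15 U (pt (segre x y)) (f i) (F i) (G i)" if "i < 3" for i
    unfolding F_def G_def by (rule local_rep_positive_degree(1)[OF F0[OF that] m])
  have "\<forall>i. \<exists>d. i < 3 \<longrightarrow> d > 0 \<and> form UNIV 15 d (F i) \<and> form UNIV 15 d (G i)"
    using local_rep_positive_degree(2)[OF F0 m] unfolding F_def G_def by blast
  then obtain d where d: "\<And>i. i < 3 \<Longrightarrow> d i > 0 \<and> form UNIV 15 (d i) (F i) \<and> form UNIV 15 (d i) (G i)"
    by metis
  define x' where "x' v l = v (4 * l + b)" for v :: "nat \<Rightarrow> complex" and l :: nat
  define y' where "y' v l = v (4 * a + l)" for v :: "nat \<Rightarrow> complex" and l :: nat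
  \<comment> \<open>Row \<open>i < 3\<close> is multiplied by the square of \<open>G i\<close> to
    clear its denominator; the product of these squares is \<open>Den\<close>.\<close>
  define rows where "rows i l v = (if i < 3 then
      drow (F i) (x' v) (y' v) l * G i (segre (x' v) (y' v)) - F i (segre (x' v) (y' v)) * drow (G i) (x' v) (y' v) l
    else sec_rows A F G j k (x' v) (y' v) i l)" for i l v
  define N where "N v = rowdet 8 (\<lambda>i l. rows i l v)" for v
  define Den where "Den v = (\<Prod>i<3. G i (segre (x' v) (y' v)) * G i (segre (x' v) (y' v)))" for v
  have fx: "form UNIV 15 1 (\<lambda>v. x' v l)" "form UNIV 15 1 (\<lambda>v. y' v l)" if "l < 4" for l
    unfolding x'_def y'_def using that ab by (auto intro!: form_coord)
  have fz: "form UNIV 15 2 (\<lambda>v. segre (x' v) (y' v) i)" if "i \<le> 15" for i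
    using form.mult[OF fx(1)[of "i div 4"] fx(2)[of "i mod 4"]] that by (simp add: segre_def numeral_2_eq_2)
  have fH: "form UNIV 15 (e * 2) (\<lambda>v. H (segre (x' v) (y' v)))" if "form UNIV 15 e H" for e H
    by (rule form_compose[OF that fz])
  have fdrow: "form UNIV 15 (2 * e - 1) (\<lambda>v. drow H (x' v) (y' v) l)"
    if H: "form UNIV 15 e H" "e > 0" and l: "l < 8" for e H l
  proof -
    have "form UNIV 15 ((e - 1) * 2 + 1) (\<lambda>v. drow H (x' v) (y' v) l)"
    proof (cases "l < 4")
      case True
      then show ?thesis unfolding drow_def
        by (simp only: True if_True) (intro form_sum form.mult fH form_partial[OF H(1)] fx, use True in auto)
    next
      case False
      then show ?thesis unfolding drow_def using l
        by (simp only: False if_False) (intro form_sum form.mult fH form_partial[OF H(1)] fx, auto)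
    qed
    moreover have "(e - 1) * 2 + 1 = 2 * e - 1" using H(2) by simp
    ultimately show ?thesis by metis
  qed
  let ?e = "\<lambda>i::nat. if i < 3 then 4 * d i - 1 else if i < 6 then 1 else 0"
  have "form UNIV 15 (\<Sum>i<8. ?e i) N"
    unfolding N_def
  proof (rule form_rowdet)
    fix i l :: nat assume "i < 8" and l: "l < 8"
    consider "i < 3" | "3 \<le> i" "i < 6" | "6 \<le> i" by linarith
    then show "form UNIV 15 (?e i) (rows i l)"
    proof cases
      case 1
      note di = d[OF 1]
      have e: "(2 * d i - 1) + d i * 2 = 4 * d i - 1" "d i * 2 + (2 * d i - 1) = 4 * d i - 1" using di by auto
      have "form UNIV 15 (4 * d i - 1) (\<lambda>v. drow (F i) (x' v) (y' v) l * G i (segre (x' v) (y' v)))"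
        using form.mult[OF fdrow[of "d i" "F i" l] fH[of "d i" "G i"]] di l by (simp only: e)
      moreover have "form UNIV 15 (4 * d i - 1) (\<lambda>v. F i (segre (x' v) (y' v)) * drow (G i) (x' v) (y' v) l)"
        using form.mult[OF fH[of "d i" "F i"] fdrow[of "d i" "G i" l]] di l by (simp only: e)
      moreover have "rows i l = (\<lambda>v. drow (F i) (x' v) (y' v) l * G i (segre (x' v) (y' v)) -
          F i (segre (x' v) (y' v)) * drow (G i) (x' v) (y' v) l)"
        using 1 by (simp add: rows_def fun_eq_iff)
      ultimately show ?thesis using 1 form_diff by (simp only: if_True)
    next
      case 2
      have "form UNIV 15 1 (\<lambda>v. brow A (x' v) (y' v) (i - 3) l)"
        unfolding brow_def rrow_def lrow_def using l
        by (cases "l < 4") (auto intro!: form_sum form_cmult fx[simplified])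
      moreover have "rows i l = (\<lambda>v. brow A (x' v) (y' v) (i - 3) l)"
        using 2 by (simp add: rows_def sec_rows_def fun_eq_iff)
      ultimately show ?thesis using 2 by simp
    next
      case 3
      then have "rows i l = (\<lambda>v. if i = 6 then unit_row j l else unit_row (4 + k) l)"
        by (simp add: rows_def sec_rows_def fun_eq_iff)
      then show ?thesis using 3 form.const[of "if i = 6 then unit_row j l else unit_row (4 + k) l" UNIV 15]
        by simp
    qed
  qed
  \<comment> \<open>Three rows of degree \<open>4 * d i - 1\<close> and three of degree 1 add up to
    the degree of \<open>Den\<close>, as a regular function requires.\<close>
  moreover have "(\<Sum>i<8. ?e i) = (\<Sum>i<3. d i * 2 + d i * 2)"
  proof -
    have "d 0 > 0" "d 1 > 0" "d 2 > 0" using d by auto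
    moreover have "{..<8::nat} = {0, 1, 2, 3, 4, 5, 6, 7}" "{..<3::nat} = {0, 1, 2}" by auto
    ultimately show ?thesis by simp
  qed
  ultimately have fN: "form UNIV 15 (\<Sum>i<3. d i * 2 + d i * 2) N" by simp
  have fDen: "form UNIV 15 (\<Sum>i<3. d i * 2 + d i * 2) Den"
    unfolding Den_def by (intro form_prod form.mult fH) (use d in auto)
  have xy': "segre (x' v) (y' v) = (\<lambda>i. (c * c * (x1 a * y1 b)) * segre x1 y1 i)"
    "x' v l = c * y1 b * x1 l" "y' v l = c * x1 a * y1 l"
    if "v = (\<lambda>i. c * segre x1 y1 i)" "l < 4" for v c x1 y1 l
  proof -
    have *: "x' v l = c * y1 b * x1 l" "y' v l = c * x1 a * y1 l" if "l < 4" for l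
      unfolding x'_def y'_def \<open>v = _\<close> using that ab by (simp_all add: segre_index)
    then show "x' v l = c * y1 b * x1 l" "y' v l = c * x1 a * y1 l" using that by auto
    have "segre (x' v) (y' v) = segre (\<lambda>l. c * y1 b * x1 l) (\<lambda>l. c * x1 a * y1 l)"
      by (rule segre_cong) (use * in auto)
    also have "\<dots> = (\<lambda>i. (c * y1 b * (c * x1 a)) * segre x1 y1 i)" by (rule segre_scale)
    finally show "segre (x' v) (y' v) = (\<lambda>i. (c * c * (x1 a * y1 b)) * segre x1 y1 i)"
      by (simp add: ac_simps)
  qed
  have "Den v \<noteq> 0" if "v \<in> p" for v
  proof -
    obtain c where c: "c \<noteq> 0" "v = (\<lambda>i. c * segre x y i)" using \<open>v \<in> p\<close> unfolding xy(2) by (rule in_ptE)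
    have "segre (x' v) (y' v) \<in> pt (segre x y)"
      unfolding xy'(1)[OF c(2) ab(1)] pt_def using c ab by (intro CollectI exI[of _ "c * c * (x a * y b)"]) simp
    then have "G i (segre (x' v) (y' v)) \<noteq> 0" if "i < 3" for i using F[OF that] unfolding local_rep_def by blast
    then show ?thesis unfolding Den_def by simp
  qed
  moreover have "antican A j k U f q = N v / Den v" if q: "q \<in> U" "v \<in> q" "Den v \<noteq> 0" for q v
  proof -
    obtain x1 y1 where xy1: "in_cone A x1 y1" "q = pt (segre x1 y1)"
      using q(1) zariski_open_in_subset[OF U] unfolding bilin_intersection_eq by blast
    obtain c where c: "c \<noteq> 0" "v = (\<lambda>i. c * segre x1 y1 i)" using q(2) unfolding xy1(2) by (rule in_ptE)
    let ?s = "c * c * (x1 a * y1 b)"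
    have Gne: "G i (segre (x' v) (y' v)) \<noteq> 0" if "i < 3" for i using q(3) that unfolding Den_def by auto
    \<comment> \<open>\<open>Den v\<close> is nonzero and \<open>d 0 > 0\<close>, so the scalar
      \<open>?s\<close> is nonzero: the row and column of \<open>v\<close> through
      \<open>(a, b)\<close> are then valid homogeneous coordinates of \<open>q\<close>.\<close>
    have "G 0 (segre (x' v) (y' v)) = ?s ^ d 0 * G 0 (segre x1 y1)"
      unfolding xy'(1)[OF c(2) ab(1)] using form_homogeneous[of UNIV 15 "d 0" "G 0" ?s] d[of 0] by auto
    then have s: "?s \<noteq> 0" using Gne[of 0] d[of 0] by (auto simp: power_0_left)
    have seg: "segre (x' v) (y' v) = (\<lambda>i. ?s * segre x1 y1 i)" by (rule xy'(1)[OF c(2) ab(1)])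
    have q': "pt (segre (x' v) (y' v)) = q" unfolding seg xy1(2) by (rule pt_scale[OF s])
    have cone: "in_cone A (x' v) (y' v)"
    proof -
      have "in_cone A (\<lambda>l. c * y1 b * x1 l) (\<lambda>l. c * x1 a * y1 l)"
        by (rule in_cone_scale[OF xy1(1)]) (use s in auto)
      moreover have "bilin h (x' v) (y' v) = bilin h (\<lambda>l. c * y1 b * x1 l) (\<lambda>l. c * x1 a * y1 l)" for h
        unfolding bilin_def by (intro sum.cong refl) (use xy'(2,3)[OF c(2)] in auto)
      ultimately show ?thesis unfolding in_cone_def using xy'(2,3)[OF c(2)] by auto
    qed
    have rep: "local_rep 15 U (pt (segre (x' v) (y' v))) (f i) (F i) (G i)" if "i < 3" for i
    proof -
      have "G i w \<noteq> 0" if "w \<in> pt (segre (x' v) (y' v))" for w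
        using that Gne[OF \<open>i < 3\<close>] form_homogeneous[of UNIV 15 "d i" "G i"] d[OF \<open>i < 3\<close>]
        by (auto elim!: in_ptE)
      then show ?thesis using F[OF that] unfolding local_rep_def by blast
    qed
    have "antican A j k U f q = sec_val A F G j k (x' v) (y' v)"
      using antican_eq[OF U cone _ rep jk] q' q(1) by simp
    also have "\<dots> = rowdet 8 (\<lambda>i l. (if i < 3 then 1 / (G i (segre (x' v) (y' v)))\<^sup>2 else 1) * 1 * rows i l v)"
      unfolding sec_val_def by (rule rowdet_cong) (simp add: rows_def sec_rows_def frow_def)
    also have "\<dots> = (\<Prod>i<8. if i < 3 then 1 / (G i (segre (x' v) (y' v)))\<^sup>2 else 1) * (\<Prod>l<8::nat. 1) * N v"
      unfolding N_def by (rule rowdet_scale_rows_columns)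
    also have "\<dots> = N v / Den v"
      unfolding Den_def by (simp add: eval_nat_numeral power2_eq_square)
    finally show ?thesis .
  qed
  ultimately have "local_rep 15 U p (antican A j k U f) N Den"
    unfolding local_rep_def using fN fDen by blast
  then show "\<exists>F G. local_rep 15 U p (antican A j k U f) F G" by blast
qed

lemma antican_anticanonical_section:
  assumes "j < 4" "k < 4"
  shows "anticanonical_section 3 1 15 (bilin_intersection A) (antican A j k)"
  unfolding anticanonical_section_def mult_1_right
  by (intro conjI allI impI ballI; (elim conjE)?)
     (use assms in \<open>auto intro: antican_regular antican_restrict antican_derivation antican_alternating\<close>)

end

section \<open>Equations of the threefold in Segre coordinates: closedness and smoothness\<close>

lemma sum_unit_row: "l < n \<Longrightarrow> (\<Sum>j<n. unit_row l j * g j) = g l" for n :: nat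
proof -
  assume "l < n"
  have "(\<Sum>j<n. unit_row l j * g j) = (\<Sum>j<n. if j = l then g j else 0)" by (rule sum.cong) auto
  then show ?thesis using \<open>l < n\<close> by simp
qed

lemma index_pair_eq: "k < 4 \<Longrightarrow> k' < 4 \<Longrightarrow> 4 * j + k = 4 * j' + k' \<longleftrightarrow> j = j' \<and> k = k'" for j k :: nat
  by presburger

text \<open>Product rule for \<open>x j0 * y k0\<close>, the value of this coordinate at
  \<open>segre x y\<close>.\<close>

lemma drow_coord:
  assumes "j0 < 4" "k0 < 4" "j < 8"
  shows "drow (\<lambda>v. v (4 * j0 + k0)) x y j = unit_row j0 j * y k0 + unit_row (4 + k0) j * x j0"
proof (cases "j < 4")
  case True
  have "drow (\<lambda>v. v (4 * j0 + k0)) x y j = (\<Sum>k<4. (if j = j0 \<and> k = k0 then 1 else 0) * y k)"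
    unfolding drow_def using True
    by (simp add: partial_coord) (intro sum.cong refl, use assms in \<open>auto simp: index_pair_eq\<close>)
  also have "\<dots> = (\<Sum>k<4. if k = k0 then (if j = j0 then y k else 0) else 0)" by (rule sum.cong) auto
  also have "\<dots> = unit_row j0 j * y k0 + unit_row (4 + k0) j * x j0" using assms True by simp
  finally show ?thesis .
next
  case False
  have "drow (\<lambda>v. v (4 * j0 + k0)) x y j = (\<Sum>i<4. (if i = j0 \<and> j - 4 = k0 then 1 else 0) * x i)"
    unfolding drow_def partial_coord using False assms
    by (simp only: if_False) (intro sum.cong refl, use assms index_pair_eq[of "j - 4" k0 _ j0] in auto)
  also have "\<dots> = (\<Sum>i<4. if i = j0 then (if j - 4 = k0 then x i else 0) else 0)" by (rule sum.cong) auto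
  also have "\<dots> = unit_row j0 j * y k0 + unit_row (4 + k0) j * x j0" using assms False by auto
  finally show ?thesis .
qed

lemma segre_rank_one:
  assumes w: "w \<in> coord_vecs 15" and ab: "a < 4" "b < 4" "w (4 * a + b) \<noteq> 0"
    and minors: "\<And>j k. j < 4 \<Longrightarrow> k < 4 \<Longrightarrow> w (4 * j + k) * w (4 * a + b) = w (4 * j + b) * w (4 * a + k)"
  shows "w = segre (\<lambda>j. w (4 * j + b)) (\<lambda>k. w (4 * a + k) / w (4 * a + b))"
proof
  fix i
  show "w i = segre (\<lambda>j. w (4 * j + b)) (\<lambda>k. w (4 * a + k) / w (4 * a + b)) i"
  proof (cases "i < 16")
    case True
    then have "i div 4 < 4" "i mod 4 < 4" "4 * (i div 4) + i mod 4 = i" by auto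
    then show ?thesis using minors[of "i div 4" "i mod 4"] ab True by (simp add: segre_def field_simps)
  qed (use w in \<open>auto simp: coord_vecs_def segre_def\<close>)
qed

definition minor_form :: "nat \<Rightarrow> nat \<Rightarrow> nat \<Rightarrow> nat \<Rightarrow> (nat \<Rightarrow> complex) \<Rightarrow> complex" where
  "minor_form a b j k v = v (4 * j + k) * v (4 * a + b) - v (4 * j + b) * v (4 * a + k)"

lemma form_minor_form:
  "a < 4 \<Longrightarrow> b < 4 \<Longrightarrow> j < 4 \<Longrightarrow> k < 4 \<Longrightarrow> form UNIV 15 2 (minor_form a b j k)"
proof -
  assume "a < 4" "b < 4" "j < 4" "k < 4"
  then have "form UNIV 15 (Suc 0 + Suc 0) (minor_form a b j k)"
    unfolding minor_form_def by (intro form_diff form.mult form_coord) auto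
  then show ?thesis by (simp add: numeral_2_eq_2)
qed

lemma minor_form_segre: "a < 4 \<Longrightarrow> b < 4 \<Longrightarrow> j < 4 \<Longrightarrow> k < 4 \<Longrightarrow> minor_form a b j k (segre x y) = 0"
  by (simp add: minor_form_def segre_index)

lemma minor_form_derivative:
  assumes "a < 4" "b < 4" "j < 4" "k < 4"
  shows "(\<Sum>l\<le>15. partial l (minor_form a b j k) v * w l) =
    w (4 * j + k) * v (4 * a + b) + v (4 * j + k) * w (4 * a + b)
    - w (4 * j + b) * v (4 * a + k) - v (4 * j + b) * w (4 * a + k)"
proof (rule DERIV_unique[OF form_directional_derivative[OF form_minor_form[OF assms]]])
  show "((\<lambda>s. minor_form a b j k (\<lambda>i. v i + s * w i)) has_field_derivative
    w (4 * j + k) * v (4 * a + b) + v (4 * j + k) * w (4 * a + b)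
    - w (4 * j + b) * v (4 * a + k) - v (4 * j + b) * w (4 * a + k)) (at 0)"
    unfolding minor_form_def by (auto intro!: derivative_eq_intros simp: algebra_simps)
qed

lemma linear_form_derivative: "(\<Sum>l\<le>15. partial l (linear_form a) v * w l) = linear_form a w"
  by (simp add: partial_linear_form linear_form_def)

lemma in_cone_of_segre:
  assumes "segre x y \<noteq> (\<lambda>_. 0)" "\<And>i. i < 3 \<Longrightarrow> linear_form (A i) (segre x y) = 0"
  shows "in_cone A x y"
proof -
  obtain i where i: "segre x y i \<noteq> 0" using assms(1) by auto
  then have "i < 16" "x (i div 4) \<noteq> 0" "y (i mod 4) \<noteq> 0" by (auto simp: segre_def split: if_splits)
  moreover have "i div 4 < 4" "i mod 4 < 4" using \<open>i < 16\<close> by auto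
  ultimately show ?thesis using assms(2) unfolding in_cone_def linear_form_segre by blast
qed

lemma coord_vecs_15_index:
  assumes "w \<in> coord_vecs 15"
  obtains a b where "a < 4" "b < 4" "w (4 * a + b) \<noteq> 0"
proof -
  obtain i where i: "w i \<noteq> 0" using assms by (auto simp: coord_vecs_def fun_eq_iff)
  then have "\<not> 15 < i" using assms by (auto simp: coord_vecs_def)
  then have "i div 4 < 4" "i mod 4 < 4" "4 * (i div 4) + i mod 4 = i" by auto
  then show ?thesis using that[of "i div 4" "i mod 4"] i by simp
qed

lemma forms_vanish_on_pt:
  assumes "form UNIV n d F" "F w = 0" "v \<in> pt w"
  shows "F v = 0"
  using assms form_homogeneous[OF assms(1)] by (auto elim!: in_ptE)

lemma in_pt_self: "w \<in> pt w"
  unfolding pt_def by (auto intro!: exI[of _ 1])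

lemma bilin_intersection_closed: "zariski_closed UNIV 15 (bilin_intersection A)"
  unfolding zariski_closed_def
proof (intro exI conjI)
  let ?S = "{minor_form a b j k | a b j k. a < 4 \<and> b < 4 \<and> j < 4 \<and> k < 4} \<union> {linear_form (A i) | i. i < 3}"
  show S: "\<forall>F\<in>?S. \<exists>d. form UNIV 15 d F" using form_minor_form form_linear_form by blast
  show "bilin_intersection A = {p \<in> proj_space 15. \<forall>F\<in>?S. \<forall>v\<in>p. F v = 0}"
  proof (rule subset_antisym; rule subsetI)
    fix p assume "p \<in> bilin_intersection A"
    then obtain x y where xy: "in_cone A x y" "p = pt (segre x y)" unfolding bilin_intersection_eq by blast
    have "F (segre x y) = 0" if "F \<in> ?S" for F
      using that xy(1) minor_form_segre by (auto simp: linear_form_segre in_cone_def)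
    then have "\<forall>F\<in>?S. \<forall>v\<in>p. F v = 0" using S forms_vanish_on_pt xy(2) by blast
    then show "p \<in> {p \<in> proj_space 15. \<forall>F\<in>?S. \<forall>v\<in>p. F v = 0}"
      using segre_coord_vecs[OF xy(1)] xy(2) unfolding proj_space_def by blast
  next
    fix p assume "p \<in> {p \<in> proj_space 15. \<forall>F\<in>?S. \<forall>v\<in>p. F v = 0}"
    then obtain w where w: "w \<in> coord_vecs 15" "p = pt w" and F: "\<forall>F\<in>?S. \<forall>v\<in>p. F v = 0"
      unfolding proj_space_def by blast
    have F: "F w = 0" if "F \<in> ?S" for F using F that w(2) in_pt_self by blast
    obtain a b where ab: "a < 4" "b < 4" "w (4 * a + b) \<noteq> 0" using coord_vecs_15_index[OF w(1)] .
    have "w (4 * j + k) * w (4 * a + b) = w (4 * j + b) * w (4 * a + k)" if "j < 4" "k < 4" for j k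
    proof -
      have "minor_form a b j k w = 0" by (rule F) (use ab that in blast)
      then show ?thesis by (simp add: minor_form_def)
    qed
    from segre_rank_one[OF w(1) ab this] obtain x y where xy: "w = segre x y" by blast
    have "linear_form (A i) w = 0" if "i < 3" for i by (rule F) (use that in blast)
    moreover have "w \<noteq> (\<lambda>_. 0)" using w(1) by (simp add: coord_vecs_def)
    ultimately have "in_cone A x y" using in_cone_of_segre xy by blast
    then show "p \<in> bilin_intersection A" unfolding bilin_intersection_eq w(2) xy by blast
  qed
qed

text \<open>Enumerates in increasing order the three indices other than \<open>a\<close>, which
  makes the nine minors through a pivot addressable by \<open>i div 3\<close> and
  \<open>i mod 3\<close>.\<close>

definition skip :: "nat \<Rightarrow> nat \<Rightarrow> nat" where
  "skip a i = (if i < a then i else Suc i)"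

lemma skip: "a < 4 \<Longrightarrow> i < 3 \<Longrightarrow> skip a i < 4" "skip a i \<noteq> a"
  by (auto simp: skip_def)

lemma skip_inj: "skip a i = skip a j \<longleftrightarrow> i = j"
  by (auto simp: skip_def)

lemma skip_surj: "a < 4 \<Longrightarrow> j < 4 \<Longrightarrow> j \<noteq> a \<Longrightarrow> \<exists>i<3. j = skip a i"
  by (rule exI[of _ "if j < a then j else j - 1"]) (auto simp: skip_def)

text \<open>Around the points with \<open>z\<^sub>a\<^sub>b \<noteq> 0\<close> the Segre variety is cut out by the nine \<open>2 \<times> 2\<close> minors through
  the entry \<open>(a, b)\<close>.\<close>

definition local_eq :: "(nat \<Rightarrow> nat \<Rightarrow> nat \<Rightarrow> complex) \<Rightarrow> nat \<Rightarrow> nat \<Rightarrow> nat \<Rightarrow> (nat \<Rightarrow> complex) \<Rightarrow> complex" where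
  "local_eq A a b i = (if i < 9 then minor_form a b (skip a (i div 3)) (skip b (i mod 3)) else linear_form (A (i - 9)))"

lemma form_local_eq: "a < 4 \<Longrightarrow> b < 4 \<Longrightarrow> form UNIV 15 (if i < 9 then 2 else 1) (local_eq A a b i)"
  using form_minor_form[OF _ _ skip(1) skip(1), of a b a "i div 3" b "i mod 3"] form_linear_form[of "A (i - 9)"]
  by (auto simp: local_eq_def)

context smooth_net
begin

text \<open>A relation is tested on suitable vectors. On \<open>segre x1 y\<close> and
  \<open>segre x y1\<close>, tangent to the Segre variety, the differentials of the minors vanish,
  so smoothness kills the coefficients of the three linear forms. A unit vector outside the row and
  column of the pivot is then seen by exactly one minor, with the nonzero value of the pivot
  entry.\<close>

lemma local_eq_independent:
  assumes xy: "in_cone A x y" and ab: "a < 4" "b < 4" "x a \<noteq> 0" "y b \<noteq> 0"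
    and c: "\<forall>l\<le>15. (\<Sum>i<12. c i * partial l (local_eq A a b i) (segre x y)) = 0" and i: "i < 12"
  shows "c i = 0"
proof -
  let ?v = "segre x y"
  define D where "D i w = (\<Sum>l\<le>15. partial l (local_eq A a b i) ?v * w l)" for i w
  have cD: "(\<Sum>i<12. c i * D i w) = 0" for w
  proof -
    have "(\<Sum>i<12. c i * D i w) = (\<Sum>l\<le>15. (\<Sum>i<12. c i * partial l (local_eq A a b i) ?v) * w l)"
      unfolding D_def sum_distrib_left sum_distrib_right by (subst sum.swap) (simp add: mult.assoc)
    then show ?thesis using c by simp
  qed
  have split: "(\<Sum>i<12. f i) = (\<Sum>i<9. f i) + (\<Sum>i<3. f (9 + i))" for f :: "nat \<Rightarrow> complex"
    by (simp add: eval_nat_numeral)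
  have Dm: "D i w = w (4 * j + k) * ?v (4 * a + b) + ?v (4 * j + k) * w (4 * a + b)
      - w (4 * j + b) * ?v (4 * a + k) - ?v (4 * j + b) * w (4 * a + k)"
    if "i < 9" "j = skip a (i div 3)" "k = skip b (i mod 3)" for i j k w
    using that ab minor_form_derivative[of a b j k ?v w] skip(1)[of a "i div 3"] skip(1)[of b "i mod 3"]
    by (simp add: D_def local_eq_def)
  have Dl: "D (9 + i) w = linear_form (A i) w" for i w
    by (simp add: D_def local_eq_def linear_form_derivative)
  have D_segre: "D i (segre x1 y1) = 0" if "i < 9" "x1 = x \<or> y1 = y" for i x1 y1
    unfolding Dm[OF that(1) refl refl] using that skip(1)[of a "i div 3"] skip(1)[of b "i mod 3"] ab
    by (auto simp: segre_index)
  have lin: "(\<Sum>i<3. c (9 + i) * bilin (A i) x1 y1) = 0" if "x1 = x \<or> y1 = y" for x1 y1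
    using cD[of "segre x1 y1"] D_segre[OF _ that] by (simp add: split Dl linear_form_segre)
  have c9: "c (9 + i) = 0" if "i < 3" for i
  proof (rule smooth_cone[OF xy _ _ that])
    fix j :: nat assume "j < 4"
    then show "(\<Sum>i<3. c (9 + i) * rrow A y i j) = 0"
      using lin[of "unit_row j" y] sum_unit_row[of j 4] by (simp add: bilin_rrow mult.commute)
    show "(\<Sum>i<3. c (9 + i) * lrow A x i j) = 0"
      using \<open>j < 4\<close> lin[of x "unit_row j"] sum_unit_row[of j 4] by (simp add: bilin_lrow mult.commute)
  qed
  show ?thesis
  proof (cases "i < 9")
    case True
    let ?j = "skip a (i div 3)" and ?k = "skip b (i mod 3)"
    have jk: "?j < 4" "?k < 4" "?j \<noteq> a" "?k \<noteq> b" using skip ab True by auto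
    have "D i' (unit_row (4 * ?j + ?k)) = (if i' = i then ?v (4 * a + b) else 0)" if "i' < 9" for i'
    proof -
      have jk': "skip a (i' div 3) < 4" "skip b (i' mod 3) < 4" using skip ab that by auto
      have "skip a (i' div 3) = ?j \<and> skip b (i' mod 3) = ?k \<longleftrightarrow> i' = i"
        unfolding skip_inj by (metis div_mult_mod_eq)
      then show ?thesis unfolding Dm[OF that refl refl] using jk jk' ab by (auto simp: index_pair_eq)
    qed
    then have "(\<Sum>i'<9. c i' * D i' (unit_row (4 * ?j + ?k))) = (\<Sum>i'<9. if i' = i then c i' * ?v (4 * a + b) else 0)"
      by (intro sum.cong) auto
    also have "\<dots> = c i * ?v (4 * a + b)" using True by simp
    finally have "c i * ?v (4 * a + b) = 0" using cD[of "unit_row (4 * ?j + ?k)"] c9 by (simp add: split)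
    then show ?thesis using ab by (simp add: segre_index)
  next
    case False
    then show ?thesis using c9[of "i - 9"] i by simp
  qed
qed

lemma smooth_of_dim_3: "smooth_of_dim 3 15 (bilin_intersection A)"
  unfolding smooth_of_dim_def
proof (intro conjI ballI)
  fix p assume "p \<in> bilin_intersection A"
  then obtain x y where xy: "in_cone A x y" "p = pt (segre x y)" unfolding bilin_intersection_eq by blast
  obtain a b where ab: "a < 4" "b < 4" "x a \<noteq> 0" "y b \<noteq> 0" using xy(1) by (auto simp: in_cone_def)
  let ?G = "\<lambda>v :: nat \<Rightarrow> complex. v (4 * a + b)"
  let ?e = "\<lambda>i::nat. if i < 9 then 2 else 1 :: nat"
  have c1: "\<exists>k. form UNIV 15 k ?G" using form_coord[of "4 * a + b" 15] ab by auto
  have c2: "\<forall>v\<in>p. ?G v \<noteq> 0" unfolding xy(2) using ab by (auto simp: segre_index elim!: in_ptE)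
  have c3: "\<forall>i<15 - 3. form UNIV 15 (?e i) (local_eq A a b i)" using form_local_eq ab by blast
  have c4: "q \<in> bilin_intersection A \<longleftrightarrow> (\<forall>i<15 - 3. \<forall>v\<in>q. local_eq A a b i v = 0)"
    if q: "q \<in> proj_space 15" "\<forall>v\<in>q. ?G v \<noteq> 0" for q
  proof
    assume "q \<in> bilin_intersection A"
    then obtain x1 y1 where q1: "in_cone A x1 y1" "q = pt (segre x1 y1)" unfolding bilin_intersection_eq by blast
    show "\<forall>i<15 - 3. \<forall>v\<in>q. local_eq A a b i v = 0"
    proof (intro allI impI ballI)
      fix i v assume i: "i < 15 - (3::nat)" and v: "v \<in> q"
      have "local_eq A a b i (segre x1 y1) = 0"
        using q1(1) i ab minor_form_segre skip(1)[of a "i div 3"] skip(1)[of b "i mod 3"]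
        by (auto simp: local_eq_def linear_form_segre in_cone_def)
      then show "local_eq A a b i v = 0" using v q1(2) form_local_eq[OF ab(1,2)] forms_vanish_on_pt by blast
    qed
  next
    assume F: "\<forall>i<15 - 3. \<forall>v\<in>q. local_eq A a b i v = 0"
    obtain w where w: "w \<in> coord_vecs 15" "q = pt w" using q(1) unfolding proj_space_def by blast
    have F: "local_eq A a b i w = 0" if "i < 12" for i using F that in_pt_self[of w] unfolding w(2) by auto
    have wab: "w (4 * a + b) \<noteq> 0" using q(2) w(2) in_pt_self by blast
    have "w (4 * j + k) * w (4 * a + b) = w (4 * j + b) * w (4 * a + k)" if jk: "j < 4" "k < 4" for j k
    proof (cases "j = a \<or> k = b")
      case False
      then obtain i1 where i1: "i1 < 3" "j = skip a i1" using skip_surj[OF ab(1) jk(1)] by blast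
      obtain i2 where i2: "i2 < 3" "k = skip b i2" using skip_surj[OF ab(2) jk(2)] False by blast
      note i = i1 i2
      have "local_eq A a b (3 * i1 + i2) w = 0" by (rule F) (use i in simp)
      then show ?thesis using i by (simp add: local_eq_def minor_form_def)
    qed auto
    from segre_rank_one[OF w(1) ab(1,2) wab this] obtain x1 y1 where xy1: "w = segre x1 y1" by blast
    have "linear_form (A i) w = 0" if "i < 3" for i using F[of "9 + i"] that by (simp add: local_eq_def)
    moreover have "w \<noteq> (\<lambda>_. 0)" using w(1) by (simp add: coord_vecs_def)
    ultimately have "in_cone A x1 y1" using in_cone_of_segre xy1 by blast
    then show "q \<in> bilin_intersection A" unfolding bilin_intersection_eq w(2) xy1 by blast
  qed
  have c5: "\<forall>i<15 - 3. c i = 0"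
    if v: "v \<in> p" and c: "\<forall>l\<le>15. (\<Sum>i<15 - 3. c i * partial l (local_eq A a b i) v) = 0" for v c
  proof -
    obtain s where s: "s \<noteq> 0" "v = (\<lambda>i. s * segre x y i)" using v unfolding xy(2) by (rule in_ptE)
    then have v': "v = segre (\<lambda>i. s * x i) y" using segre_scale[of s x 1 y] by simp
    have cone: "in_cone A (\<lambda>i. s * x i) y" using in_cone_scale[OF xy(1) s(1), of 1] by simp
    have "c i = 0" if "i < 12" for i
      by (rule local_eq_independent[OF cone ab(1,2) _ ab(4) _ that]) (use s(1) ab c v' in auto)
    then show ?thesis by simp
  qed
  have c4': "\<forall>q\<in>proj_space 15. (\<forall>v\<in>q. ?G v \<noteq> 0) \<longrightarrow>
      (q \<in> bilin_intersection A \<longleftrightarrow> (\<forall>i<15 - 3. \<forall>v\<in>q. local_eq A a b i v = 0))"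
    by (rule ballI, rule impI, rule c4)
  have c5': "\<forall>v\<in>p. \<forall>c. (\<forall>j\<le>15. (\<Sum>i<15 - 3. c i * partial j (local_eq A a b i) v) = 0) \<longrightarrow>
      (\<forall>i<15 - 3. c i = 0)"
    by (rule ballI, rule allI, rule impI, rule c5)
  show "\<exists>G (e :: nat \<Rightarrow> nat) F. (\<exists>k. form UNIV 15 k G) \<and> (\<forall>v\<in>p. G v \<noteq> 0) \<and>
      (\<forall>i<15 - 3. form UNIV 15 (e i) (F i)) \<and>
      (\<forall>q\<in>proj_space 15. (\<forall>v\<in>q. G v \<noteq> 0) \<longrightarrow>
         (q \<in> bilin_intersection A \<longleftrightarrow> (\<forall>i<15 - 3. \<forall>v\<in>q. F i v = 0))) \<and>
      (\<forall>v\<in>p. \<forall>c. (\<forall>j\<le>15. (\<Sum>i<15 - 3. c i * partial j (F i) v) = 0) \<longrightarrow> (\<forall>i<15 - 3. c i = 0))"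
    by (rule exI[of _ ?G], rule exI[of _ ?e], rule exI[of _ "local_eq A a b"])
       (intro conjI c1 c2 c3 c4' c5')
qed simp

section \<open>The sections are the Segre coordinates\<close>

lemma sec_rows_annihilate:
  assumes FG: "\<And>i. i < 3 \<Longrightarrow> \<exists>d. form UNIV 15 d (F i) \<and> form UNIV 15 d (G i)"
    and xy: "in_cone A x y" and i: "i < 6"
  shows "(\<Sum>l<4. sec_rows A F G j k x y i l * x l) = 0"
    and "(\<Sum>l<4. sec_rows A F G j k x y i (4 + l) * y l) = 0"
proof -
  have b: "bilin (A m) x y = 0" if "m < 3" for m using xy that by (simp add: in_cone_def)
  show "(\<Sum>l<4. sec_rows A F G j k x y i l * x l) = 0"
  proof (cases "i < 3")
    case True
    then show ?thesis using FG[OF True] frow_euler_x by (auto simp: sec_rows_def)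
  next
    case False
    then show ?thesis using b[of "i - 3"] i by (simp add: sec_rows_def brow_def bilin_rrow)
  qed
  show "(\<Sum>l<4. sec_rows A F G j k x y i (4 + l) * y l) = 0"
  proof (cases "i < 3")
    case True
    then show ?thesis using FG[OF True] frow_euler_y by (auto simp: sec_rows_def)
  next
    case False
    then show ?thesis using b[of "i - 3"] i by (simp add: sec_rows_def brow_def bilin_lrow)
  qed
qed

text \<open>With row 6 replaced by \<open>x a * dx_j - x j * dx_a\<close>, every row kills the Euler
  vector \<open>(x, 0)\<close>, so the determinant vanishes and exchanges \<open>j\<close> for
  \<open>a\<close>. Row 7 and the vector \<open>(0, y)\<close> treat \<open>k\<close> and
  \<open>b\<close> in the same way.\<close>

lemma sec_val_proportional:
  assumes FG: "\<And>i. i < 3 \<Longrightarrow> \<exists>d. form UNIV 15 d (F i) \<and> form UNIV 15 d (G i)"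
    and xy: "in_cone A x y" and ab: "a < 4" "b < 4" and jk: "j < 4" "k < 4"
    and ne: "x a \<noteq> 0" "y b \<noteq> 0"
  shows "sec_val A F G j k x y = sec_val A F G a b x y / (x a * y b) * (x j * y k)"
proof -
  let ?R = "sec_rows A F G"
  have X: "x a * sec_val A F G j k x y = x j * sec_val A F G a k x y"
  proof -
    let ?r = "(?R j k x y)(6 := \<lambda>l. x a * unit_row j l + (- x j) * unit_row a l)"
    have "rowdet 8 ?r = 0"
    proof (rule rowdet_0_if_kernel[where v = "\<lambda>l. if l < 4 then x l else 0" and j = a])
      show "\<forall>i<8. (\<Sum>l<8. ?r i l * (if l < 4 then x l else 0)) = 0"
      proof (intro allI impI)
        fix i :: nat assume "i < 8"
        then consider "i < 6" | "i = 6" | "i = 7" by linarith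
        then have "(\<Sum>l<4. ?r i l * x l) = 0"
        proof cases
          case 1
          then show ?thesis using sec_rows_annihilate(1)[OF FG xy 1] by simp
        next
          case 2
          have "(\<Sum>l<4. (x a * unit_row j l + (- x j) * unit_row a l) * x l) =
              x a * (\<Sum>l<4. unit_row j l * x l) + (- x j) * (\<Sum>l<4. unit_row a l * x l)"
            unfolding sum_distrib_left sum.distrib[symmetric] by (rule sum.cong) (auto simp: algebra_simps)
          then show ?thesis unfolding sum_unit_row[OF jk(1)] sum_unit_row[OF ab(1)] using 2 by simp
        qed (simp add: sec_rows_def)
        then show "(\<Sum>l<8. ?r i l * (if l < 4 then x l else 0)) = 0" unfolding sum_8 by simp
      qed
    qed (use ab ne in auto)
    moreover have "rowdet 8 ?r = x a * rowdet 8 ((?R j k x y)(6 := unit_row j)) +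
        (- x j) * rowdet 8 ((?R j k x y)(6 := unit_row a))"
      by (simp only: rowdet_add rowdet_scale numeral_less_iff rel_simps)
    moreover have "(?R j k x y)(6 := unit_row j) = ?R j k x y" "(?R j k x y)(6 := unit_row a) = ?R a k x y"
      by (auto simp: sec_rows_def fun_eq_iff)
    ultimately show ?thesis by (simp add: sec_val_def)
  qed
  have Y: "y b * sec_val A F G a k x y = y k * sec_val A F G a b x y"
  proof -
    let ?r = "(?R a k x y)(7 := \<lambda>l. y b * unit_row (4 + k) l + (- y k) * unit_row (4 + b) l)"
    have "rowdet 8 ?r = 0"
    proof (rule rowdet_0_if_kernel[where v = "\<lambda>l. if l < 4 then 0 else y (l - 4)" and j = "4 + b"])
      show "\<forall>i<8. (\<Sum>l<8. ?r i l * (if l < 4 then 0 else y (l - 4))) = 0"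
      proof (intro allI impI)
        fix i :: nat assume "i < 8"
        then consider "i < 6" | "i = 6" | "i = 7" by linarith
        then have "(\<Sum>l<4. ?r i (4 + l) * y l) = 0"
        proof cases
          case 1
          then show ?thesis using sec_rows_annihilate(2)[OF FG xy 1] by simp
        next
          case 2
          then show ?thesis using ab by (simp add: sec_rows_def)
        next
          case 3
          have "(\<Sum>l<4. (y b * unit_row k l + (- y k) * unit_row b l) * y l) =
              y b * (\<Sum>l<4. unit_row k l * y l) + (- y k) * (\<Sum>l<4. unit_row b l * y l)"
            unfolding sum_distrib_left sum.distrib[symmetric] by (rule sum.cong) (auto simp: algebra_simps)
          then show ?thesis unfolding sum_unit_row[OF jk(2)] sum_unit_row[OF ab(2)] using 3 by simp
        qed
        then show "(\<Sum>l<8. ?r i l * (if l < 4 then 0 else y (l - 4))) = 0" unfolding sum_8 by simp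
      qed
    qed (use ab ne in auto)
    moreover have "rowdet 8 ?r = y b * rowdet 8 ((?R a k x y)(7 := unit_row (4 + k))) +
        (- y k) * rowdet 8 ((?R a k x y)(7 := unit_row (4 + b)))"
      by (simp only: rowdet_add rowdet_scale numeral_less_iff rel_simps)
    moreover have "rowdet 8 ((?R a k x y)(7 := unit_row (4 + c))) = sec_val A F G a c x y" for c
      unfolding sec_val_def by (rule rowdet_cong) (auto simp: sec_rows_def)
    ultimately show ?thesis by simp
  qed
  have "x a * y b * sec_val A F G j k x y = y b * (x a * sec_val A F G j k x y)" by simp
  also have "\<dots> = x j * (y b * sec_val A F G a k x y)" unfolding X by simp
  also have "\<dots> = sec_val A F G a b x y * (x j * y k)" unfolding Y by simp
  finally show ?thesis using ne by (simp add: field_simps)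
qed

text \<open>The quotients \<open>x\<^sub>l / x\<^sub>a\<close> and \<open>y\<^sub>l / y\<^sub>b\<close>, as quotients of coordinates of \<open>z = x \<otimes> y\<close>.\<close>

definition chart_index :: "nat \<Rightarrow> nat \<Rightarrow> nat \<Rightarrow> nat" where
  "chart_index a b l = (if l < 4 then 4 * l + b else 4 * a + (l - 4))"

text \<open>The quotient rule for \<open>x l / x a\<close> gives a multiple of \<open>dx_l\<close>
  plus a multiple of \<open>dx_a\<close>, which is row 6 of \<open>sec_rows\<close>; for the
  \<open>y\<close> coordinates the correction is a multiple of row 7.\<close>

lemma frow_chart:
  assumes ab: "a < 4" "b < 4" "x a \<noteq> 0" "y b \<noteq> 0" and l: "l < 8"
  shows "\<exists>c e (m::nat). c \<noteq> 0 \<and> m \<in> {6, 7} \<and> (\<forall>j<8.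
    frow (\<lambda>v. v (chart_index a b l)) (\<lambda>v. v (4 * a + b)) x y j =
      c * unit_row l j + e * (if m = 6 then unit_row a else unit_row (4 + b)) j)"
proof (cases "l < 4")
  case True
  have quotient: "((u * y b + w * x l) * (x a * y b) - x l * y b * (u' * y b + w * x a)) / (x a * y b)\<^sup>2 =
      1 / x a * u + (- x l / (x a)\<^sup>2) * u'" for u u' w
    using ab by (simp add: field_simps power2_eq_square)
  have "frow (\<lambda>v. v (chart_index a b l)) (\<lambda>v. v (4 * a + b)) x y j =
      1 / x a * unit_row l j + (- x l / (x a)\<^sup>2) * unit_row a j" if "j < 8" for j
    unfolding frow_def chart_index_def if_P[OF True] drow_coord[OF True ab(2) that] drow_coord[OF ab(1,2) that]
      segre_index[OF True ab(2)] segre_index[OF ab(1,2)] by (rule quotient)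
  then show ?thesis using ab
    by (intro exI[of _ "1 / x a"] exI[of _ "- x l / (x a)\<^sup>2"] exI[of _ 6]) simp
next
  case False
  then obtain m where m: "m < 4" "l = 4 + m" using l by (intro that[of "l - 4"]) auto
  have quotient: "((u' * y m + w * x a) * (x a * y b) - x a * y m * (u' * y b + w' * x a)) / (x a * y b)\<^sup>2 =
      1 / y b * w + (- y m / (y b)\<^sup>2) * w'" for u' w w'
    using ab by (simp add: field_simps power2_eq_square)
  have idx: "chart_index a b l = 4 * a + m" using m by (simp add: chart_index_def)
  have "frow (\<lambda>v. v (chart_index a b l)) (\<lambda>v. v (4 * a + b)) x y j =
      1 / y b * unit_row (4 + m) j + (- y m / (y b)\<^sup>2) * unit_row (4 + b) j" if "j < 8" for j
    unfolding frow_def idx drow_coord[OF ab(1) m(1) that] drow_coord[OF ab(1,2) that]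
      segre_index[OF ab(1) m(1)] segre_index[OF ab(1,2)] by (rule quotient)
  then show ?thesis using ab m(2)
    by (intro exI[of _ "1 / y b"] exI[of _ "- y m / (y b)\<^sup>2"] exI[of _ 7]) simp
qed

text \<open>Rows 3 to 7 are independent: pairing a relation with the two Euler vectors isolates the
  coefficients of rows 6 and 7, as \<open>x a\<close> and \<open>y b\<close> are nonzero, and
  smoothness removes the rest. Unit rows complete them to a nonsingular matrix; by
  \<open>frow_chart\<close> each may be traded for the differential of a chart function, which
  changes the determinant by a nonzero factor.\<close>

lemma sec_val_nonzero:
  assumes xy: "in_cone A x y" and ab: "a < 4" "b < 4" "x a \<noteq> 0" "y b \<noteq> 0"
  shows "\<exists>l. (\<forall>i<3. l i < 8) \<and>
    sec_val A (\<lambda>i v. v (chart_index a b (l i))) (\<lambda>i v. v (4 * a + b)) a b x y \<noteq> 0"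
proof -
  \<comment> \<open>The zero forms only fill rows 0 to 2, which are replaced below.\<close>
  define r where "r = sec_rows A (\<lambda>i v. 0) (\<lambda>i v. 0) a b x y"
  have r: "r (3 + i) = brow A x y i" if "i < 3" for i using that by (simp add: r_def sec_rows_def)
  have r67: "r 6 = unit_row a" "r 7 = unit_row (4 + b)" by (simp_all add: r_def sec_rows_def fun_eq_iff)
  have "\<exists>l. (\<forall>i<3. l i < 8) \<and>
    rowdet 8 (\<lambda>i. if i < 3 then (\<lambda>j. if j = l i then 1 else 0) else r i) \<noteq> 0"
  proof (rule extend_rows_by_coordinates)
    fix c assume c: "\<And>j. j < 8 \<Longrightarrow> (\<Sum>i=3..<8. c i * r i j) = 0"
    have s: "{3..<8::nat} = {3, 4, 5, 6, 7}" and s3: "{..<3::nat} = {0, 1, 2}" by auto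
    have r345: "r 3 = brow A x y 0" "r 4 = brow A x y 1" "r 5 = brow A x y 2"
      using r[of 0] r[of 1] r[of 2] by simp_all
    have c': "(\<Sum>i<3. c (3 + i) * brow A x y i j) + c 6 * unit_row a j + c 7 * unit_row (4 + b) j = 0"
      if "j < 8" for j
      using c[OF that] unfolding s s3 by (simp add: r345 r67 add.assoc del: One_nat_def split del: if_split)
    have bx: "(\<Sum>j<4. brow A x y i j * x j) = 0" "(\<Sum>j<4. brow A x y i (4 + j) * y j) = 0" if "i < 3" for i
      using xy that by (simp_all add: in_cone_def brow_def bilin_rrow[symmetric] bilin_lrow[symmetric])
    have "0 = (\<Sum>j<4. ((\<Sum>i<3. c (3 + i) * brow A x y i j) + c 6 * unit_row a j + c 7 * unit_row (4 + b) j) * x j)"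
    proof (rule sum.neutral[symmetric], rule ballI)
      fix j :: nat assume "j \<in> {..<4}"
      then have "j < 8" by simp
      show "((\<Sum>i<3. c (3 + i) * brow A x y i j) + c 6 * unit_row a j + c 7 * unit_row (4 + b) j) * x j = 0"
        unfolding c'[OF \<open>j < 8\<close>] by simp
    qed
    also have "\<dots> = (\<Sum>j<4. \<Sum>i<3. c (3 + i) * (brow A x y i j * x j)) + c 6 * (\<Sum>j<4. unit_row a j * x j)"
      unfolding sum_distrib_left sum.distrib[symmetric]
      by (rule sum.cong) (auto simp: algebra_simps sum_distrib_left)
    also have "(\<Sum>j<4. \<Sum>i<3. c (3 + i) * (brow A x y i j * x j)) = (\<Sum>i<3. c (3 + i) * (\<Sum>j<4. brow A x y i j * x j))"
      by (subst sum.swap) (simp add: sum_distrib_left)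
    also have "\<dots> = 0" using bx by simp
    also have "(\<Sum>j<4. unit_row a j * x j) = x a" by (rule sum_unit_row[OF ab(1)])
    finally have c6: "c 6 = 0" using ab by simp
    have "0 = (\<Sum>j<4. ((\<Sum>i<3. c (3 + i) * brow A x y i (4 + j)) + c 6 * unit_row a (4 + j) +
        c 7 * unit_row (4 + b) (4 + j)) * y j)"
    proof (rule sum.neutral[symmetric], rule ballI)
      fix j :: nat assume "j \<in> {..<4}"
      then have "4 + j < 8" by simp
      show "((\<Sum>i<3. c (3 + i) * brow A x y i (4 + j)) + c 6 * unit_row a (4 + j) +
          c 7 * unit_row (4 + b) (4 + j)) * y j = 0"
        unfolding c'[OF \<open>4 + j < 8\<close>] by simp
    qed
    also have "\<dots> = (\<Sum>j<4. \<Sum>i<3. c (3 + i) * (brow A x y i (4 + j) * y j)) + c 7 * (\<Sum>j<4. unit_row b j * y j)"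
      unfolding sum_distrib_left sum.distrib[symmetric]
      by (rule sum.cong) (auto simp: algebra_simps sum_distrib_left c6)
    also have "(\<Sum>j<4. \<Sum>i<3. c (3 + i) * (brow A x y i (4 + j) * y j)) =
        (\<Sum>i<3. c (3 + i) * (\<Sum>j<4. brow A x y i (4 + j) * y j))"
      by (subst sum.swap) (simp add: sum_distrib_left)
    also have "\<dots> = 0" using bx by simp
    also have "(\<Sum>j<4. unit_row b j * y j) = y b" by (rule sum_unit_row[OF ab(2)])
    finally have c7: "c 7 = 0" using ab by simp
    have c0: "(\<Sum>i<3. c (3 + i) * brow A x y i j) = 0" if "j < 8" for j using c'[OF that] c6 c7 by simp
    have "c (3 + i) = 0" if "i < 3" for i
    proof (rule smooth_cone[OF xy _ _ that])
      fix j :: nat assume "j < 4"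
      then show "(\<Sum>i<3. c (3 + i) * rrow A y i j) = 0" using c0[of j] by (simp add: brow_def)
      show "(\<Sum>i<3. c (3 + i) * lrow A x i j) = 0" using c0[of "4 + j"] \<open>j < 4\<close> by (simp add: brow_def)
    qed
    from this[of 0] this[of 1] this[of 2] show "\<forall>i\<in>{3..<8}. c i = 0" unfolding s using c6 c7 by simp
  qed simp
  then obtain l where l: "\<forall>i<3. l i < 8" "rowdet 8 (\<lambda>i. if i < 3 then unit_row (l i) else r i) \<noteq> 0" by blast
  let ?f = "\<lambda>i. frow (\<lambda>v. v (chart_index a b (l i))) (\<lambda>v. v (4 * a + b)) x y"
  define T where "T m i = (if i < m then ?f i else if i < 3 then unit_row (l i) else r i)" for m i :: nat
  have step: "rowdet 8 (T (Suc m)) \<noteq> 0" if T: "rowdet 8 (T m) \<noteq> 0" and m: "m < 3" for m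
  proof -
    obtain c e and k :: nat where k: "c \<noteq> 0" "k \<in> {6, 7}"
      "\<And>j. j < 8 \<Longrightarrow> ?f m j = c * unit_row (l m) j + e * (if k = 6 then unit_row a else unit_row (4 + b)) j"
      using frow_chart[of a b x y "l m"] ab l(1) m by blast
    have "(if k = 6 then unit_row a else unit_row (4 + b)) = T m k"
      using k(2) m r67 by (auto simp: T_def)
    then have f: "?f m j = c * unit_row (l m) j + e * T m k j" if "j < 8" for j using k(3)[OF that] by simp
    have T1: "T (Suc m) = (T m)(m := ?f m)" and T0: "(T m)(m := unit_row (l m)) = T m"
      using m by (auto simp: T_def fun_eq_iff)
    have "rowdet 8 (T (Suc m)) = rowdet 8 ((T m)(m := \<lambda>j. c * unit_row (l m) j))"
      unfolding T1 by (rule rowdet_add_multiple[of m 8 k]) (use m k(2) f in auto)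
    also have "\<dots> = c * rowdet 8 ((T m)(m := unit_row (l m)))" by (rule rowdet_scale) (use m in simp)
    finally show ?thesis unfolding T0 using T k(1) by simp
  qed
  have "rowdet 8 (T 0) \<noteq> 0" using l(2) unfolding T_def by simp
  then have "rowdet 8 (T 3) \<noteq> 0" using step[of 0] step[of 1] step[of 2] by (simp add: numeral_3_eq_3 numeral_2_eq_2)
  moreover have "rowdet 8 (T 3) = sec_val A (\<lambda>i v. v (chart_index a b (l i))) (\<lambda>i v. v (4 * a + b)) a b x y"
    unfolding sec_val_def by (rule rowdet_cong) (auto simp: T_def sec_rows_def r_def)
  ultimately show ?thesis using l(1) by (intro exI[of _ l]) auto
qed

lemma chart_quotient_regular:
  assumes m: "m \<le> 15" "m' \<le> 15" and U: "U = bilin_intersection A - {p \<in> proj_space 15. \<forall>F\<in>{\<lambda>v. v m}. \<forall>v\<in>p. F v = 0}"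
    and p: "p \<in> U"
  shows "local_rep 15 U p (\<lambda>q. SOME s. \<exists>v\<in>q. v m \<noteq> 0 \<and> s = v m' / v m) (\<lambda>v. v m') (\<lambda>v. v m)"
proof -
  have "\<forall>v\<in>p. v m \<noteq> 0"
  proof -
    obtain x y where xy: "in_cone A x y" "p = pt (segre x y)" using p U unfolding bilin_intersection_eq by blast
    then have "p \<in> proj_space 15" using segre_coord_vecs unfolding proj_space_def by blast
    then obtain v where "v \<in> p" "v m \<noteq> 0" using p U by blast
    then have "segre x y m \<noteq> 0" using xy(2) by (auto elim!: in_ptE)
    then show ?thesis using xy(2) by (auto elim!: in_ptE)
  qed
  moreover have "(SOME s. \<exists>v\<in>q. v m \<noteq> 0 \<and> s = v m' / v m) = v m' / v m"
    if q: "q \<in> U" "v \<in> q" "v m \<noteq> 0" for q v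
  proof (rule some_equality)
    show "\<exists>w\<in>q. w m \<noteq> 0 \<and> v m' / v m = w m' / w m" using q by blast
    fix s assume "\<exists>w\<in>q. w m \<noteq> 0 \<and> s = w m' / w m"
    then obtain w where w: "w \<in> q" "w m \<noteq> 0" "s = w m' / w m" by blast
    obtain z where z: "q = pt z" using q(1) U unfolding bilin_intersection_eq by blast
    obtain c d where "c \<noteq> 0" "v = (\<lambda>i. c * z i)" "d \<noteq> 0" "w = (\<lambda>i. d * z i)"
      using q(2) w(1) unfolding z by (auto elim!: in_ptE)
    then show "s = v m' / v m" using w(3) by simp
  qed
  moreover have "form UNIV 15 1 (\<lambda>v. v m')" "form UNIV 15 1 (\<lambda>v. v m)" by (rule form.coord[OF m(2)], rule form.coord[OF m(1)])
  ultimately show ?thesis unfolding local_rep_def by auto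
qed

text \<open>For the chart functions found in \<open>sec_val_nonzero\<close>, the sixteen sections
  are the Segre coordinates times one common nonzero factor, so they reproduce the point
  itself.\<close>

lemma antican_coordinates:
  assumes p: "p \<in> bilin_intersection A"
  shows "\<exists>U f. zariski_open_in 15 (bilin_intersection A) U \<and> p \<in> U \<and> (\<forall>i<3. regular_on 15 U (f i)) \<and>
    p = pt (\<lambda>j. if j \<le> 15 then antican A (j div 4) (j mod 4) U f p else 0)"
proof -
  obtain x y where xy: "in_cone A x y" "p = pt (segre x y)" using p unfolding bilin_intersection_eq by blast
  obtain a b where ab: "a < 4" "b < 4" "x a \<noteq> 0" "y b \<noteq> 0" using xy(1) by (auto simp: in_cone_def)
  let ?m = "4 * a + b"
  have m: "?m \<le> 15" using ab by simp
  obtain l where l: "\<And>i. i < 3 \<Longrightarrow> l i < 8"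
    and ne: "sec_val A (\<lambda>i v. v (chart_index a b (l i))) (\<lambda>i v. v ?m) a b x y \<noteq> 0"
    using sec_val_nonzero[OF xy(1) ab] by blast
  let ?F = "\<lambda>i v. v (chart_index a b (l i)) :: complex" and ?G = "\<lambda>(i::nat) v. v ?m :: complex"
  define U where "U = bilin_intersection A - {p \<in> proj_space 15. \<forall>F\<in>{\<lambda>v. v ?m}. \<forall>v\<in>p. F v = 0}"
  define f where "f i q = (SOME s. \<exists>v\<in>q. v ?m \<noteq> 0 \<and> s = v (chart_index a b (l i)) / v ?m)"
    for i :: nat and q :: "complex point"
  have li: "chart_index a b (l i) \<le> 15" if "i < 3" for i using l[OF that] ab by (auto simp: chart_index_def)
  have "zariski_closed UNIV 15 {p \<in> proj_space 15. \<forall>F\<in>{\<lambda>v. v ?m}. \<forall>v\<in>p. F v = 0}"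
    unfolding zariski_closed_def using form.coord[OF m, of UNIV] by (intro exI[of _ "{\<lambda>v. v ?m}"]) blast
  then have U: "zariski_open_in 15 (bilin_intersection A) U" unfolding zariski_open_in_def U_def by blast
  have "segre x y ?m \<noteq> 0" using ab by (simp add: segre_index)
  then have pU: "pt (segre x y) \<in> U" 
    using p \<open>segre x y ?m \<noteq> 0\<close> segre_in_pt[of x y] unfolding U_def xy(2) by auto
  have rep: "local_rep 15 U q (f i) (?F i) (?G i)" if "i < 3" "q \<in> U" for i q
    unfolding f_def by (rule chart_quotient_regular[OF m li[OF that(1)] U_def that(2)])
  have reg: "regular_on 15 U (f i)" if "i < 3" for i
    unfolding regular_on_local_rep using rep[OF that] by blast
  let ?\<kappa> = "sec_val A ?F ?G a b x y / (x a * y b)"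
  have eq: "(\<lambda>j. if j \<le> 15 then antican A (j div 4) (j mod 4) U f p else 0) = (\<lambda>j. ?\<kappa> * segre x y j)"
  proof
    fix j
    show "(if j \<le> 15 then antican A (j div 4) (j mod 4) U f p else 0) = ?\<kappa> * segre x y j"
    proof (cases "j \<le> 15")
      case True
      then have j: "j div 4 < 4" "j mod 4 < 4" by auto
      have "antican A (j div 4) (j mod 4) U f p = sec_val A ?F ?G (j div 4) (j mod 4) x y"
        unfolding xy(2) by (rule antican_eq[OF U xy(1) pU rep[OF _ pU] j])
      also have "\<dots> = ?\<kappa> * (x (j div 4) * y (j mod 4))"
        by (rule sec_val_proportional[OF _ xy(1) ab(1,2) j ab(3,4)])
           (use rep[OF _ pU] in \<open>auto simp: local_rep_def\<close>)
      finally show ?thesis using True by (simp add: segre_def)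
    qed (simp add: segre_def)
  qed
  have \<kappa>: "?\<kappa> \<noteq> 0" using ne ab by simp
  have "p = pt (\<lambda>j. if j \<le> 15 then antican A (j div 4) (j mod 4) U f p else 0)"
    unfolding eq pt_scale[OF \<kappa>] by (rule xy(2))
  then show ?thesis using U pU reg xy(2) by blast
qed

end

section \<open>Transport along isomorphisms\<close>

text \<open>Since \<open>Z\<close> is stable under conjugation, each equation vanishes on
  \<open>Z\<close> together with its conjugate. The real forms \<open>G\<close> and \<open>H\<close>
  of \<open>form_cnj\<close> recombine the two, and together they cut out the same set.\<close>

lemma zariski_closed_real:
  assumes Z: "zariski_closed UNIV n Z"
    and cnj: "\<And>v. v \<in> coord_vecs n \<Longrightarrow> pt v \<in> Z \<Longrightarrow> pt (\<lambda>i. cnj (v i)) \<in> Z"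
  shows "zariski_closed \<real> n Z"
proof -
  obtain S where S: "\<And>F. F \<in> S \<Longrightarrow> \<exists>d. form UNIV n d F" "Z = {p \<in> proj_space n. \<forall>F\<in>S. \<forall>v\<in>p. F v = 0}"
    using Z unfolding zariski_closed_def by blast
  define R where "R = {K. \<exists>F d G H. F \<in> S \<and> form \<real> n d G \<and> form \<real> n d H \<and> (K = G \<or> K = H) \<and>
    (\<forall>v. F v = G v + \<i> * H v \<and> cnj (F (\<lambda>i. cnj (v i))) = G v - \<i> * H v)}"
  have "Z = {p \<in> proj_space n. \<forall>K\<in>R. \<forall>v\<in>p. K v = 0}"
  proof (rule subset_antisym; rule subsetI)
    fix p assume p: "p \<in> Z"
    then obtain u where u: "u \<in> coord_vecs n" "p = pt u" using S(2) unfolding proj_space_def by blast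
    have "K w = 0" if K: "K \<in> R" and w: "w \<in> p" for K w
    proof -
      obtain F d G H where FGH: "F \<in> S" "K = G \<or> K = H" "F w = G w + \<i> * H w"
        "cnj (F (\<lambda>i. cnj (w i))) = G w - \<i> * H w" using K unfolding R_def by blast
      have "F w = 0" using p w FGH(1) S(2) by blast
      have "(\<lambda>i. cnj (w i)) \<in> pt (\<lambda>i. cnj (u i))"
        using w unfolding u(2) by (auto simp: pt_def)
      then have "F (\<lambda>i. cnj (w i)) = 0" using cnj[OF u(1)] p u(2) FGH(1) S(2) by blast
      then have "G w - \<i> * H w = 0" "G w + \<i> * H w = 0" using FGH(3,4) \<open>F w = 0\<close> by auto
      then have "G w = 0" "H w = 0" by (auto simp: algebra_simps)
      then show ?thesis using FGH(2) by auto
    qed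
    then show "p \<in> {p \<in> proj_space n. \<forall>K\<in>R. \<forall>v\<in>p. K v = 0}" using p S(2) by blast
  next
    fix p assume p: "p \<in> {p \<in> proj_space n. \<forall>K\<in>R. \<forall>v\<in>p. K v = 0}"
    have "F w = 0" if F: "F \<in> S" and w: "w \<in> p" for F w
    proof -
      obtain d where "form UNIV n d F" using S(1) F by blast
      then obtain G H where GH: "form \<real> n d G" "form \<real> n d H"
        "\<forall>v. F v = G v + \<i> * H v \<and> cnj (F (\<lambda>i. cnj (v i))) = G v - \<i> * H v"
        using form_cnj by blast
      have "G \<in> R" "H \<in> R" unfolding R_def using F GH by blast+
      then have "G w = 0" "H w = 0" using p w by blast+
      then show ?thesis using GH(3) by simp
    qed
    then show "p \<in> Z" using p S(2) by blast
  qed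
  moreover have "\<forall>K\<in>R. \<exists>d. form \<real> n d K" unfolding R_def by blast
  ultimately show ?thesis unfolding zariski_closed_def by blast
qed

section \<open>Linear changes of coordinates\<close>

lemma regular_on_cong:
  assumes "\<And>q. q \<in> U \<Longrightarrow> f q = g q"
  shows "regular_on n U f \<longleftrightarrow> regular_on n U g"
proof -
  have *: "regular_on n U h'" if h: "regular_on n U h" and h': "\<And>q. q \<in> U \<Longrightarrow> h' q = h q"
    for h h' :: "complex point \<Rightarrow> complex"
    unfolding regular_on_local_rep
  proof
    fix p assume "p \<in> U"
    then obtain F G where "local_rep n U p h F G" using h unfolding regular_on_local_rep by blast
    then have "local_rep n U p h' F G" by (rule local_rep_restrict) (use h' in auto)
    then show "\<exists>F G. local_rep n U p h' F G" by blast
  qed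
  show ?thesis using *[of f g] *[of g f] assms by auto
qed

text \<open>Coordinates beyond \<open>n\<close> are fixed, so that the two maps are inverse to each
  other as maps on all functions and image sets of points can be cancelled without side
  conditions.\<close>

locale linear_iso =
  fixes n :: nat and T T' :: "(nat \<Rightarrow> complex) \<Rightarrow> nat \<Rightarrow> complex"
  assumes form_T: "i \<le> n \<Longrightarrow> form UNIV n 1 (\<lambda>v. T v i)"
    and form_T': "i \<le> n \<Longrightarrow> form UNIV n 1 (\<lambda>v. T' v i)"
    and T'_T: "T' (T v) = v"
    and T_T': "T (T' v) = v"
    and T_beyond: "n < i \<Longrightarrow> T v i = v i"
begin

lemma T'_beyond: "n < i \<Longrightarrow> T' v i = v i"
  using T_beyond[of i "T' v"] by (simp add: T_T')

lemma inverse_iso: "linear_iso n T' T"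
  by unfold_locales (simp_all add: form_T[simplified] form_T'[simplified] T_T' T'_T T'_beyond)

lemma T_scale: "T (\<lambda>i. c * v i) = (\<lambda>i. c * T v i)"
proof
  fix i
  show "T (\<lambda>i. c * v i) i = c * T v i"
    using form_homogeneous[OF form_T[of i], of c v] T_beyond[of i] by (cases "i \<le> n") auto
qed

lemma T_zero: "T (\<lambda>_. 0) = (\<lambda>_. 0)"
  using T_scale[of 0 "\<lambda>_. 0"] by simp

text \<open>Linearity is extracted from degree 1: the partial derivatives of a component have degree
  0, hence are constant, and Euler's relation writes the component as a linear combination of the
  coordinates.\<close>

lemma T_line: "T (\<lambda>i. v i + s * w i) k = T v k + s * T w k"
proof (cases "k \<le> n")
  case True
  let ?F = "\<lambda>v. T v k"
  note F = form_T[OF True]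
  have linear: "?F u = (\<Sum>i\<le>n. partial i ?F (\<lambda>_. 0) * u i)" for u
  proof -
    have const: "partial i ?F u = partial i ?F (\<lambda>_. 0)" if "i \<le> n" for i
    proof -
      have "form UNIV n 0 (partial i ?F)" using form_partial[OF F that] by simp
      then obtain c where "partial i ?F = (\<lambda>_. c)" using form_0_const by blast
      then show ?thesis by simp
    qed
    have "?F u = (\<Sum>i\<le>n. partial i ?F u * u i)" using form_euler[OF F, of u] by simp
    also have "\<dots> = (\<Sum>i\<le>n. partial i ?F (\<lambda>_. 0) * u i)" by (rule sum.cong) (simp_all add: const)
    finally show ?thesis .
  qed
  show ?thesis
    unfolding linear[of "\<lambda>i. v i + s * w i"] linear[of v] linear[of w]
    by (simp add: sum.distrib sum_distrib_left algebra_simps)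
qed (simp add: T_beyond)

lemma T_coord_vecs: "v \<in> coord_vecs n \<Longrightarrow> T v \<in> coord_vecs n"
proof -
  assume v: "v \<in> coord_vecs n"
  have "T v \<noteq> (\<lambda>_. 0)"
  proof
    assume "T v = (\<lambda>_. 0)"
    then have "v = T' (\<lambda>_. 0)" using T'_T[of v] by simp
    also have "\<dots> = (\<lambda>_. 0)" using linear_iso.T_zero[OF inverse_iso] .
    finally show False using v by (simp add: coord_vecs_def)
  qed
  then show ?thesis using v by (simp add: coord_vecs_def T_beyond)
qed

lemma image_pt: "T ` pt v = pt (T v)"
proof -
  have "pt w = (\<lambda>c i. c * w i) ` {c. c \<noteq> 0}" for w :: "nat \<Rightarrow> complex" unfolding pt_def by auto
  then show ?thesis by (simp add: image_image T_scale)
qed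

lemma image_cancel: "T' ` (T ` p) = p" "T ` (T' ` p) = p"
  by (simp_all add: image_comp o_def T'_T T_T')

lemma image_proj_space: "p \<in> proj_space n \<Longrightarrow> T ` p \<in> proj_space n"
  unfolding proj_space_def using image_pt T_coord_vecs by fastforce

lemma form_T_compose: "form UNIV n d F \<Longrightarrow> form UNIV n d (\<lambda>v. F (T v))"
  using form_compose[of n d F n 1 T] form_T by simp

definition pullback :: "complex point set \<Rightarrow> complex point set" where
  "pullback Y = {p \<in> proj_space n. T ` p \<in> Y}"

lemma zariski_closed_pullback:
  assumes "zariski_closed UNIV n Z"
  shows "zariski_closed UNIV n (pullback Z)"
proof -
  obtain S where S: "\<And>F. F \<in> S \<Longrightarrow> \<exists>d. form UNIV n d F" "Z = {p \<in> proj_space n. \<forall>F\<in>S. \<forall>v\<in>p. F v = 0}"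
    using assms unfolding zariski_closed_def by blast
  let ?S = "(\<lambda>F v. F (T v)) ` S"
  have "pullback Z = {p \<in> proj_space n. \<forall>F\<in>?S. \<forall>v\<in>p. F v = 0}"
    unfolding pullback_def S(2) by (auto simp: image_proj_space)
  moreover have "\<forall>F\<in>?S. \<exists>d. form UNIV n d F" using S(1) form_T_compose by blast
  ultimately show ?thesis unfolding zariski_closed_def by blast
qed

lemma regular_on_pullback:
  assumes "regular_on n V f"
  shows "regular_on n (pullback V) (\<lambda>p. f (T ` p))"
  unfolding regular_on_local_rep
proof
  fix p assume "p \<in> pullback V"
  then have "T ` p \<in> V" unfolding pullback_def by blast
  then obtain F G where FG: "local_rep n V (T ` p) f F G" using assms unfolding regular_on_local_rep by blast
  then obtain d where "form UNIV n d F" "form UNIV n d G" unfolding local_rep_def by blast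
  then have "\<exists>d. form UNIV n d (\<lambda>v. F (T v)) \<and> form UNIV n d (\<lambda>v. G (T v))" using form_T_compose by blast
  moreover have "\<forall>v\<in>p. G (T v) \<noteq> 0" using FG unfolding local_rep_def by blast
  moreover have "\<forall>q\<in>pullback V. \<forall>v\<in>q. G (T v) \<noteq> 0 \<longrightarrow> f (T ` q) = F (T v) / G (T v)"
    using FG unfolding local_rep_def pullback_def by blast
  ultimately have "local_rep n (pullback V) p (\<lambda>p. f (T ` p)) (\<lambda>v. F (T v)) (\<lambda>v. G (T v))"
    unfolding local_rep_def by blast
  then show "\<exists>F G. local_rep n (pullback V) p (\<lambda>p. f (T ` p)) F G" by blast
qed

lemma pullback_pullback: "Y \<subseteq> proj_space n \<Longrightarrow> linear_iso.pullback n T' (pullback Y) = Y"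
proof -
  interpret I: linear_iso n T' T by (rule inverse_iso)
  assume "Y \<subseteq> proj_space n"
  then show ?thesis
    unfolding I.pullback_def pullback_def by (auto simp: image_cancel I.image_proj_space)
qed

lemma preimage_eq_pullback: "V \<subseteq> Y \<Longrightarrow> Y \<subseteq> proj_space n \<Longrightarrow> pullback Y \<inter> (\<lambda>p. T ` p) -` V = pullback V"
  unfolding pullback_def by blast

lemma variety_iso_pullback:
  assumes Y: "Y \<subseteq> proj_space n"
  shows "variety_iso n (pullback Y) n Y (\<lambda>p. T ` p)"
  unfolding variety_iso_def
proof (intro conjI allI impI)
  interpret I: linear_iso n T' T by (rule inverse_iso)
  show "bij_betw (\<lambda>p. T ` p) (pullback Y) Y"
  proof (rule bij_betw_byWitness[where f' = "\<lambda>p. T' ` p"])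
    show "(\<lambda>p. T' ` p) ` Y \<subseteq> pullback Y"
      using Y I.image_proj_space by (auto simp: pullback_def image_cancel)
  qed (auto simp: image_cancel pullback_def)
  fix V
  show "zariski_open_in n Y V \<longleftrightarrow> zariski_open_in n (pullback Y) (pullback Y \<inter> (\<lambda>p. T ` p) -` V)"
    if V: "V \<subseteq> Y"
  proof
    assume "zariski_open_in n Y V"
    then obtain Z where Z: "zariski_closed UNIV n Z" "V = Y - Z" unfolding zariski_open_in_def by blast
    have "pullback Y \<inter> (\<lambda>p. T ` p) -` V = pullback Y - pullback Z"
      unfolding pullback_def Z(2) by blast
    then show "zariski_open_in n (pullback Y) (pullback Y \<inter> (\<lambda>p. T ` p) -` V)"
      unfolding zariski_open_in_def using zariski_closed_pullback[OF Z(1)] by blast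
  next
    assume "zariski_open_in n (pullback Y) (pullback Y \<inter> (\<lambda>p. T ` p) -` V)"
    then obtain Z where Z: "zariski_closed UNIV n Z" "pullback V = pullback Y - Z"
      unfolding zariski_open_in_def preimage_eq_pullback[OF V Y] by blast
    have "V = I.pullback (pullback V)" using pullback_pullback[of V] V Y by simp
    also have "\<dots> = I.pullback (pullback Y) - I.pullback Z" unfolding Z(2) I.pullback_def by blast
    also have "\<dots> = Y - I.pullback Z" by (simp add: pullback_pullback[OF Y])
    finally show "zariski_open_in n Y V"
      unfolding zariski_open_in_def using I.zariski_closed_pullback[OF Z(1)] by blast
  qed
  fix f
  assume "zariski_open_in n Y V"
  then have V: "V \<subseteq> Y" by (rule zariski_open_in_subset)
  show "regular_on n V f \<longleftrightarrow> regular_on n (pullback Y \<inter> (\<lambda>p. T ` p) -` V) (f \<circ> (\<lambda>p. T ` p))"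
    unfolding preimage_eq_pullback[OF V Y]
  proof
    assume "regular_on n V f"
    then show "regular_on n (pullback V) (f \<circ> (\<lambda>p. T ` p))" using regular_on_pullback by (simp add: o_def)
  next
    assume "regular_on n (pullback V) (f \<circ> (\<lambda>p. T ` p))"
    from I.regular_on_pullback[OF this] have "regular_on n V (\<lambda>p. f (T ` (T' ` p)))"
      using V Y by (simp add: pullback_pullback[of V] o_def)
    then show "regular_on n V f" by (simp add: image_cancel)
  qed
qed

lemma zariski_irreducible_pullback:
  assumes Y: "Y \<subseteq> proj_space n" and irr: "zariski_irreducible n Y"
  shows "zariski_irreducible n (pullback Y)"
  unfolding zariski_irreducible_def
proof (intro conjI allI impI)
  interpret I: linear_iso n T' T by (rule inverse_iso)
  show "pullback Y \<noteq> {}"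
    using irr Y pullback_pullback[OF Y] unfolding zariski_irreducible_def I.pullback_def by auto
  fix P Q
  assume PQ: "zariski_closed UNIV n P \<and> zariski_closed UNIV n Q \<and> pullback Y \<subseteq> P \<union> Q"
  have "I.pullback (pullback Y) \<subseteq> I.pullback P \<union> I.pullback Q"
    using PQ unfolding I.pullback_def by blast
  then have "Y \<subseteq> I.pullback P \<or> Y \<subseteq> I.pullback Q"
    using irr PQ I.zariski_closed_pullback unfolding zariski_irreducible_def pullback_pullback[OF Y] by blast
  moreover have "pullback Y \<subseteq> R" if "Y \<subseteq> I.pullback R" for R
  proof
    fix p assume "p \<in> pullback Y"
    then have "T ` p \<in> Y" unfolding pullback_def by blast
    then have "T' ` (T ` p) \<in> R" using that unfolding I.pullback_def by blast
    then show "p \<in> R" by (simp add: image_cancel)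
  qed
  ultimately show "pullback Y \<subseteq> P \<or> pullback Y \<subseteq> Q" by blast
qed

lemma compose_derivative:
  assumes F: "form UNIV n d F"
  shows "(\<Sum>l\<le>n. partial l (\<lambda>v. F (T v)) u * w l) = (\<Sum>k\<le>n. partial k F (T u) * T w k)"
proof (rule DERIV_unique[OF form_directional_derivative[OF form_T_compose[OF F]]])
  have "T (\<lambda>i. u i + s * w i) = (\<lambda>k. T u k + s * T w k)" for s by (rule ext) (rule T_line)
  then show "((\<lambda>s. F (T (\<lambda>i. u i + s * w i))) has_field_derivative (\<Sum>k\<le>n. partial k F (T u) * T w k)) (at 0)"
    using form_directional_derivative[OF F, of "T u" "T w"] by simp
qed

lemma smooth_of_dim_pullback:
  assumes Y: "smooth_of_dim d n Y"
  shows "smooth_of_dim d n (pullback Y)"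
  unfolding smooth_of_dim_def
proof (intro conjI ballI)
  show "d \<le> n" using Y unfolding smooth_of_dim_def by blast
  fix p assume p: "p \<in> pullback Y"
  then have "T ` p \<in> Y" unfolding pullback_def by blast
  from Y[unfolded smooth_of_dim_def, THEN conjunct2, THEN bspec, OF this]
  obtain G e F where 1: "\<exists>k. form UNIV n k G" and 2: "\<forall>v\<in>T ` p. G v \<noteq> 0"
    and 3: "\<forall>i<n - d. form UNIV n (e i) (F i)"
    and 4: "\<forall>q\<in>proj_space n. (\<forall>v\<in>q. G v \<noteq> 0) \<longrightarrow> (q \<in> Y \<longleftrightarrow> (\<forall>i<n - d. \<forall>v\<in>q. F i v = 0))"
    and 5: "\<forall>v\<in>T ` p. \<forall>c. (\<forall>j\<le>n. (\<Sum>i<n - d. c i * partial j (F i) v) = 0) \<longrightarrow> (\<forall>i<n - d. c i = 0)"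
    by - (erule exE, erule exE, erule exE, (erule conjE)+, (rule that; assumption))
  let ?G = "\<lambda>v. G (T v)" and ?F = "\<lambda>i v. F i (T v)"
  have c1: "\<exists>k. form UNIV n k ?G" using 1 form_T_compose by blast
  have c2: "\<forall>v\<in>p. ?G v \<noteq> 0" using 2 by blast
  have c3: "\<forall>i<n - d. form UNIV n (e i) (?F i)" using 3 form_T_compose by blast
  have c4: "\<forall>q\<in>proj_space n. (\<forall>v\<in>q. ?G v \<noteq> 0) \<longrightarrow> (q \<in> pullback Y \<longleftrightarrow> (\<forall>i<n - d. \<forall>v\<in>q. ?F i v = 0))"
  proof (intro ballI impI)
    fix q assume q: "q \<in> proj_space n" "\<forall>v\<in>q. ?G v \<noteq> 0"
    have "T ` q \<in> Y \<longleftrightarrow> (\<forall>i<n - d. \<forall>v\<in>T ` q. F i v = 0)"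
      using 4 image_proj_space[OF q(1)] q(2) by blast
    then show "q \<in> pullback Y \<longleftrightarrow> (\<forall>i<n - d. \<forall>v\<in>q. ?F i v = 0)" using q(1) unfolding pullback_def by blast
  qed
  have ind: "\<forall>i<n - d. c i = 0"
    if v: "v \<in> p" and c: "\<forall>j\<le>n. (\<Sum>i<n - d. c i * partial j (?F i) v) = 0" for v c
  proof -
    have "(\<Sum>i<n - d. c i * partial j (F i) (T v)) = 0" if "j \<le> n" for j
    proof -
      \<comment> \<open>\<open>T\<close> maps this vector back to the unit vector, so pairing the
        relation with it isolates the partial derivatives in direction \<open>j\<close> at
        \<open>T v\<close>.\<close>
      let ?w = "T' (unit_row j)"
      have "0 = (\<Sum>l\<le>n. (\<Sum>i<n - d. c i * partial l (?F i) v) * ?w l)" using c by simp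
      also have "\<dots> = (\<Sum>i<n - d. c i * (\<Sum>l\<le>n. partial l (?F i) v * ?w l))"
        unfolding sum_distrib_left sum_distrib_right by (subst sum.swap) (simp add: mult.assoc)
      also have "\<dots> = (\<Sum>i<n - d. c i * (\<Sum>k\<le>n. partial k (F i) (T v) * T ?w k))"
        by (intro sum.cong refl arg_cong2[of _ _ _ _ "(*)"] compose_derivative[OF 3[rule_format]]) simp
      also have "\<dots> = (\<Sum>i<n - d. c i * partial j (F i) (T v))"
        using that by (simp add: T_T' if_distrib[of "(*) _"] cong: if_cong)
      finally show ?thesis by simp
    qed
    then show ?thesis using 5 v by blast
  qed
  have c5: "\<forall>v\<in>p. \<forall>c. (\<forall>j\<le>n. (\<Sum>i<n - d. c i * partial j (?F i) v) = 0) \<longrightarrow> (\<forall>i<n - d. c i = 0)"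
    by (rule ballI, rule allI, rule impI, rule ind)
  show "\<exists>G e F. (\<exists>k. form UNIV n k G) \<and> (\<forall>v\<in>p. G v \<noteq> 0) \<and> (\<forall>i<n - d. form UNIV n (e i) (F i)) \<and>
      (\<forall>q\<in>proj_space n. (\<forall>v\<in>q. G v \<noteq> 0) \<longrightarrow> (q \<in> pullback Y \<longleftrightarrow> (\<forall>i<n - d. \<forall>v\<in>q. F i v = 0))) \<and>
      (\<forall>v\<in>p. \<forall>c. (\<forall>j\<le>n. (\<Sum>i<n - d. c i * partial j (F i) v) = 0) \<longrightarrow> (\<forall>i<n - d. c i = 0))"
    by (rule exI[of _ ?G], rule exI[of _ e], rule exI[of _ ?F]) (intro conjI c1 c2 c3 c4 c5)
qed

end

section \<open>Transport of anticanonical sections\<close>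

lemma anticanonical_section_regular:
  assumes "anticanonical_section d e m Y D" "zariski_open_in m Y U" "\<And>i. i < d * e \<Longrightarrow> regular_on m U (f i)"
  shows "regular_on m U (D U f)"
proof -
  have "\<forall>U f. zariski_open_in m Y U \<and> (\<forall>i<d*e. regular_on m U (f i)) \<longrightarrow> regular_on m U (D U f)"
    using assms(1) unfolding anticanonical_section_def by (elim conjE) assumption
  then show ?thesis using assms(2,3) by simp
qed

lemma anticanonical_section_restrict:
  assumes "anticanonical_section d e m Y D" "zariski_open_in m Y U" "zariski_open_in m Y V" "V \<subseteq> U"
    "\<And>i. i < d * e \<Longrightarrow> regular_on m U (f i)" "\<And>i. i < d * e \<Longrightarrow> regular_on m V (g i)"
    "\<And>i p. i < d * e \<Longrightarrow> p \<in> V \<Longrightarrow> f i p = g i p" "p \<in> V"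
  shows "D U f p = D V g p"
proof -
  have "\<forall>U V f g. zariski_open_in m Y U \<and> zariski_open_in m Y V \<and> V \<subseteq> U \<and>
        (\<forall>i<d*e. regular_on m U (f i) \<and> regular_on m V (g i) \<and> (\<forall>p\<in>V. f i p = g i p)) \<longrightarrow>
        (\<forall>p\<in>V. D U f p = D V g p)"
    using assms(1) unfolding anticanonical_section_def by (elim conjE) assumption
  from this[THEN spec[of _ U], THEN spec[of _ V], THEN spec[of _ f], THEN spec[of _ g]]
  show ?thesis using assms(2-) by simp
qed

lemma anticanonical_section_derivation:
  assumes "anticanonical_section d e m Y D" "zariski_open_in m Y U"
    "\<And>i. i < d * e \<Longrightarrow> regular_on m U (f i)" "i < d * e" "regular_on m U a" "regular_on m U b" "p \<in> U"
  shows "D U (f(i := (\<lambda>q. a q + b q))) p = D U (f(i := a)) p + D U (f(i := b)) p \<and>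
        D U (f(i := (\<lambda>q. a q * b q))) p = a p * D U (f(i := b)) p + b p * D U (f(i := a)) p \<and>
        D U (f(i := (\<lambda>_. c))) p = 0"
proof -
  have "\<forall>U f i a b c. zariski_open_in m Y U \<and> (\<forall>j<d*e. regular_on m U (f j)) \<and> i < d*e \<and>
        regular_on m U a \<and> regular_on m U b \<longrightarrow>
        (\<forall>p\<in>U. D U (f(i := (\<lambda>q. a q + b q))) p = D U (f(i := a)) p + D U (f(i := b)) p \<and>
                D U (f(i := (\<lambda>q. a q * b q))) p = a p * D U (f(i := b)) p + b p * D U (f(i := a)) p \<and>
                D U (f(i := (\<lambda>_. c))) p = 0)"
    using assms(1) unfolding anticanonical_section_def by (elim conjE) assumption
  from this[THEN spec[of _ U], THEN spec[of _ f], THEN spec[of _ i], THEN spec[of _ a], THEN spec[of _ b],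
      THEN spec[of _ c], THEN mp, THEN bspec, of p]
  show ?thesis using assms(2-) by blast
qed

lemma anticanonical_section_alternating:
  assumes "anticanonical_section d e m Y D" "zariski_open_in m Y U"
    "\<And>i. i < d * e \<Longrightarrow> regular_on m U (f i)" "i < d * e" "j < d * e" "i \<noteq> j" "i div d = j div d"
    "\<And>p. p \<in> U \<Longrightarrow> f i p = f j p" "p \<in> U"
  shows "D U f p = 0"
proof -
  have "\<forall>U f i j. zariski_open_in m Y U \<and> (\<forall>k<d*e. regular_on m U (f k)) \<and>
        i < d*e \<and> j < d*e \<and> i \<noteq> j \<and> i div d = j div d \<and> (\<forall>p\<in>U. f i p = f j p) \<longrightarrow>
        (\<forall>p\<in>U. D U f p = 0)"
    using assms(1) unfolding anticanonical_section_def by (elim conjE) assumption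
  from this[THEN spec[of _ U], THEN spec[of _ f], THEN spec[of _ i], THEN spec[of _ j]]
  show ?thesis using assms(2-) by simp
qed

lemma anticanonical_section_cong:
  assumes D: "anticanonical_section d m n X D" and U: "zariski_open_in n X U"
    and f: "\<And>i. i < d * m \<Longrightarrow> regular_on n U (f i)" and fg: "\<And>i q. i < d * m \<Longrightarrow> q \<in> U \<Longrightarrow> f i q = g i q"
    and p: "p \<in> U"
  shows "D U f p = D U g p"
proof (rule anticanonical_section_restrict[OF D U U subset_refl f _ fg p])
  show "regular_on n U (g i)" if "i < d * m" for i
    using f[OF that] regular_on_cong[of U "f i" "g i"] fg[OF that] by blast
qed

locale var_iso =
  fixes n X m Y \<phi>
  assumes iso: "variety_iso n X m Y \<phi>"
begin

definition \<psi> where "\<psi> = inv_into X \<phi>"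

lemma bij: "bij_betw \<phi> X Y"
  using iso unfolding variety_iso_def by blast

lemma \<psi>_\<phi>: "p \<in> X \<Longrightarrow> \<psi> (\<phi> p) = p"
  using bij unfolding \<psi>_def bij_betw_def by simp

lemma preimage_image: "U \<subseteq> X \<Longrightarrow> X \<inter> \<phi> -` (\<phi> ` U) = U"
  using inj_onD[OF bij_betw_imp_inj_on[OF bij]] by auto

lemma image_subset: "U \<subseteq> X \<Longrightarrow> \<phi> ` U \<subseteq> Y"
  using bij unfolding bij_betw_def by blast

lemma open_image: "zariski_open_in n X U \<Longrightarrow> zariski_open_in m Y (\<phi> ` U)"
proof -
  assume U: "zariski_open_in n X U"
  note sub = zariski_open_in_subset[OF U]
  have "zariski_open_in m Y (\<phi> ` U) \<longleftrightarrow> zariski_open_in n X (X \<inter> \<phi> -` (\<phi> ` U))"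
    using iso image_subset[OF sub] unfolding variety_iso_def by blast
  then show ?thesis using U preimage_image[OF sub] by simp
qed

lemma regular_iff:
  assumes "zariski_open_in n X U"
  shows "regular_on m (\<phi> ` U) f \<longleftrightarrow> regular_on n U (f \<circ> \<phi>)"
proof -
  have "regular_on m (\<phi> ` U) f \<longleftrightarrow> regular_on n (X \<inter> \<phi> -` (\<phi> ` U)) (f \<circ> \<phi>)"
    using iso open_image[OF assms] unfolding variety_iso_def by blast
  then show ?thesis using preimage_image[OF zariski_open_in_subset[OF assms]] by simp
qed

lemma regular_image:
  assumes U: "zariski_open_in n X U" and f: "regular_on n U f"
  shows "regular_on m (\<phi> ` U) (\<lambda>q. f (\<psi> q))"
  unfolding regular_iff[OF U]
  by (rule iffD1[OF regular_on_cong f]) (use \<psi>_\<phi> zariski_open_in_subset[OF U] in auto)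

definition transport where
  "transport D U f p = D (\<phi> ` U) (\<lambda>i q. f i (\<psi> q)) (\<phi> p)"

lemma anticanonical_section_transport:
  assumes D: "anticanonical_section d e m Y D"
  shows "anticanonical_section d e n X (transport D)"
proof -
  note D1 = anticanonical_section_regular[OF D] and D2 = anticanonical_section_restrict[OF D]
    and D3 = anticanonical_section_derivation[OF D] and D4 = anticanonical_section_alternating[OF D]
  have upd: "(\<lambda>k q. (f(i := h)) k (\<psi> q)) = (\<lambda>k q. f k (\<psi> q))(i := (\<lambda>q. h (\<psi> q)))"
    for f :: "nat \<Rightarrow> complex point \<Rightarrow> complex" and i h by (auto simp: fun_eq_iff)
  show ?thesis
    unfolding anticanonical_section_def
  proof (intro conjI allI impI; (elim conjE)?)
    fix U f assume U: "zariski_open_in n X U" and f: "\<forall>i<d*e. regular_on n U (f i)"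
    have "regular_on m (\<phi> ` U) (D (\<phi> ` U) (\<lambda>i q. f i (\<psi> q)))"
      by (rule D1) (use open_image[OF U] f regular_image[OF U] in auto)
    then show "regular_on n U (transport D U f)"
      unfolding regular_iff[OF U] by (simp add: transport_def[abs_def] o_def)
  next
    fix U V f g assume U: "zariski_open_in n X U" and V: "zariski_open_in n X V" and VU: "V \<subseteq> U"
      and fg: "\<forall>i<d*e. regular_on n U (f i) \<and> regular_on n V (g i) \<and> (\<forall>p\<in>V. f i p = g i p)"
    show "\<forall>p\<in>V. transport D U f p = transport D V g p"
    proof
      fix p assume p: "p \<in> V"
      show "transport D U f p = transport D V g p"
        unfolding transport_def
      proof (rule D2[OF open_image[OF U] open_image[OF V]])
        fix i assume i: "i < d * e"
        show "regular_on m (\<phi> ` U) (\<lambda>q. f i (\<psi> q))" "regular_on m (\<phi> ` V) (\<lambda>q. g i (\<psi> q))"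
          using fg i regular_image[OF U] regular_image[OF V] by blast+
        show "f i (\<psi> p) = g i (\<psi> p)" if "p \<in> \<phi> ` V" for p
          using fg i that \<psi>_\<phi> zariski_open_in_subset[OF V] by auto
      qed (use VU p in auto)
    qed
  next
    fix U f i a b c
    assume U: "zariski_open_in n X U" and f: "\<forall>j<d*e. regular_on n U (f j)" and i: "i < d*e"
      and ab: "regular_on n U a" "regular_on n U b"
    show "\<forall>p\<in>U. transport D U (f(i := (\<lambda>q. a q + b q))) p = transport D U (f(i := a)) p + transport D U (f(i := b)) p \<and>
        transport D U (f(i := (\<lambda>q. a q * b q))) p = a p * transport D U (f(i := b)) p + b p * transport D U (f(i := a)) p \<and>
        transport D U (f(i := (\<lambda>_. c))) p = 0"
    proof
      fix p assume p: "p \<in> U"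
      then have "\<psi> (\<phi> p) = p" using \<psi>_\<phi> zariski_open_in_subset[OF U] by blast
      moreover have "regular_on m (\<phi> ` U) (\<lambda>q. f j (\<psi> q))" if "j < d * e" for j
        using f that regular_image[OF U] by blast
      note D3[where f = "\<lambda>j q. f j (\<psi> q)", OF open_image[OF U] this i regular_image[OF U ab(1)]
          regular_image[OF U ab(2)] imageI[OF p], of c]
      ultimately show "transport D U (f(i := (\<lambda>q. a q + b q))) p = transport D U (f(i := a)) p + transport D U (f(i := b)) p \<and>
        transport D U (f(i := (\<lambda>q. a q * b q))) p = a p * transport D U (f(i := b)) p + b p * transport D U (f(i := a)) p \<and>
        transport D U (f(i := (\<lambda>_. c))) p = 0"
        unfolding transport_def upd by simp
    qed
  next
    fix U f i j
    assume U: "zariski_open_in n X U" and f: "\<forall>k<d*e. regular_on n U (f k)" and ij: "i < d*e" "j < d*e" "i \<noteq> j"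
      "i div d = j div d" and eq: "\<forall>p\<in>U. f i p = f j p"
    show "\<forall>p\<in>U. transport D U f p = 0"
    proof
      fix p assume p: "p \<in> U"
      show "transport D U f p = 0"
        unfolding transport_def
      proof (rule D4[OF open_image[OF U] _ ij])
        show "regular_on m (\<phi> ` U) (\<lambda>q. f k (\<psi> q))" if "k < d * e" for k
          using f that regular_image[OF U] by blast
        show "f i (\<psi> p) = f j (\<psi> p)" if "p \<in> \<phi> ` U" for p
          using that eq \<psi>_\<phi> zariski_open_in_subset[OF U] by auto
      qed (use p in auto)
    qed
  qed
qed

text \<open>If sections on \<open>Y\<close> reproduce the homogeneous coordinates of its points,
  their transports give the map \<phi> on \<open>X\<close>, which is an isomorphism onto the closed
  set \<open>Y\<close>.\<close>

lemma anticanonical_very_ample_transport: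
  assumes closed: "zariski_closed UNIV m Y"
    and s: "\<And>j. j \<le> m \<Longrightarrow> anticanonical_section d e m Y (s j)"
    and coords: "\<And>q. q \<in> Y \<Longrightarrow> \<exists>U f. zariski_open_in m Y U \<and> q \<in> U \<and> (\<forall>i<d*e. regular_on m U (f i)) \<and>
      q = pt (\<lambda>j. if j \<le> m then s j U f q else 0)"
  shows "anticanonical_power_very_ample d e n X"
proof -
  have im: "\<phi> ` X = Y" using bij by (simp add: bij_betw_def)
  have "\<exists>U f. zariski_open_in n X U \<and> p \<in> U \<and> (\<forall>i<d*e. regular_on n U (f i)) \<and>
      \<phi> p = pt (\<lambda>j. if j \<le> m then transport (s j) U f p else 0)" if p: "p \<in> X" for p
  proof -
    have "\<phi> p \<in> Y" using im p by blast
    then obtain V g where V: "zariski_open_in m Y V" "\<phi> p \<in> V" "\<forall>i<d*e. regular_on m V (g i)"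
      "\<phi> p = pt (\<lambda>j. if j \<le> m then s j V g (\<phi> p) else 0)" using coords[of "\<phi> p"] by blast
    let ?U = "X \<inter> \<phi> -` V"
    have VY: "V \<subseteq> Y" by (rule zariski_open_in_subset[OF V(1)])
    have U: "zariski_open_in n X ?U" using iso V(1) VY unfolding variety_iso_def by blast
    have imU: "\<phi> ` ?U = V" using VY im by blast
    have reg: "regular_on n ?U (g i \<circ> \<phi>)" if "i < d * e" for i
      using V(3) that regular_iff[OF U, of "g i"] imU by simp
    \<comment> \<open>Going to \<open>X\<close> and back changes the functions off \<open>V\<close>,
      where the inverse means nothing; a section depends only on their values on
      \<open>V\<close>.\<close>
    have "s j V (\<lambda>i q. (g i \<circ> \<phi>) (\<psi> q)) (\<phi> p) = s j V g (\<phi> p)" if "j \<le> m" for j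
    proof (rule anticanonical_section_cong[OF s[OF that] V(1) _ _ V(2)])
      show "regular_on m V (\<lambda>q. (g i \<circ> \<phi>) (\<psi> q))" if "i < d * e" for i
        using regular_image[OF U reg[OF that]] imU by simp
      show "(g i \<circ> \<phi>) (\<psi> q) = g i q" if "q \<in> V" for i q
      proof -
        have "q \<in> \<phi> ` X" using that VY im by blast
        then show ?thesis by (auto simp: \<psi>_\<phi>)
      qed
    qed
    then have "\<phi> p = pt (\<lambda>j. if j \<le> m then transport (s j) ?U (\<lambda>i. g i \<circ> \<phi>) p else 0)"
      unfolding transport_def imU using V(4) by (simp cong: if_cong)
    then show ?thesis using U p V(2) reg by (intro exI[of _ ?U] exI[of _ "\<lambda>i. g i \<circ> \<phi>"]) auto
  qed
  then show ?thesis
    unfolding anticanonical_power_very_ample_def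
    using closed iso im anticanonical_section_transport[OF s]
    by (intro exI[of _ m] exI[of _ "\<lambda>j. transport (s j)"] exI[of _ \<phi>]) auto
qed

end

context smooth_net
begin

lemma pullback_fano:
  assumes "linear_iso 15 T T'"
  shows "smooth_fano 3 15 (linear_iso.pullback 15 T (bilin_intersection A))"
    and "family_2_12 15 (linear_iso.pullback 15 T (bilin_intersection A))"
    and "zariski_irreducible 15 (linear_iso.pullback 15 T (bilin_intersection A))"
proof -
  interpret T: linear_iso 15 T T' by (rule assms)
  have sub: "bilin_intersection A \<subseteq> proj_space 15"
    unfolding bilin_intersection_eq proj_space_def using segre_coord_vecs by blast
  note iso = T.variety_iso_pullback[OF sub]
  interpret V: var_iso 15 "T.pullback (bilin_intersection A)" 15 "bilin_intersection A" "\<lambda>p. T ` p"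
    by unfold_locales (rule iso)
  show "family_2_12 15 (T.pullback (bilin_intersection A))"
    unfolding family_2_12_def using smooth iso by blast
  show "zariski_irreducible 15 (T.pullback (bilin_intersection A))"
    by (rule T.zariski_irreducible_pullback[OF sub irreducible])
  have "anticanonical_power_very_ample 3 1 15 (T.pullback (bilin_intersection A))"
  proof (rule V.anticanonical_very_ample_transport[OF bilin_intersection_closed])
    show "anticanonical_section 3 1 15 (bilin_intersection A) (antican A (j div 4) (j mod 4))" if "j \<le> 15" for j
      by (rule antican_anticanonical_section) (use that in auto)
    show "\<exists>U f. zariski_open_in 15 (bilin_intersection A) U \<and> q \<in> U \<and> (\<forall>i<3 * 1. regular_on 15 U (f i)) \<and>
      q = pt (\<lambda>j. if j \<le> 15 then antican A (j div 4) (j mod 4) U f q else 0)" if "q \<in> bilin_intersection A" for q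
      using antican_coordinates[OF that] by simp
  qed
  then show "smooth_fano 3 15 (T.pullback (bilin_intersection A))"
    unfolding smooth_fano_def using T.smooth_of_dim_pullback[OF smooth_of_dim_3] by (intro conjI exI[of _ 1]) simp_all
qed

end

section \<open>The example\<close>

text \<open>Writing \<open>d = (4, 4, -1, -1)\<close> and \<open>w = (2, 1, 2, 1)\<close>, with indices modulo 4, the three forms are
  \<open>\<Sum> d\<^sub>j x\<^sub>j y\<^sub>j\<close>, \<open>\<Sum> w\<^sub>j x\<^sub>j y\<^sub>j\<^sub>+\<^sub>1\<close> and \<open>\<Sum> w\<^sub>j x\<^sub>j\<^sub>+\<^sub>1 y\<^sub>j\<close>. For \<open>y = cnj x\<close> the first is a Hermitian form and the
  other two are complex conjugate.\<close>

definition net :: "nat \<Rightarrow> nat \<Rightarrow> nat \<Rightarrow> complex" where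
  "net i j k =
    (if i = 0 then (if j = k then (if j < 2 then 4 else -1) else 0)
     else if i = 1 then (if k = (j + 1) mod 4 then (if even j then 2 else 1) else 0)
     else (if j = (k + 1) mod 4 then (if even k then 2 else 1) else 0))"

section \<open>Smoothness and corank of the example\<close>

lemma lessThan_4: "{..<4::nat} = {0, 1, 2, 3}" and lessThan_3: "{..<3::nat} = {0, 1, 2}"
  by auto

lemma all_less_4: "(\<forall>k<4::nat. P k) \<longleftrightarrow> P 0 \<and> P 1 \<and> P 2 \<and> P 3"
proof -
  have "(\<forall>k<4::nat. P k) \<longleftrightarrow> (\<forall>k\<in>{..<4}. P k)" by (simp add: Ball_def)
  then show ?thesis unfolding lessThan_4 by simp
qed

lemma all_less_3: "(\<forall>k<3::nat. P k) \<longleftrightarrow> P 0 \<and> P 1 \<and> P 2"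
proof -
  have "(\<forall>k<3::nat. P k) \<longleftrightarrow> (\<forall>k\<in>{..<3}. P k)" by (simp add: Ball_def)
  then show ?thesis unfolding lessThan_3 by simp
qed

lemma ex_less_4: "(\<exists>k<4::nat. P k) \<longleftrightarrow> P 0 \<or> P 1 \<or> P 2 \<or> P 3"
  using all_less_4[of "\<lambda>k. \<not> P k"] by blast

lemma bilin_net:
  "bilin (net 0) x y = 4 * (x 0 * y 0) + 4 * (x 1 * y 1) - x 2 * y 2 - x 3 * y 3"
  "bilin (net 1) x y = 2 * (x 0 * y 1) + x 1 * y 2 + 2 * (x 2 * y 3) + x 3 * y 0"
  "bilin (net 2) x y = 2 * (x 1 * y 0) + x 2 * y 1 + 2 * (x 3 * y 2) + x 0 * y 3"
  unfolding bilin_def atMost_3 lessThan_4 by (simp_all add: net_def)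

lemma lrow_net:
  "(\<Sum>i<3. c i * lrow net x i 0) = 4 * (c 0 * x 0) + c 1 * x 3 + 2 * (c 2 * x 1)"
  "(\<Sum>i<3. c i * lrow net x i 1) = 4 * (c 0 * x 1) + 2 * (c 1 * x 0) + c 2 * x 2"
  "(\<Sum>i<3. c i * lrow net x i 2) = - (c 0 * x 2) + c 1 * x 1 + 2 * (c 2 * x 3)"
  "(\<Sum>i<3. c i * lrow net x i 3) = - (c 0 * x 3) + 2 * (c 1 * x 2) + c 2 * x 0"
  unfolding lrow_def lessThan_4 lessThan_3 by (simp_all add: net_def)

lemma rrow_net:
  "(\<Sum>i<3. c i * rrow net y i 0) = 4 * (c 0 * y 0) + 2 * (c 1 * y 1) + c 2 * y 3"
  "(\<Sum>i<3. c i * rrow net y i 1) = 4 * (c 0 * y 1) + c 1 * y 2 + 2 * (c 2 * y 0)"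
  "(\<Sum>i<3. c i * rrow net y i 2) = - (c 0 * y 2) + 2 * (c 1 * y 3) + c 2 * y 1"
  "(\<Sum>i<3. c i * rrow net y i 3) = - (c 0 * y 3) + c 1 * y 0 + 2 * (c 2 * y 2)"
  unfolding rrow_def lessThan_4 lessThan_3 by (simp_all add: net_def)

text \<open>\<open>(A, B, C)\<close> are the \<open>2 \<times> 2\<close> minors of two elements of the left kernel of the matrix \<open>lrow net x\<close>.\<close>

lemma net_corank_aux:
  fixes A B C x0 x1 x2 x3 :: complex
  assumes "4 * A * x0 = 2 * C * x1" "4 * B * x0 = - C * x3"
    "4 * A * x1 = C * x2" "4 * B * x1 = - 2 * C * x0"
    "- A * x2 = 2 * C * x3" "B * x2 = C * x1"
    "- A * x3 = C * x0" "B * x3 = 2 * C * x2"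
    and nz: "x0 \<noteq> 0 \<or> x1 \<noteq> 0 \<or> x2 \<noteq> 0 \<or> x3 \<noteq> 0"
  shows "A = 0" "B = 0" "C = 0"
proof -
  show C: "C = 0"
  proof (rule ccontr)
    assume C: "C \<noteq> 0"
    \<comment> \<open>Passing from \<open>x0\<close> through \<open>x3\<close> gives
      \<open>C^2 x0 = 4 A B x0\<close>, passing through \<open>x1\<close> gives
      \<open>C^2 x0 = - 4 A B x0\<close>.\<close>
    have "C * C * x0 = - A * (C * x3)" using assms(7) by (simp add: algebra_simps)
    also have "\<dots> = 4 * (A * B) * x0" using assms(2) by (simp add: algebra_simps)
    finally have 1: "C * C * x0 = 4 * (A * B) * x0" .
    have "2 * (C * C) * x0 = - C * (- 2 * C * x0)" by simp
    also have "\<dots> = - C * (4 * B * x1)" by (simp only: assms(4))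
    also have "\<dots> = - 4 * B * (C * x1)" by simp
    also have "\<dots> = - 2 * B * (4 * A * x0)" using assms(1) by (simp add: algebra_simps)
    finally have "2 * (C * C * x0) = - 2 * (4 * (A * B) * x0)" by (simp add: algebra_simps)
    then have "4 * (C * C * x0) = 0" unfolding 1[symmetric] by simp
    then have x0: "x0 = 0" using C by simp
    then have "x1 = 0" "x3 = 0" using assms(1,2) C by auto
    then have "x2 = 0" using assms(3) C by auto
    then show False using nz x0 \<open>x1 = 0\<close> \<open>x3 = 0\<close> by blast
  qed
  have "A * x0 = 0" "A * x1 = 0" "A * x2 = 0" "A * x3 = 0"
    using assms(1,3,5,7) unfolding C by simp_all
  then show "A = 0" using nz by (metis mult_eq_0_iff)
  have "B * x0 = 0" "B * x1 = 0" "B * x2 = 0" "B * x3 = 0"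
    using assms(2,4,6,8) unfolding C by simp_all
  then show "B = 0" using nz by (metis mult_eq_0_iff)
qed

text \<open>The vector \<open>(a, b, e)\<close> is orthogonal to \<open>(t, p, q)\<close> and
  \<open>(t', p', q')\<close>, hence parallel to their vector product; these are two of the
  resulting proportions.\<close>

lemma eliminate_two_equations:
  fixes a b e t p q t' p' q' :: complex
  assumes "a * t + b * p + e * q = 0" "a * t' + b * p' + e * q' = 0"
  shows "a * (t * p' - p * t') = e * (p * q' - q * p')" "a * (t * q' - q * t') = - b * (p * q' - q * p')"
proof -
  have "a * (t * p' - p * t') = p' * (a * t + b * p + e * q) - p * (a * t' + b * p' + e * q') + e * (p * q' - q * p')"
    by (simp add: algebra_simps)
  then show "a * (t * p' - p * t') = e * (p * q' - q * p')" unfolding assms by simp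
  have "a * (t * q' - q * t') = q' * (a * t + b * p + e * q) - q * (a * t' + b * p' + e * q') - b * (p * q' - q * p')"
    by (simp add: algebra_simps)
  then show "a * (t * q' - q * t') = - b * (p * q' - q * p')" unfolding assms by simp
qed

lemma sum_0_cancel: "X + a + b = 0 \<Longrightarrow> X + c + d = 0 \<Longrightarrow> a - d = c - b" for X :: complex
proof -
  assume "X + a + b = 0" "X + c + d = 0"
  moreover have "a - d = (X + a + b) - (X + c + d) + (c - b)" by simp
  ultimately show ?thesis by simp
qed

lemma sum_0_solve: "X + a + b = 0 \<Longrightarrow> X = - (a + b)" "- X + a + b = 0 \<Longrightarrow> X = a + b" for X :: complex
proof -
  show "X = - (a + b)" if "X + a + b = 0"
  proof -
    have "X = (X + a + b) - (a + b)" by simp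
    then show ?thesis unfolding that by simp
  qed
  show "X = a + b" if "- X + a + b = 0"
  proof -
    have "X = (a + b) - (- X + a + b)" by simp
    then show ?thesis unfolding that by simp
  qed
qed

lemma net_corank:
  fixes c c' :: "nat \<Rightarrow> complex"
  assumes x: "\<exists>j<4. x j \<noteq> 0" and c: "\<And>k. k < 4 \<Longrightarrow> (\<Sum>i<3. c i * lrow net x i k) = 0"
    and c': "\<And>k. k < 4 \<Longrightarrow> (\<Sum>i<3. c' i * lrow net x i k) = 0" and ij: "i < 3" "j < 3"
  shows "c i * c' j = c j * c' i"
proof -
  define A B C where "A = c 0 * c' 1 - c 1 * c' 0" and "B = c 0 * c' 2 - c 2 * c' 0"
    and "C = c 1 * c' 2 - c 2 * c' 1"
  have l: "4 * (c 0 * x 0) + c 1 * x 3 + 2 * (c 2 * x 1) = 0"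
    "4 * (c 0 * x 1) + 2 * (c 1 * x 0) + c 2 * x 2 = 0"
    "- (c 0 * x 2) + c 1 * x 1 + 2 * (c 2 * x 3) = 0"
    "- (c 0 * x 3) + 2 * (c 1 * x 2) + c 2 * x 0 = 0"
    using c[of 0] c[of 1] c[of 2] c[of 3] unfolding lrow_net by auto
  have l': "4 * (c' 0 * x 0) + c' 1 * x 3 + 2 * (c' 2 * x 1) = 0"
    "4 * (c' 0 * x 1) + 2 * (c' 1 * x 0) + c' 2 * x 2 = 0"
    "- (c' 0 * x 2) + c' 1 * x 1 + 2 * (c' 2 * x 3) = 0"
    "- (c' 0 * x 3) + 2 * (c' 1 * x 2) + c' 2 * x 0 = 0"
    using c'[of 0] c'[of 1] c'[of 2] c'[of 3] unfolding lrow_net by auto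
  note E0 = eliminate_two_equations[of "4 * x 0" "c 0" "x 3" "c 1" "2 * x 1" "c 2" "c' 0" "c' 1" "c' 2"]
  note E1 = eliminate_two_equations[of "4 * x 1" "c 0" "2 * x 0" "c 1" "x 2" "c 2" "c' 0" "c' 1" "c' 2"]
  note E2 = eliminate_two_equations[of "- x 2" "c 0" "x 1" "c 1" "2 * x 3" "c 2" "c' 0" "c' 1" "c' 2"]
  note E3 = eliminate_two_equations[of "- x 3" "c 0" "2 * x 2" "c 1" "x 0" "c 2" "c' 0" "c' 1" "c' 2"]
  have "4 * x 0 * A = 2 * x 1 * C" "4 * x 0 * B = - x 3 * C" "4 * x 1 * A = x 2 * C" "4 * x 1 * B = - (2 * x 0) * C"
    "- x 2 * A = 2 * x 3 * C" "- x 2 * B = - x 1 * C" "- x 3 * A = x 0 * C" "- x 3 * B = - (2 * x 2) * C"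
    unfolding A_def B_def C_def
    by (rule E0 E1 E2 E3; use l l' in \<open>simp add: mult.commute mult.left_commute\<close>)+
  then have h: "4 * A * x 0 = 2 * C * x 1" "4 * B * x 0 = - C * x 3" "4 * A * x 1 = C * x 2"
    "4 * B * x 1 = - 2 * C * x 0" "- A * x 2 = 2 * C * x 3" "B * x 2 = C * x 1" "- A * x 3 = C * x 0"
    "B * x 3 = 2 * C * x 2"
    by (simp_all add: mult.commute mult.left_commute)
  have "x 0 \<noteq> 0 \<or> x 1 \<noteq> 0 \<or> x 2 \<noteq> 0 \<or> x 3 \<noteq> 0" using x unfolding ex_less_4 .
  then have "A = 0 \<and> B = 0 \<and> C = 0" using net_corank_aux[OF h] by blast
  moreover have "i = 0 \<or> i = 1 \<or> i = 2" "j = 0 \<or> j = 1 \<or> j = 2" using ij by auto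
  ultimately show ?thesis unfolding A_def B_def C_def by auto
qed

text \<open>With \<open>\<sigma>\<^sub>j = p w\<^sub>j x\<^sub>j y\<^sub>j\<^sub>+\<^sub>1\<close> the equations force \<open>\<sigma>\<^sub>j = q w\<^sub>j x\<^sub>j\<^sub>+\<^sub>1 y\<^sub>j\<close> and \<open>t d\<^sub>j x\<^sub>j y\<^sub>j = - (\<sigma>\<^sub>j + \<sigma>\<^sub>j\<^sub>-\<^sub>1)\<close>, hence
  \<open>t\<^sup>2 \<sigma>\<^sub>j\<^sup>2 = K, K, 16 K, K\<close> for a common \<open>K\<close>, which together with \<open>\<Sum> \<sigma>\<^sub>j = 0\<close> leaves only \<open>\<sigma> = 0\<close>.\<close>

lemma net_sigma_zero:
  fixes t p q :: complex
  assumes r: "4 * (t * y0) + 2 * (p * y1) + q * y3 = 0" "4 * (t * y1) + p * y2 + 2 * (q * y0) = 0"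
      "- (t * y2) + 2 * (p * y3) + q * y1 = 0" "- (t * y3) + p * y0 + 2 * (q * y2) = 0"
    and l: "4 * (t * x0) + p * x3 + 2 * (q * x1) = 0" "4 * (t * x1) + 2 * (p * x0) + q * x2 = 0"
      "- (t * x2) + p * x1 + 2 * (q * x3) = 0" "- (t * x3) + 2 * (p * x2) + q * x0 = 0"
    and b1: "2 * (x0 * y1) + x1 * y2 + 2 * (x2 * y3) + x3 * y0 = 0"
    and b2: "2 * (x1 * y0) + x2 * y1 + 2 * (x3 * y2) + x0 * y3 = 0"
    and t: "t \<noteq> 0"
  shows "x0 * y0 = 0 \<and> x1 * y1 = 0 \<and> x2 * y2 = 0 \<and> x3 * y3 = 0 \<and>
    p * (x0 * y1) = 0 \<and> p * (x1 * y2) = 0 \<and> p * (x2 * y3) = 0 \<and> p * (x3 * y0) = 0 \<and>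
    q * (x1 * y0) = 0 \<and> q * (x2 * y1) = 0 \<and> q * (x3 * y2) = 0 \<and> q * (x0 * y3) = 0"
proof -
  define s0 s1 s2 s3 where "s0 = 2 * (p * (x0 * y1))" and "s1 = p * (x1 * y2)"
    and "s2 = 2 * (p * (x2 * y3))" and "s3 = p * (x3 * y0)"
  define u0 u1 u2 u3 where "u0 = 2 * (q * (x1 * y0))" and "u1 = q * (x2 * y1)"
    and "u2 = 2 * (q * (x3 * y2))" and "u3 = q * (x0 * y3)"
  \<comment> \<open>Equation \<open>r\<close> number \<open>j\<close> is multiplied by
    \<open>x_j\<close>, and below equation \<open>l\<close> number \<open>j\<close> by
    \<open>y_j\<close>, so that both contain the diagonal term \<open>x_j y_j\<close>.\<close>
  have row: "4 * (t * (x0 * y0)) + s0 + u3 = 0" "4 * (t * (x1 * y1)) + s1 + u0 = 0"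
    "- (t * (x2 * y2)) + s2 + u1 = 0" "- (t * (x3 * y3)) + s3 + u2 = 0"
    using arg_cong[OF r(1), of "(*) x0"] arg_cong[OF r(2), of "(*) x1"] arg_cong[OF r(3), of "(*) x2"]
      arg_cong[OF r(4), of "(*) x3"]
    unfolding s0_def s1_def s2_def s3_def u0_def u1_def u2_def u3_def by (simp_all add: algebra_simps)
  have col: "4 * (t * (x0 * y0)) + s3 + u0 = 0" "4 * (t * (x1 * y1)) + s0 + u1 = 0"
    "- (t * (x2 * y2)) + s1 + u2 = 0" "- (t * (x3 * y3)) + s2 + u3 = 0"
    using arg_cong[OF l(1), of "(*) y0"] arg_cong[OF l(2), of "(*) y1"] arg_cong[OF l(3), of "(*) y2"]
      arg_cong[OF l(4), of "(*) y3"]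
    unfolding s0_def s1_def s2_def s3_def u0_def u1_def u2_def u3_def by (simp_all add: algebra_simps)
  have ss: "s0 + s1 + s2 + s3 = 0" and su: "u0 + u1 + u2 + u3 = 0"
    using arg_cong[OF b1, of "(*) p"] arg_cong[OF b2, of "(*) q"]
    unfolding s0_def s1_def s2_def s3_def u0_def u1_def u2_def u3_def by (simp_all add: algebra_simps)
  \<comment> \<open>Row and column equations share the diagonal term, so subtraction shows that
    \<open>s_j - u_j\<close> does not depend on \<open>j\<close>. The bilinear equations make the
    sum of these differences 0.\<close>
  have e: "s1 - u1 = s0 - u0" "s2 - u2 = s1 - u1" "s3 - u3 = s2 - u2"
    by (rule sum_0_cancel[OF row(2) col(2)], rule sum_0_cancel[OF row(3) col(3)], rule sum_0_cancel[OF row(4) col(4)])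
  have "4 * (s0 - u0) = (s0 - u0) + (s1 - u1) + (s2 - u2) + (s3 - u3)" unfolding e by simp
  also have "\<dots> = (s0 + s1 + s2 + s3) - (u0 + u1 + u2 + u3)" by simp
  finally have "s0 - u0 = 0" unfolding ss su by simp
  then have us: "u0 = s0" "u1 = s1" "u2 = s2" "u3 = s3" using e by simp_all
  define K where "K = - (p * q * ((s0 + s1) * (s1 + s2)))"
  have D: "4 * (t * (x0 * y0)) = - (s0 + s3)" "4 * (t * (x1 * y1)) = - (s0 + s1)"
    "t * (x2 * y2) = s1 + s2" "t * (x3 * y3) = s2 + s3"
    using sum_0_solve(1)[OF row(1)] sum_0_solve(1)[OF row(2)] sum_0_solve(2)[OF row(3)] sum_0_solve(2)[OF row(4)]
    unfolding us by (simp_all add: add.commute)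
  have "s2 + s3 = (s0 + s1 + s2 + s3) - (s0 + s1)" "s0 + s3 = (s0 + s1 + s2 + s3) - (s1 + s2)" by simp_all
  then have rest: "s2 + s3 = - (s0 + s1)" "s0 + s3 = - (s1 + s2)" unfolding ss by simp_all
  have D: "4 * (t * (x0 * y0)) = s1 + s2" "4 * (t * (x1 * y1)) = - (s0 + s1)"
    "t * (x2 * y2) = s1 + s2" "t * (x3 * y3) = - (s0 + s1)"
    using D unfolding rest by simp_all
  \<comment> \<open>As \<open>u = s\<close>, each \<open>s_j ^ 2 = s_j * u_j\<close> regroups into a
    product of two neighbouring diagonal terms, which \<open>D\<close> expresses through
    \<open>s0 + s1\<close> and \<open>s1 + s2\<close>.\<close>
  have "4 * (t\<^sup>2 * s0\<^sup>2) = p * q * ((4 * (t * (x0 * y0))) * (4 * (t * (x1 * y1))))"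
  proof -
    have "s0\<^sup>2 = s0 * u0" using us by (simp add: power2_eq_square)
    moreover have "4 * (t\<^sup>2 * (s0 * u0)) = p * q * ((4 * (t * (x0 * y0))) * (4 * (t * (x1 * y1))))"
      unfolding s0_def u0_def by (simp add: power2_eq_square algebra_simps)
    ultimately show ?thesis by (simp only:)
  qed
  then have k0: "4 * (t\<^sup>2 * s0\<^sup>2) = K" unfolding D K_def by (simp add: algebra_simps)
  have "4 * (t\<^sup>2 * s1\<^sup>2) = p * q * ((4 * (t * (x1 * y1))) * (t * (x2 * y2)))"
  proof -
    have "s1\<^sup>2 = s1 * u1" using us by (simp add: power2_eq_square)
    moreover have "4 * (t\<^sup>2 * (s1 * u1)) = p * q * ((4 * (t * (x1 * y1))) * (t * (x2 * y2)))"
      unfolding s1_def u1_def by (simp add: power2_eq_square algebra_simps)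
    ultimately show ?thesis by (simp only:)
  qed
  then have k1: "4 * (t\<^sup>2 * s1\<^sup>2) = K" unfolding D K_def by (simp add: algebra_simps)
  have "t\<^sup>2 * s2\<^sup>2 = 4 * (p * q * ((t * (x2 * y2)) * (t * (x3 * y3))))"
  proof -
    have "s2\<^sup>2 = s2 * u2" using us by (simp add: power2_eq_square)
    moreover have "t\<^sup>2 * (s2 * u2) = 4 * (p * q * ((t * (x2 * y2)) * (t * (x3 * y3))))"
      unfolding s2_def u2_def by (simp add: power2_eq_square algebra_simps)
    ultimately show ?thesis by (simp only:)
  qed
  then have k2: "t\<^sup>2 * s2\<^sup>2 = 4 * K" unfolding D K_def by (simp add: algebra_simps)
  have "4 * (t\<^sup>2 * s3\<^sup>2) = p * q * ((4 * (t * (x0 * y0))) * (t * (x3 * y3)))"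
  proof -
    have "s3\<^sup>2 = s3 * u3" using us by (simp add: power2_eq_square)
    moreover have "4 * (t\<^sup>2 * (s3 * u3)) = p * q * ((4 * (t * (x0 * y0))) * (t * (x3 * y3)))"
      unfolding s3_def u3_def by (simp add: power2_eq_square algebra_simps)
    ultimately show ?thesis by (simp only:)
  qed
  then have k3: "4 * (t\<^sup>2 * s3\<^sup>2) = K" unfolding D K_def by (simp add: algebra_simps)
  have "4 * (t\<^sup>2 * s1\<^sup>2) = 4 * (t\<^sup>2 * s0\<^sup>2)" "4 * (t\<^sup>2 * s3\<^sup>2) = 4 * (t\<^sup>2 * s0\<^sup>2)"
    unfolding k0 k1 k3 by (rule refl)+
  moreover have "t\<^sup>2 * s2\<^sup>2 = t\<^sup>2 * (16 * s0\<^sup>2)" unfolding k2 k0[symmetric] by simp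
  ultimately have sq: "s1\<^sup>2 = s0\<^sup>2" "s3\<^sup>2 = s0\<^sup>2" "s2\<^sup>2 = (4 * s0)\<^sup>2" using t by (simp_all add: power_mult_distrib)
  then have "s1 = s0 \<or> s1 = - s0" "s3 = s0 \<or> s3 = - s0" "s2 = 4 * s0 \<or> s2 = - (4 * s0)"
    by (simp_all only: power2_eq_iff)
  \<comment> \<open>\<open>ss\<close> reads \<open>(1 + a + b + 4 * c) * s0 = 0\<close> with signs
    \<open>a\<close>, \<open>b\<close>, \<open>c\<close>; the integer is odd, hence nonzero.\<close>
  then have s0: "s0 = 0" using ss by auto
  then have s: "s1 = 0" "s2 = 0" "s3 = 0" using sq by simp_all
  have "x0 * y0 = 0" "x1 * y1 = 0" "x2 * y2 = 0" "x3 * y3 = 0" using D s0 s t by simp_all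
  then show ?thesis
    using s0 s us unfolding s0_def s1_def s2_def s3_def u0_def u1_def u2_def u3_def by simp
qed

text \<open>For nonzero \<open>t\<close> the products \<open>x_j y_j\<close> vanish by
  \<open>net_sigma_zero\<close>, which the linear equations do not allow. For \<open>t = 0\<close>
  these equations link only indices of equal parity: \<open>4 p^2 - q^2\<close> kills
  \<open>y1\<close> and \<open>x0\<close>, \<open>p^2 - 4 q^2\<close> kills \<open>y0\<close> and
  \<open>x1\<close>, and in either case the first bilinear equation fails.\<close>

lemma net_smooth_aux:
  fixes t p q :: complex
  assumes r: "4 * (t * y0) + 2 * (p * y1) + q * y3 = 0" "4 * (t * y1) + p * y2 + 2 * (q * y0) = 0"
      "- (t * y2) + 2 * (p * y3) + q * y1 = 0" "- (t * y3) + p * y0 + 2 * (q * y2) = 0"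
    and l: "4 * (t * x0) + p * x3 + 2 * (q * x1) = 0" "4 * (t * x1) + 2 * (p * x0) + q * x2 = 0"
      "- (t * x2) + p * x1 + 2 * (q * x3) = 0" "- (t * x3) + 2 * (p * x2) + q * x0 = 0"
    and b1: "2 * (x0 * y1) + x1 * y2 + 2 * (x2 * y3) + x3 * y0 = 0"
    and b2: "2 * (x1 * y0) + x2 * y1 + 2 * (x3 * y2) + x0 * y3 = 0"
    and x: "x0 \<noteq> 0 \<or> x1 \<noteq> 0 \<or> x2 \<noteq> 0 \<or> x3 \<noteq> 0" and y: "y0 \<noteq> 0 \<or> y1 \<noteq> 0 \<or> y2 \<noteq> 0 \<or> y3 \<noteq> 0"
  shows "t = 0 \<and> p = 0 \<and> q = 0"
proof -
  have t: "t = 0"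
  proof (rule ccontr)
    assume t: "t \<noteq> 0"
    note z = net_sigma_zero[OF r l b1 b2 t]
    show False
    proof (cases "p = 0")
      case p: True
      \<comment> \<open>For \<open>p = 0\<close> the equations link the zeros of the
        \<open>y_j\<close> in a chain, so no \<open>y_j\<close> vanishes and
        \<open>x_j y_j = 0\<close> gives \<open>x = 0\<close>. The case \<open>q = 0\<close> is
        similar.\<close>
      have "q \<noteq> 0" using r t y p by auto
      then have "y0 = 0 \<longleftrightarrow> y3 = 0" "y1 = 0 \<longleftrightarrow> y0 = 0" "y2 = 0 \<longleftrightarrow> y1 = 0"
        using r(1-3) t p by (auto simp: add_eq_0_iff)
      then show False using z x y by auto
    next
      case p: False
      show False
      proof (cases "q = 0")
        case q: True
        have "y0 = 0 \<longleftrightarrow> y1 = 0" "y1 = 0 \<longleftrightarrow> y2 = 0" "y2 = 0 \<longleftrightarrow> y3 = 0"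
          using r(1-3) t p q by (auto simp: add_eq_0_iff)
        then show False using z x y by auto
      next
        case q: False
        \<comment> \<open>With indices modulo 4, a nonzero \<open>x_j\<close> kills
          \<open>y_j\<close> and its two neighbours; one of the equations \<open>r\<close> then
          kills the fourth coordinate.\<close>
        have z': "x0 * y0 = 0" "x1 * y1 = 0" "x2 * y2 = 0" "x3 * y3 = 0" "x0 * y1 = 0" "x1 * y2 = 0"
          "x2 * y3 = 0" "x3 * y0 = 0" "x1 * y0 = 0" "x2 * y1 = 0" "x3 * y2 = 0" "x0 * y3 = 0"
          using z p q by auto
        show False
        proof (cases "y0 = 0 \<and> y1 = 0 \<or> y1 = 0 \<and> y2 = 0")
          case True
          then show False using r z' p q t x y by auto
        next
          case False
          then show False using r z' p q t x y by auto
        qed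
      qed
    qed
  qed
  have r0: "2 * (p * y1) = - (q * y3)" "p * y2 = - (2 * (q * y0))" "2 * (p * y3) = - (q * y1)" "p * y0 = - (2 * (q * y2))"
    and l0: "p * x3 = - (2 * (q * x1))" "2 * (p * x0) = - (q * x2)" "p * x1 = - (2 * (q * x3))" "2 * (p * x2) = - (q * x0)"
    using r l t by (simp_all add: add_eq_0_iff2)
  have "p = 0 \<and> q = 0"
  proof (rule ccontr)
    assume "\<not> ?thesis"
    then have pq: "p \<noteq> 0" "q \<noteq> 0" using r0 y by auto
    have 1: "(4 * p\<^sup>2 - q\<^sup>2) * y1 = 0" "(p\<^sup>2 - 4 * q\<^sup>2) * y0 = 0" "(p\<^sup>2 - 4 * q\<^sup>2) * x1 = 0" "(4 * p\<^sup>2 - q\<^sup>2) * x0 = 0"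
    proof -
      have d: "(4 * p\<^sup>2 - q\<^sup>2) * z = 2 * p * (2 * (p * z)) - q * (q * z)"
        "(p\<^sup>2 - 4 * q\<^sup>2) * z = p * (p * z) - 2 * q * (2 * (q * z))" for z
        by (simp_all add: power2_eq_square algebra_simps)
      have "q * y1 = - (2 * (p * y3))" "2 * (q * y0) = - (p * y2)" "2 * (q * x1) = - (p * x3)" "q * x0 = - (2 * (p * x2))"
        unfolding r0 l0 by simp_all
      then show "(4 * p\<^sup>2 - q\<^sup>2) * y1 = 0" "(p\<^sup>2 - 4 * q\<^sup>2) * y0 = 0" "(p\<^sup>2 - 4 * q\<^sup>2) * x1 = 0" "(4 * p\<^sup>2 - q\<^sup>2) * x0 = 0"
        unfolding d r0(1,4) l0(2,3) by simp_all
    qed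
    have iff: "y3 = 0 \<longleftrightarrow> y1 = 0" "y2 = 0 \<longleftrightarrow> y0 = 0" "x3 = 0 \<longleftrightarrow> x1 = 0" "x2 = 0 \<longleftrightarrow> x0 = 0"
      using r0 l0 pq by auto
    show False
    proof (cases "4 * p\<^sup>2 = q\<^sup>2")
      case True
      \<comment> \<open>\<open>4 p^2 = q^2\<close> and \<open>p^2 = 4 q^2\<close> together would
        force \<open>p = q = 0\<close>.\<close>
      then have "p\<^sup>2 - 4 * q\<^sup>2 \<noteq> 0" using pq by (auto simp flip: True)
      then have "y0 = 0" "x1 = 0" using 1 by auto
      then have z: "y0 = 0" "y2 = 0" "x1 = 0" "x3 = 0" "y1 \<noteq> 0" "x0 \<noteq> 0" using iff x y by auto
      then have "x0 * y1 + x2 * y3 = (2 * (x0 * y1) + x1 * y2 + 2 * (x2 * y3) + x3 * y0) / 2"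
        by (simp add: add_divide_distrib)
      then have "x0 * y1 + x2 * y3 = 0" unfolding b1 by simp
      \<comment> \<open>\<open>q x2 = - 2 p x0\<close> and \<open>q y3 = - 2 p y1\<close>: the signs
        cancel in the product, so the two terms are equal, while \<open>b1\<close> makes them
        opposite.\<close>
      moreover have "q\<^sup>2 * (x2 * y3) = q\<^sup>2 * (x0 * y1)"
      proof -
        have "q\<^sup>2 * (x2 * y3) = (- (q * x2)) * (- (q * y3))" by (simp add: power2_eq_square)
        also have "\<dots> = (4 * p\<^sup>2) * (x0 * y1)" by (simp add: power2_eq_square flip: l0(2) r0(1))
        finally show ?thesis using True by simp
      qed
      then have "x2 * y3 = x0 * y1" using pq by simp
      ultimately have "2 * (x0 * y1) = 0" by simp
      then show False using z by simp
    next
      case False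
      then have z1: "y1 = 0" "x0 = 0" using 1 by auto
      then have nz: "y0 \<noteq> 0" "x1 \<noteq> 0" using iff x y by auto
      have "x1 * y2 + x3 * y0 = 0" using b1 z1 iff by simp
      then have "0 = p * (x1 * y2 + x3 * y0)" by simp
      also have "\<dots> = x1 * (p * y2) + (p * x3) * y0" by (simp add: algebra_simps)
      also have "\<dots> = - (4 * (q * (x1 * y0)))" unfolding r0(2) l0(1) by simp
      finally have "4 * (q * (x1 * y0)) = 0" by simp
      then show False using nz pq by simp
    qed
  qed
  then show ?thesis using t by blast
qed

lemma net_smooth: "smooth_complete_intersection net"
  unfolding smooth_complete_intersection_def
proof (intro ballI impI allI; elim conjE)
  fix x y :: "nat \<Rightarrow> complex" and c i
  assume x: "x \<in> coord_vecs 3" and y: "y \<in> coord_vecs 3" and b: "\<forall>i<3. bilin (net i) x y = 0"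
    and "\<forall>j\<le>3. (\<Sum>i<3. c i * (\<Sum>k\<le>3. net i j k * y k)) = 0"
    and "\<forall>k\<le>3. (\<Sum>i<3. c i * (\<Sum>j\<le>3. net i j k * x j)) = 0" and i: "i < (3::nat)"
  then have r: "\<forall>j<4. (\<Sum>i<3. c i * rrow net y i j) = 0" and l: "\<forall>k<4. (\<Sum>i<3. c i * lrow net x i k) = 0"
    by (simp_all add: rrow_def lrow_def atMost_3)
  have "c 0 = 0 \<and> c 1 = 0 \<and> c 2 = 0"
    using r l b coord_vecs_3_nonzero[OF x] coord_vecs_3_nonzero[OF y]
    unfolding all_less_4 all_less_3 ex_less_4 bilin_net rrow_net lrow_net
    by (intro net_smooth_aux[of "c 0" "y 0" "c 1" "y 1" "c 2" "y 3" "y 2" "x 0" "x 3" "x 1" "x 2"]) simp_all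
  moreover have "i = 0 \<or> i = 1 \<or> i = 2" using i by auto
  ultimately show "c i = 0" by auto
qed

interpretation net: smooth_net net
  by unfold_locales (rule net_smooth, rule net_corank)

text \<open>Real coordinates on the space of Hermitian \<open>4 \<times> 4\<close> matrices: the entry \<open>(j, k)\<close> of a real
  matrix \<open>u\<close> holds the real part of \<open>z\<^sub>j\<^sub>k\<close> if \<open>j \<le> k\<close> and the imaginary part of \<open>z\<^sub>k\<^sub>j\<close> if \<open>j > k\<close>.\<close>

definition swap_index :: "nat \<Rightarrow> nat" where
  "swap_index l = 4 * (l mod 4) + l div 4"

definition herm :: "(nat \<Rightarrow> complex) \<Rightarrow> nat \<Rightarrow> complex" where
  "herm u l = (if 15 < l \<or> l div 4 = l mod 4 then u l
     else if l div 4 < l mod 4 then u l + \<i> * u (swap_index l) else u (swap_index l) - \<i> * u l)"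

definition herm_inv :: "(nat \<Rightarrow> complex) \<Rightarrow> nat \<Rightarrow> complex" where
  "herm_inv z l = (if 15 < l \<or> l div 4 = l mod 4 then z l
     else if l div 4 < l mod 4 then (z l + z (swap_index l)) / 2 else \<i> * (z l - z (swap_index l)) / 2)"

lemma swap_index:
  assumes "l \<le> 15"
  shows "swap_index l \<le> 15" "swap_index l div 4 = l mod 4" "swap_index l mod 4 = l div 4"
    "swap_index (swap_index l) = l"
proof -
  have "l div 4 < 4" "l mod 4 < 4" using assms by auto
  then show "swap_index l \<le> 15" and dm: "swap_index l div 4 = l mod 4" "swap_index l mod 4 = l div 4"
    unfolding swap_index_def by auto
  show "swap_index (swap_index l) = l" unfolding swap_index_def[of "swap_index l"] dm by simp
qed

lemma herm_iso: "linear_iso 15 herm herm_inv"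
proof
  have c: "form UNIV 15 1 (\<lambda>v. v i)" "form UNIV 15 1 (\<lambda>v. v (swap_index i))" if "i \<le> 15" for i
    using form.coord[of _ 15] that swap_index(1)[OF that] by auto
  fix i :: nat and v
  assume i: "i \<le> 15"
  show "form UNIV 15 1 (\<lambda>v. herm v i)"
    using i c[OF i]
    by (cases "i div 4" "i mod 4" rule: linorder_cases)
       (auto simp: herm_def intro!: form.add form_diff form_cmult)
  have "form UNIV 15 1 (\<lambda>v. (1 / 2) * (v i + v (swap_index i)))" "form UNIV 15 1 (\<lambda>v. (\<i> / 2) * (v i - v (swap_index i)))"
    using c[OF i] by (intro form_cmult form.add form_diff; simp)+
  then show "form UNIV 15 1 (\<lambda>v. herm_inv v i)"
    using i c[OF i] by (cases "i div 4" "i mod 4" rule: linorder_cases) (auto simp: herm_inv_def)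
next
  fix v
  have ii: "\<i> * (\<i> * a) = - a" for a by (simp flip: mult.assoc)
  show "herm_inv (herm v) = v"
  proof
    fix l
    show "herm_inv (herm v) l = v l"
    proof (cases "l \<le> 15")
      case True
      then show ?thesis using swap_index[OF True]
        by (cases "l div 4" "l mod 4" rule: linorder_cases) (auto simp: herm_def herm_inv_def ii field_simps)
    qed (simp add: herm_def herm_inv_def)
  qed
  show "herm (herm_inv v) = v"
  proof
    fix l
    show "herm (herm_inv v) l = v l"
    proof (cases "l \<le> 15")
      case True
      then show ?thesis using swap_index[OF True]
        by (cases "l div 4" "l mod 4" rule: linorder_cases) (auto simp: herm_def herm_inv_def ii field_simps)
    qed (simp add: herm_def herm_inv_def)
  qed
qed (simp add: herm_def)

interpretation herm: linear_iso 15 herm herm_inv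
  by (rule herm_iso)

definition example_variety :: "complex point set" where
  "example_variety = herm.pullback (bilin_intersection net)"

section \<open>Conjugation and the real structure\<close>

lemma in_example_variety:
  assumes "pt u \<in> example_variety"
  obtains x y where "in_cone net x y" "herm u = segre x y"
proof -
  have "pt (herm u) \<in> bilin_intersection net"
    using assms unfolding example_variety_def herm.pullback_def by (simp add: herm.image_pt)
  then obtain x y where xy: "in_cone net x y" "pt (herm u) = pt (segre x y)" unfolding bilin_intersection_eq by blast
  have "herm u \<in> pt (segre x y)" using in_pt_self[of "herm u"] unfolding xy(2) .
  then obtain c where c: "c \<noteq> 0" "herm u = (\<lambda>i. c * segre x y i)" by (rule in_ptE)
  then have "herm u = segre (\<lambda>i. c * x i) (\<lambda>i. 1 * y i)" unfolding segre_scale by simp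
  then show ?thesis using that in_cone_scale[OF xy(1) c(1), of 1] by simp
qed

lemma example_varietyI:
  assumes "u \<in> coord_vecs 15" "in_cone net x y" "herm u = segre x y"
  shows "pt u \<in> example_variety"
  unfolding example_variety_def herm.pullback_def herm.image_pt assms(3)
  using assms(1) pt_segre_in[OF assms(2)] herm.image_pt[of u] assms(3) unfolding proj_space_def by auto

text \<open>Conjugating the coordinates is the conjugate transpose on matrices: this is the twisted
  real structure.\<close>

lemma herm_cnj: "l \<le> 15 \<Longrightarrow> herm (\<lambda>i. cnj (u i)) l = cnj (herm u (swap_index l))"
  using swap_index[of l] mult_div_mod_eq[of 4 l]
  by (cases "l div 4" "l mod 4" rule: linorder_cases) (auto simp: herm_def swap_index_def)

text \<open>On rank one matrices the conjugate transpose sends \<open>(x, y)\<close> to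
  \<open>(cnj y, cnj x)\<close>. The first form is Hermitian, and the other two are
  interchanged.\<close>

lemma in_cone_net_cnj:
  assumes "in_cone net x y"
  shows "in_cone net (\<lambda>i. cnj (y i)) (\<lambda>i. cnj (x i))"
proof -
  have "bilin (net 0) (\<lambda>i. cnj (y i)) (\<lambda>i. cnj (x i)) = cnj (bilin (net 0) x y)"
    "bilin (net 1) (\<lambda>i. cnj (y i)) (\<lambda>i. cnj (x i)) = cnj (bilin (net 2) x y)"
    "bilin (net 2) (\<lambda>i. cnj (y i)) (\<lambda>i. cnj (x i)) = cnj (bilin (net 1) x y)"
    unfolding bilin_net by (simp_all add: algebra_simps)
  then show ?thesis using assms unfolding in_cone_def all_less_3 by simp
qed

lemma example_variety_real: "real_variety 15 example_variety"
  unfolding real_variety_def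
proof
  show "zariski_irreducible 15 example_variety"
    unfolding example_variety_def by (rule net.pullback_fano(3)[OF herm_iso])
  show "zariski_closed \<real> 15 example_variety"
  proof (rule zariski_closed_real)
    show "zariski_closed UNIV 15 example_variety"
      unfolding example_variety_def by (rule herm.zariski_closed_pullback[OF bilin_intersection_closed])
    fix v :: "nat \<Rightarrow> complex" assume v: "v \<in> coord_vecs 15" "pt v \<in> example_variety"
    obtain x y where xy: "in_cone net x y" "herm v = segre x y" using in_example_variety[OF v(2)] .
    show "pt (\<lambda>i. cnj (v i)) \<in> example_variety"
    proof (rule example_varietyI[OF _ in_cone_net_cnj[OF xy(1)]])
      show "(\<lambda>i. cnj (v i)) \<in> coord_vecs 15" using v(1) by (auto simp: coord_vecs_def fun_eq_iff)
      show "herm (\<lambda>i. cnj (v i)) = segre (\<lambda>i. cnj (y i)) (\<lambda>i. cnj (x i))"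
      proof
        fix l
        show "herm (\<lambda>i. cnj (v i)) l = segre (\<lambda>i. cnj (y i)) (\<lambda>i. cnj (x i)) l"
        proof (cases "l \<le> 15")
          case True
          then show ?thesis using swap_index[OF True] herm_cnj[OF True] xy(2) by (simp add: segre_def)
        next
          case False
          then show ?thesis using v(1) by (simp add: herm_def segre_def coord_vecs_def)
        qed
      qed
    qed
  qed
qed

text \<open>On a real point, \<open>z\<close> is a real multiple of \<open>x x\<^sup>*\<close>, and \<open>|x\<^sub>2| = |x\<^sub>3|\<close> is impossible: with \<open>s = |x\<^sub>2|\<close> the
  Hermitian equation gives \<open>|x\<^sub>0|\<^sup>2 + |x\<^sub>1|\<^sup>2 = s\<^sup>2 / 2\<close>, so the other terms of the second equation add up to at
  most \<open>3 s\<^sup>2 / 2\<close> in absolute value, while \<open>|2 x\<^sub>2 y\<^sub>3| = 2 s\<^sup>2\<close>.\<close>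

lemma hermitian_point_separation:
  assumes "in_cone net x (\<lambda>i. cnj (x i))"
  shows "cmod (x 2) \<noteq> cmod (x 3)"
proof
  assume eq: "cmod (x 2) = cmod (x 3)"
  define s a b where "s = cmod (x 2)" and "a = cmod (x 0)" and "b = cmod (x 1)"
  have s3: "cmod (x 3) = s" using eq by (simp add: s_def)
  have pos: "s \<ge> 0" "a \<ge> 0" "b \<ge> 0" by (simp_all add: s_def a_def b_def)
  have bil: "bilin (net 0) x (\<lambda>i. cnj (x i)) = 0" "bilin (net 1) x (\<lambda>i. cnj (x i)) = 0"
    using assms unfolding in_cone_def by auto
  have "complex_of_real (4 * a\<^sup>2 + 4 * b\<^sup>2 - s\<^sup>2 - s\<^sup>2) = 0"
    using bil(1) unfolding bilin_net complex_norm_square[symmetric] s3 s_def[symmetric] a_def[symmetric] b_def[symmetric]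
    by simp
  then have ab: "2 * a\<^sup>2 + 2 * b\<^sup>2 = s\<^sup>2" by (simp only: of_real_eq_0_iff)
  have "2 * (x 2 * cnj (x 3)) = bilin (net 1) x (\<lambda>i. cnj (x i)) -
      (2 * (x 0 * cnj (x 1)) + x 1 * cnj (x 2) + x 3 * cnj (x 0))"
    unfolding bilin_net by simp
  then have "2 * (x 2 * cnj (x 3)) = - (2 * (x 0 * cnj (x 1)) + x 1 * cnj (x 2) + x 3 * cnj (x 0))"
    unfolding bil by simp
  then have "cmod (2 * (x 2 * cnj (x 3))) = cmod (2 * (x 0 * cnj (x 1)) + x 1 * cnj (x 2) + x 3 * cnj (x 0))"
    by (simp only: norm_minus_cancel)
  also have "\<dots> \<le> cmod (2 * (x 0 * cnj (x 1))) + cmod (x 1 * cnj (x 2)) + cmod (x 3 * cnj (x 0))"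
    by (intro norm_triangle_le add_mono order_refl norm_triangle_ineq)
  finally have ineq: "2 * s\<^sup>2 \<le> 2 * (a * b) + s * (a + b)"
    by (simp add: norm_mult s3 s_def[symmetric] a_def[symmetric] b_def[symmetric] power2_eq_square algebra_simps
        del: One_nat_def)
  \<comment> \<open>Since \<open>s^2 = 2 a^2 + 2 b^2\<close>, the squares \<open>(a - b)^2\<close>
    and \<open>(a + b)^2\<close> add up to \<open>s^2\<close>, and \<open>4 a b\<close> is at most
    \<open>s^2\<close>.\<close>
  have "0 \<le> (a - b)\<^sup>2" by simp
  then have prod: "4 * (a * b) \<le> s\<^sup>2" and sum: "(a + b)\<^sup>2 \<le> s\<^sup>2" using ab by (simp_all add: power2_eq_square algebra_simps)
  have "a + b \<le> s" using sum pos(1) by (rule power2_le_imp_le)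
  then have "s * (a + b) \<le> s\<^sup>2" using pos(1) unfolding power2_eq_square by (rule mult_left_mono)
  then have "s\<^sup>2 \<le> 0" using ineq prod by linarith
  then have "s = 0" by simp
  then have "a = 0" "b = 0" using ab pos by (simp_all add: add_nonneg_eq_0_iff)
  then have "\<forall>j<4. x j = 0" unfolding all_less_4 using \<open>s = 0\<close> s3 by (simp add: s_def a_def b_def)
  then show False using assms unfolding in_cone_def by blast
qed

text \<open>A Hermitian matrix of the form \<open>x_j y_k\<close> has \<open>y\<close> proportional
  to \<open>cnj x\<close>. Entries 10 = 4 * 2 + 2 and 15 = 4 * 3 + 3 are diagonal, so they are
  \<open>|x 2|^2\<close> and \<open>|x 3|^2\<close> up to a common factor; squares avoid discussing
  its sign.\<close>

lemma real_point_separation: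
  fixes v :: "nat \<Rightarrow> real"
  assumes v: "v \<in> coord_vecs 15" "pt (\<lambda>i. complex_of_real (v i)) \<in> example_variety"
  shows "(v 10)\<^sup>2 \<noteq> (v 15)\<^sup>2"
proof
  assume eq: "(v 10)\<^sup>2 = (v 15)\<^sup>2"
  let ?u = "\<lambda>i. complex_of_real (v i)"
  obtain x y where xy: "in_cone net x y" "herm ?u = segre x y" using in_example_variety[OF v(2)] .
  have herm: "x k * y j = cnj (x j * y k)" if "j < 4" "k < 4" for j k
  proof -
    have "herm ?u (4 * k + j) = cnj (herm ?u (4 * j + k))"
    proof -
      have "swap_index (4 * k + j) = 4 * j + k" using that by (simp add: swap_index_def)
      then show ?thesis using herm_cnj[of "4 * k + j" ?u] that by simp
    qed
    then show ?thesis unfolding xy(2) using that by (simp add: segre_index)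
  qed
  obtain k where k: "k < 4" "x k \<noteq> 0" using xy(1) by (auto simp: in_cone_def)
  define \<kappa> where "\<kappa> = cnj (y k) / x k"
  have y: "y j = \<kappa> * cnj (x j)" if "j < 4" for j
    using herm[OF that k(1)] k(2) by (simp add: \<kappa>_def field_simps)
  then have "\<kappa> \<noteq> 0" using xy(1) by (auto simp: in_cone_def)
  have bil: "bilin f x y = \<kappa> * bilin f x (\<lambda>i. cnj (x i))" for f
    unfolding bilin_def atMost_3 sum_distrib_left by (intro sum.cong refl) (simp add: y)
  have "in_cone net x (\<lambda>i. cnj (x i))"
    using xy(1) \<open>\<kappa> \<noteq> 0\<close> unfolding in_cone_def bil by auto
  then have "cmod (x 2) \<noteq> cmod (x 3)" by (rule hermitian_point_separation)
  moreover have "herm ?u 10 = ?u 10" "herm ?u 15 = ?u 15" by (simp_all add: herm_def)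
  then have "?u 10 = x 2 * y 2" "?u 15 = x 3 * y 3" unfolding xy(2) by (simp_all add: segre_def)
  then have e: "?u 10 = \<kappa> * of_real ((cmod (x 2))\<^sup>2)" "?u 15 = \<kappa> * of_real ((cmod (x 3))\<^sup>2)"
    unfolding complex_norm_square by (simp_all add: y)
  have "\<bar>v 10\<bar> = cmod \<kappa> * (cmod (x 2))\<^sup>2" "\<bar>v 15\<bar> = cmod \<kappa> * (cmod (x 3))\<^sup>2"
    using arg_cong[OF e(1), of cmod] arg_cong[OF e(2), of cmod]
    by (simp_all only: norm_mult norm_of_real abs_power2)
  moreover have "\<bar>v 10\<bar> = \<bar>v 15\<bar>" using eq by (simp add: power2_eq_iff abs_eq_iff)
  ultimately show False using \<open>\<kappa> \<noteq> 0\<close> by (simp add: power2_eq_iff_nonneg)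
qed

text \<open>Rescaling multiplies both squares by the same positive number, so the comparison
  descends to points, and on the cone it is the preimage of the positive numbers under a continuous
  function.\<close>

lemma openin_real_proj_comparison:
  assumes "i \<le> n" "k \<le> n"
  shows "openin (real_proj_topology n) {p \<in> proj_space n. \<forall>v\<in>p. (v i)\<^sup>2 < (v k)\<^sup>2}"
  unfolding openin_real_proj_topology
proof
  have pt: "(\<forall>w\<in>pt v. (w i)\<^sup>2 < (w k)\<^sup>2) \<longleftrightarrow> (v i)\<^sup>2 < (v k)\<^sup>2" for v :: "nat \<Rightarrow> real"
  proof
    assume "\<forall>w\<in>pt v. (w i)\<^sup>2 < (w k)\<^sup>2"
    then show "(v i)\<^sup>2 < (v k)\<^sup>2" using in_pt_self by blast
  next
    assume v: "(v i)\<^sup>2 < (v k)\<^sup>2"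
    show "\<forall>w\<in>pt v. (w i)\<^sup>2 < (w k)\<^sup>2"
    proof
      fix w assume "w \<in> pt v"
      then obtain c where "c \<noteq> 0" "w = (\<lambda>i. c * v i)" by (rule in_ptE)
      then show "(w i)\<^sup>2 < (w k)\<^sup>2" using v by (simp add: power_mult_distrib)
    qed
  qed
  \<comment> \<open>The strict inequality already excludes the zero vector.\<close>
  have "{v \<in> coord_vecs n. pt v \<in> {p \<in> proj_space n. \<forall>v\<in>p. (v i)\<^sup>2 < (v k)\<^sup>2}} =
      {v \<in> topspace (Euclidean_space (Suc n)). (v k)\<^sup>2 - (v i)\<^sup>2 \<in> {0::real<..}}"
    using assms by (auto simp: pt coord_vecs_def proj_space_def topspace_Euclidean_space Suc_le_eq)
  moreover have "openin (Euclidean_space (Suc n))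
      {v \<in> topspace (Euclidean_space (Suc n)). (v k)\<^sup>2 - (v i)\<^sup>2 \<in> {0::real<..}}"
  proof (rule openin_continuous_map_preimage)
    have "continuous_map (Euclidean_space (Suc n)) euclideanreal (\<lambda>v. v l)" for l
      unfolding Euclidean_space_def
      by (rule continuous_map_from_subtopology) (rule continuous_map_product_projection, simp)
    then show "continuous_map (Euclidean_space (Suc n)) euclideanreal (\<lambda>v. (v k)\<^sup>2 - (v i)\<^sup>2)"
      by (intro continuous_intros)
  qed simp
  ultimately show "openin (Euclidean_space (Suc n))
      {v \<in> coord_vecs n. pt v \<in> {p \<in> proj_space n. \<forall>v\<in>p. (v i)\<^sup>2 < (v k)\<^sup>2}}" by simp
qed blast

text \<open>The matrices \<open>x x^*\<close> of (1, 0, 2, 0) and (0, 1, 0, 2). The indices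
  \<open>5 * j\<close>, \<open>5 * j + 2\<close>, \<open>5 * j + 10\<close> are the places
  \<open>(j, j)\<close>, \<open>(j, j + 2)\<close>, \<open>(j + 2, j + 2)\<close>; the place
  \<open>(j + 2, j)\<close> stores an imaginary part and stays 0.\<close>

lemma real_locus_points:
  fixes v :: "nat \<Rightarrow> real"
  assumes "j \<in> {0, 1}" and v: "v = (\<lambda>_. 0)(5 * j := 1, 5 * j + 2 := 2, 5 * j + 10 := 4)"
  shows "v \<in> coord_vecs 15" "pt v \<in> real_locus 15 example_variety"
proof -
  show vc: "v \<in> coord_vecs 15" using assms by (auto simp: coord_vecs_def fun_eq_iff)
  let ?x = "\<lambda>i. if i = j then 1 else if i = j + 2 then 2 else 0 :: complex"
  have cone: "in_cone net ?x ?x"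
    unfolding in_cone_def all_less_3 bilin_net ex_less_4 using assms(1) by auto
  have herm: "herm (\<lambda>i. complex_of_real (v i)) l = segre ?x ?x l" for l
  proof (cases "l \<le> 15")
    case True
    then have "l \<in> {..<16}" by simp
    also have "{..<16::nat} = {0, 1, 2, 3, 4, 5, 6, 7, 8, 9, 10, 11, 12, 13, 14, 15}"
      by (auto simp: lessThan_nat_numeral lessThan_Suc)
    finally have "l \<in> {0, 1, 2, 3, 4, 5, 6, 7, 8, 9, 10, 11, 12, 13, 14, 15}" .
    then show ?thesis using assms by (elim insertE emptyE) (simp_all add: herm_def segre_def swap_index_def)
  next
    case False
    then show ?thesis using vc by (simp add: herm_def segre_def coord_vecs_def)
  qed
  have "pt (\<lambda>i. complex_of_real (v i)) \<in> example_variety"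
  proof (rule example_varietyI[OF _ cone])
    show "(\<lambda>i. complex_of_real (v i)) \<in> coord_vecs 15" using vc by (auto simp: coord_vecs_def fun_eq_iff)
  qed (use herm in blast)
  then show "pt v \<in> real_locus 15 example_variety" unfolding real_locus_def using vc by blast
qed

lemma example_variety_disconnected:
  "\<not> connected_space (subtopology (real_proj_topology 15) (real_locus 15 example_variety))"
proof -
  let ?R = "real_locus 15 example_variety"
  let ?U = "{p \<in> proj_space 15. \<forall>v\<in>p. (v 10)\<^sup>2 < (v 15 :: real)\<^sup>2}"
  let ?V = "{p \<in> proj_space 15. \<forall>v\<in>p. (v 15)\<^sup>2 < (v 10 :: real)\<^sup>2}"
  have R: "?R \<subseteq> proj_space 15" unfolding real_locus_def proj_space_def by blast
  have cover: "?R \<subseteq> ?U \<union> ?V"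
  proof
    fix p assume p: "p \<in> ?R"
    then obtain v where v: "v \<in> coord_vecs 15" "p = pt v" "pt (\<lambda>i. complex_of_real (v i)) \<in> example_variety"
      unfolding real_locus_def by blast
    then have "(v 10)\<^sup>2 \<noteq> (v 15)\<^sup>2" using real_point_separation by blast
    then have "(v 10)\<^sup>2 < (v 15)\<^sup>2 \<or> (v 15)\<^sup>2 < (v 10)\<^sup>2" by linarith
    then show "p \<in> ?U \<union> ?V" using p R unfolding v(2) by (auto simp: pt_def power_mult_distrib)
  qed
  have disj: "?U \<inter> ?V = {}"
  proof -
    have False if p: "p \<in> ?U" "p \<in> ?V" for p
    proof -
      obtain v where "p = pt v" using p(1) unfolding proj_space_def by blast
      then have "v \<in> p" using in_pt_self by simp
      then have "(v 10)\<^sup>2 < (v 15)\<^sup>2" "(v 15)\<^sup>2 < (v 10)\<^sup>2" using p by auto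
      then show False by simp
    qed
    then show ?thesis by blast
  qed
  have open_U: "openin (real_proj_topology 15) ?U" "openin (real_proj_topology 15) ?V"
    by (intro openin_real_proj_comparison; simp)+
  note pts = real_locus_points[of 0, OF _ refl] real_locus_points[of 1, OF _ refl]
  have "?R \<inter> ?V \<noteq> {}" "?R \<inter> ?U \<noteq> {}"
  proof -
    \<comment> \<open>Here entry 10 is 4 and entry 15 is 0; for the second point it is the other way
      round.\<close>
    let ?v = "(\<lambda>_. 0)(5 * 0 := 1, 5 * 0 + 2 := 2, 5 * 0 + 10 := 4) :: nat \<Rightarrow> real"
    have "pt ?v \<in> ?R \<inter> ?V" using pts(2) R by (auto simp: pt_def power_mult_distrib)
    then show "?R \<inter> ?V \<noteq> {}" by blast
    let ?v = "(\<lambda>_. 0)(5 * 1 := 1, 5 * 1 + 2 := 2, 5 * 1 + 10 := 4) :: nat \<Rightarrow> real"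
    have "pt ?v \<in> ?R \<inter> ?U" using pts(4) R by (auto simp: pt_def power_mult_distrib)
    then show "?R \<inter> ?U \<noteq> {}" by blast
  qed
  then have nonempty: "?R \<inter> ?U \<noteq> {}" "?R \<inter> ?V \<noteq> {}" by blast+
  have top: "topspace (subtopology (real_proj_topology 15) ?R) = ?R"
    using R by (simp add: topspace_real_proj_topology Int_absorb1)
  have opens: "openin (subtopology (real_proj_topology 15) ?R) (?R \<inter> ?U)"
    "openin (subtopology (real_proj_topology 15) ?R) (?R \<inter> ?V)"
    using open_U by (auto simp: openin_subtopology)
  have "topspace (subtopology (real_proj_topology 15) ?R) \<subseteq> (?R \<inter> ?U) \<union> (?R \<inter> ?V)"
    unfolding top using cover by blast
  moreover have "(?R \<inter> ?U) \<inter> (?R \<inter> ?V) = {}" using disj by blast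
  ultimately show ?thesis
    unfolding connected_space_def not_not
    by (intro exI[of _ "?R \<inter> ?U"] exI[of _ "?R \<inter> ?V"] conjI opens nonempty)
qed

theorem proposition3p16:
  shows "\<exists>n X. real_variety n X \<and> smooth_fano 3 n X \<and> family_2_12 n X \<and>
           \<not> connected_space (subtopology (real_proj_topology n) (real_locus n X))"
  using example_variety_real example_variety_disconnected
    net.pullback_fano(1)[OF herm_iso] net.pullback_fano(2)[OF herm_iso]
  unfolding example_variety_def[symmetric] by blast

end
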